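(* Fix an integer $N>0$. The nonlinear system for $(v_1,\dots,v_N)$ given, for each $m\in\{1,\dots,N\}$, by $$L v_m(\mathbf{x})-\sum_{n=1}^N s_{mn}v_n(\mathbf{x})-\frac{Lf(\mathbf{x})}{f(\mathbf{x})}v_m(\mathbf{x})+\sum_{n=1}^N\frac{\Psi_n(0)}{f(\mathbf{x})}v_n(\mathbf{x})v_m(\mathbf{x})=0\quad\text{for }\mathbf{x}\in\Omega,$$ $$v_m(\mathbf{x})=F_m(\mathbf{x}),\qquad \partial_\nu v_m(\mathbf{x})=G_m(\mathbf{x})\quad\text{for }\mathbf{x}\in\partial\Omega,$$ has at most one solution $(v_1,\dots,v_N)$ with all components in $H^2(\Omega)\cap L^\infty(\Omega)$.
   Context: Let $d\ge 2$, $R>0$, $\Omega=(-R,R)^d\subset\mathbb{R}^d$, $T>0$, and let $\nu$ be the outward unit normal on $\partial\Omega$, $\partial_\nu w=\nabla w\cdot\nu$. Let $A\in C^\infty(\mathbb{R}^d,\mathbb{R}^{d\times d})$ be symmetric, uniformly elliptic (there is $\mu>0$ with $A(\mathbf{x})\xi\cdot\xi\ge\mu|\xi|^2$ for all $\mathbf{x},\xi\in\mathbb{R}^d$), with $A(\mathbf{x})=\mathrm{Id}$ for all $\mathbf{x}\in\mathbb{R}^d\setminus\Omega$. Let $\mathbf{b}\in C^\infty(\mathbb{R}^d,\mathbb{R}^d)$ and $Lw=\mathrm{div}(A\nabla w)+\mathbf{b}\cdot\nabla w$. Let $f\in C_0^\infty(\mathbb{R}^d)$ be strictly positive on $\overline\Omega$.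 Basis: $\{\Psi_n\}_{n\ge1}$ is the orthonormal basis of $L^2(0,T)$ obtained by Gram-Schmidt orthonormalization of $\phi_n(t)=(t-T/2)^{n-1}\exp(t-T/2)$, $n\ge1$; and $s_{mn}=\int_0^T\Psi_n'(t)\Psi_m(t)\,dt$. Data: $u$ is the solution of $u_t=Lu+c(\mathbf{x})u$ in $\mathbb{R}^d\times(0,\infty)$, $u(\mathbf{x},0)=f(\mathbf{x})$, for some coefficient $c(\mathbf{x})$, assumed regular enough that the following are defined: $F=u$ and $G=A\nabla u\cdot\nu$ on $\partial\Omega\times[0,T]$, $F_m(\mathbf{x})=\int_0^T F_t(\mathbf{x},t)\Psi_m(t)\,dt$ and $G_m(\mathbf{x})=\int_0^T G_t(\mathbf{x},t)\Psi_m(t)\,dt$ for $\mathbf{x}\in\partial\Omega$. For $H^2(\Omega)$ solutions, the equations hold almost everywhere in $\Omega$ and the boundary conditions hold in the sense of traces. *)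

theory Defs
  imports "HOL-Analysis.Analysis"
begin

section \<open>Classical derivatives and the operator \<open>L\<close>\<close>

definition partial :: "'n \<Rightarrow> (real^'n \<Rightarrow> real) \<Rightarrow> real^'n \<Rightarrow> real"
  where "partial i f x = frechet_derivative f (at x) (axis i 1)"

text \<open>\<open>C\<^sup>\<infinity>\<close> on the whole space: all iterated partial derivatives exist and are (Frechet)
  differentiable, hence continuous.\<close>

definition smooth :: "(real^'n \<Rightarrow> real) \<Rightarrow> bool"
  where "smooth f \<longleftrightarrow> (\<forall>is x. foldr partial is f differentiable at x)"

definition support :: "(real^'n \<Rightarrow> real) \<Rightarrow> (real^'n) set"
  where "support f = closure {x. f x \<noteq> 0}"

text \<open>Gradient, divergence and \<open>L w = div (A \<nabla>w) + b \<cdot> \<nabla>w\<close> are parametrised by the partial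
  derivatives \<open>D i\<close> they are built from: \<open>partial\<close> for classical derivatives, or \<open>wpartial \<Omega>\<close>
  (below) for weak ones.\<close>

definition grad :: "('n \<Rightarrow> (real^'n \<Rightarrow> real) \<Rightarrow> real^'n \<Rightarrow> real)
    \<Rightarrow> (real^'n \<Rightarrow> real) \<Rightarrow> real^'n \<Rightarrow> real^'n"
  where "grad D w x = (\<chi> i. D i w x)"

definition divg :: "('n::finite \<Rightarrow> (real^'n \<Rightarrow> real) \<Rightarrow> real^'n \<Rightarrow> real)
    \<Rightarrow> (real^'n \<Rightarrow> real^'n) \<Rightarrow> real^'n \<Rightarrow> real"
  where "divg D V x = (\<Sum>i\<in>UNIV. D i (\<lambda>y. V y $ i) x)"

definition Lop :: "('n::finite \<Rightarrow> (real^'n \<Rightarrow> real) \<Rightarrow> real^'n \<Rightarrow> real)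
    \<Rightarrow> (real^'n \<Rightarrow> real^'n^'n) \<Rightarrow> (real^'n \<Rightarrow> real^'n)
    \<Rightarrow> (real^'n \<Rightarrow> real) \<Rightarrow> real^'n \<Rightarrow> real"
  where "Lop D A b w x = divg D (\<lambda>y. A y *v grad D w y) x + b x \<bullet> grad D w x"


section \<open>Lebesgue and Sobolev spaces\<close>

definition L2 :: "'a measure \<Rightarrow> ('a \<Rightarrow> real) set"
  where "L2 M = {w \<in> borel_measurable M. integrable M (\<lambda>x. (w x)\<^sup>2)}"

definition Linf :: "'a measure \<Rightarrow> ('a \<Rightarrow> real) set"
  where "Linf M = {w \<in> borel_measurable M. \<exists>C. AE x in M. \<bar>w x\<bar> \<le> C}"

definition tendsto_L2 :: "'a measure \<Rightarrow> (nat \<Rightarrow> 'a \<Rightarrow> real) \<Rightarrow> ('a \<Rightarrow> real) \<Rightarrow> bool"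
  where "tendsto_L2 M \<phi> w \<longleftrightarrow> (\<forall>k. (\<lambda>x. \<phi> k x - w x) \<in> L2 M) \<and>
    (\<lambda>k. \<integral>x. (\<phi> k x - w x)\<^sup>2 \<partial>M) \<longlonglongrightarrow> 0"

definition loc_integrable :: "(real^'n) set \<Rightarrow> (real^'n \<Rightarrow> real) \<Rightarrow> bool"
  where "loc_integrable \<Omega> w \<longleftrightarrow> (\<forall>K. compact K \<and> K \<subseteq> \<Omega> \<longrightarrow> w absolutely_integrable_on K)"

definition has_wpartial ::
    "(real^'n) set \<Rightarrow> 'n \<Rightarrow> (real^'n \<Rightarrow> real) \<Rightarrow> (real^'n \<Rightarrow> real) \<Rightarrow> bool"
  where "has_wpartial \<Omega> i w g \<longleftrightarrow> loc_integrable \<Omega> w \<and> loc_integrable \<Omega> g \<and>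
    (\<forall>\<phi>. smooth \<phi> \<and> compact (support \<phi>) \<and> support \<phi> \<subseteq> \<Omega> \<longrightarrow>
      (\<integral>x. w x * partial i \<phi> x \<partial>lebesgue_on \<Omega>) = - (\<integral>x. g x * \<phi> x \<partial>lebesgue_on \<Omega>))"

text \<open>A representative of the weak derivative, which is unique almost everywhere if it exists;
  unspecified otherwise.\<close>

definition wpartial :: "(real^'n) set \<Rightarrow> 'n \<Rightarrow> (real^'n \<Rightarrow> real) \<Rightarrow> real^'n \<Rightarrow> real"
  where "wpartial \<Omega> i w = (SOME g. has_wpartial \<Omega> i w g)"

text \<open>\<open>H\<^sup>k(\<Omega>)\<close>; its elements are representatives, to be identified almost everywhere.\<close>

primrec sobolev :: "nat \<Rightarrow> (real^'n) set \<Rightarrow> (real^'n \<Rightarrow> real) set"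
  where
    "sobolev 0 \<Omega> = L2 (lebesgue_on \<Omega>)"
  | "sobolev (Suc k) \<Omega> =
      {w \<in> L2 (lebesgue_on \<Omega>). \<forall>i. \<exists>g \<in> sobolev k \<Omega>. has_wpartial \<Omega> i w g}"


section \<open>The cube, its boundary and traces\<close>

definition cube :: "real \<Rightarrow> (real^'n) set"
  where "cube R = box (\<chi> i. - R) (\<chi> i. R)"

text \<open>The boundary of the cube is the union of the \<open>2d\<close> faces \<open>x $ i = \<sigma> R\<close>, \<open>\<sigma> \<in> {-1, 1}\<close>, any two
  of which meet in a null set of the surface measure.  On each face the surface measure is the
  \<open>(d-1)\<close>-dimensional Lebesgue measure in the remaining coordinates, here completed.\<close>

definition face_measure :: "real \<Rightarrow> 'n::finite \<Rightarrow> real \<Rightarrow> (real^'n) measure"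
  where "face_measure R i \<sigma> = completion
    (distr (\<Pi>\<^sub>M j\<in>UNIV - {i}. restrict_space lborel {-R..R}) borel
      (\<lambda>y. \<chi> j. if j = i then \<sigma> * R else y j))"

text \<open>Boundary points in the relative interior of a face, where the normal exists.\<close>

definition face_points :: "real \<Rightarrow> (real^'n) set"
  where "face_points R = {x \<in> frontier (cube R). \<exists>!i. \<bar>x $ i\<bar> = R}"

text \<open>The outward unit normal at \<open>face_points R\<close>.  At the remaining boundary points (a null set)
  the value is a mere convention.\<close>

definition normal :: "real \<Rightarrow> real^'n \<Rightarrow> real^'n"
  where "normal R x = (\<chi> i. if \<bar>x $ i\<bar> = R then sgn (x $ i) else 0)"

text \<open>\<open>\<tau>\<close> is the trace of \<open>w \<in> H\<^sup>1\<close>: the trace operator is the continuous extension to \<open>H\<^sup>1\<close> of the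
  restriction to the boundary of functions smooth up to the boundary.\<close>

definition has_trace :: "real \<Rightarrow> (real^'n::finite \<Rightarrow> real) \<Rightarrow> (real^'n \<Rightarrow> real) \<Rightarrow> bool"
  where "has_trace R w \<tau> \<longleftrightarrow> w \<in> sobolev 1 (cube R) \<and>
    (\<exists>\<phi>. (\<forall>k. smooth (\<phi> k)) \<and>
      tendsto_L2 (lebesgue_on (cube R)) \<phi> w \<and>
      (\<forall>i. tendsto_L2 (lebesgue_on (cube R)) (\<lambda>k. partial i (\<phi> k)) (wpartial (cube R) i w)) \<and>
      (\<forall>i. \<forall>\<sigma>\<in>{-1, 1}. tendsto_L2 (face_measure R i \<sigma>) \<phi> \<tau>))"

text \<open>\<open>\<nabla>w \<cdot> \<nu> = G\<close> on the boundary, for \<open>w \<in> H\<^sup>2\<close> and \<open>\<nabla>w\<close> understood as a trace.\<close>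

definition has_normal_trace :: "real \<Rightarrow> (real^'n::finite \<Rightarrow> real) \<Rightarrow> (real^'n \<Rightarrow> real) \<Rightarrow> bool"
  where "has_normal_trace R w G \<longleftrightarrow>
    (\<exists>\<tau>. (\<forall>j. has_trace R (wpartial (cube R) j w) (\<lambda>x. \<tau> x $ j)) \<and>
      (\<forall>i. \<forall>\<sigma>\<in>{-1, 1}. AE x in face_measure R i \<sigma>. \<tau> x \<bullet> normal R x = G x))"


section \<open>The time basis\<close>

definition phi :: "real \<Rightarrow> nat \<Rightarrow> real \<Rightarrow> real"
  where "phi T n t = (t - T/2) ^ (n - 1) * exp (t - T/2)"

definition ip :: "real \<Rightarrow> (real \<Rightarrow> real) \<Rightarrow> (real \<Rightarrow> real) \<Rightarrow> real"
  where "ip T g h = (\<integral>t. g t * h t \<partial>lebesgue_on {0..T})"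

text \<open>Gram-Schmidt in \<open>L\<^sup>2(0,T)\<close>, indexed from 1; the value at index 0 is irrelevant.\<close>

fun Psi :: "real \<Rightarrow> nat \<Rightarrow> real \<Rightarrow> real"
  where "Psi T n =
    (let p = (\<lambda>t. phi T n t - (\<Sum>k\<in>{1..<n}. ip T (phi T n) (Psi T k) * Psi T k t))
     in (\<lambda>t. p t / sqrt (ip T p p)))"

declare Psi.simps [simp del]

definition smat :: "real \<Rightarrow> nat \<Rightarrow> nat \<Rightarrow> real"
  where "smat T m n = (\<integral>t. deriv (Psi T n) t * Psi T m t \<partial>lebesgue_on {0..T})"


section \<open>The parabolic problem and the lateral Cauchy data\<close>

text \<open>Classical solutions of \<open>u\<^sub>t = L u + c u\<close> for \<open>t > 0\<close> with \<open>u(\<cdot>,0) = f\<close>.\<close>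

definition parabolic_solution :: "(real^'n::finite \<Rightarrow> real^'n^'n) \<Rightarrow> (real^'n \<Rightarrow> real^'n)
    \<Rightarrow> (real^'n \<Rightarrow> real) \<Rightarrow> (real^'n \<Rightarrow> real) \<Rightarrow> (real^'n \<Rightarrow> real \<Rightarrow> real) \<Rightarrow> bool"
  where "parabolic_solution A b c f u \<longleftrightarrow>
    continuous_on (UNIV \<times> {0..}) (\<lambda>(x, t). u x t) \<and>
    (\<forall>x. u x 0 = f x) \<and>
    (\<forall>t>0. \<forall>x. (\<lambda>y. u y t) differentiable at x \<and>
      (\<forall>i. partial i (\<lambda>y. u y t) differentiable at x) \<and>
      (u x has_real_derivative Lop partial A b (\<lambda>y. u y t) x + c x * u x t) (at t))"

text \<open>\<open>G = A \<nabla>u \<cdot> \<nu>\<close>; the Dirichlet datum \<open>F\<close> is \<open>u\<close> itself.\<close>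

definition flux :: "real \<Rightarrow> (real^'n::finite \<Rightarrow> real^'n^'n) \<Rightarrow> (real^'n \<Rightarrow> real \<Rightarrow> real)
    \<Rightarrow> real^'n \<Rightarrow> real \<Rightarrow> real"
  where "flux R A u x t = (A x *v grad partial (\<lambda>y. u y t) x) \<bullet> normal R x"

text \<open>\<open>\<integral>\<^sub>0\<^sup>T g'(t) \<Psi>\<^sub>m(t) dt\<close>, and the condition under which it is meaningful.  The two-sided derivative
  matters only for \<open>0 < t < T\<close>.\<close>

definition time_coeff :: "real \<Rightarrow> nat \<Rightarrow> (real \<Rightarrow> real) \<Rightarrow> real"
  where "time_coeff T m g = (\<integral>t. deriv g t * Psi T m t \<partial>lebesgue_on {0..T})"

definition time_coeff_defined :: "real \<Rightarrow> nat \<Rightarrow> (real \<Rightarrow> real) \<Rightarrow> bool"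
  where "time_coeff_defined T m g \<longleftrightarrow> (\<forall>t\<in>{0<..<T}. g differentiable at t) \<and>
    integrable (lebesgue_on {0..T}) (\<lambda>t. deriv g t * Psi T m t)"


section \<open>The nonlinear boundary value problem\<close>

definition system_solution :: "real \<Rightarrow> real \<Rightarrow> (real^'n::finite \<Rightarrow> real^'n^'n)
    \<Rightarrow> (real^'n \<Rightarrow> real^'n) \<Rightarrow> (real^'n \<Rightarrow> real) \<Rightarrow> nat
    \<Rightarrow> (nat \<Rightarrow> real^'n \<Rightarrow> real) \<Rightarrow> (nat \<Rightarrow> real^'n \<Rightarrow> real)
    \<Rightarrow> (nat \<Rightarrow> real^'n \<Rightarrow> real) \<Rightarrow> bool"
  where "system_solution R T A b f N F G v \<longleftrightarrow> (\<forall>m\<in>{1..N}.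
    v m \<in> sobolev 2 (cube R) \<inter> Linf (lebesgue_on (cube R)) \<and>
    (AE x in lebesgue_on (cube R).
      Lop (wpartial (cube R)) A b (v m) x
      - (\<Sum>n=1..N. smat T m n * v n x)
      - Lop partial A b f x / f x * v m x
      + (\<Sum>n=1..N. Psi T n 0 / f x * v n x * v m x) = 0) \<and>
    has_trace R (v m) (F m) \<and>
    has_normal_trace R (v m) (G m))"

end

(* The difference h of two solutions satisfies |a_ij d_ij h_m| <= C (|grad h_m| + sum_n |h_n|) and has
   zero Cauchy data.  All computations are carried out directly on H^2 functions: zero Cauchy data is
   encoded by integration by parts without boundary terms, which the traces provide by the divergence
   theorem on smooth approximants.

   Uniqueness then follows from a Carleman estimate with weight exp (lambda exp (beta x_k)).  For
   w = exp (lambda exp (beta x_k)) h and r = lambda beta exp (beta x_k), put p = a_kk, Q = a_kj d_j w,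
   Y = a_ij d_ij w + r^2 p w and let P w be the conjugated operator.  Then
   P w + beta r p w = Y - 2 r Q, so (P w + beta r p w)^2 / r >= Y^2 / r - 4 Q Y.  Dividing by r makes the
   term Q a_ij d_ij w free of the weight, so that it costs only a multiple of |grad w|^2, while
   -4 r^2 p w Q integrates to 4 beta r^2 p^2 w^2 up to lower order.  Testing Y against w recovers the
   gradient.  The result is int r^2 w^2 + |grad w|^2 <= int 2 (P w)^2 / r, and lambda large absorbs
   the right hand side. *)

theory Submission
  imports Defs
begin

text \<open>The obstacle is regularity: \<open>wpartial\<close> is only a choice among
  almost-everywhere equal functions, and the data control a single normal component of the gradient
  on each face. Integrating second derivatives by parts freely needs every component of the gradient
  to have zero trace. So weak gradients are carried as explicit families approximated by C1
  functions, and the tangential traces are shown to vanish before any estimate begins. Because the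
  Cauchy data of the difference vanish on the whole boundary, no boundary term survives and the
  weight needs no adapted level sets: any coordinate direction serves. The convexity parameter
  \<open>\<beta>\<close> is fixed first, from the ellipticity constant and bounds on the
  coefficients, and no constant entering it may depend on the large parameter. Only then is the
  latter chosen, depending on the number of equations and the lower-order bound. The essential
  bounds of both solutions turn the quadratic terms of the difference into linear ones with bounded
  coefficients.\<close>

section \<open>Square-integrable functions and strong convergence\<close>

lemma L2D: "f \<in> L2 M \<Longrightarrow> f \<in> borel_measurable M" "f \<in> L2 M \<Longrightarrow> integrable M (\<lambda>x. (f x)\<^sup>2)"
  by (auto simp: L2_def)

lemma L2_integrable_mult:
  assumes "f \<in> L2 M" "g \<in> L2 M"
  shows "integrable M (\<lambda>x. f x * g x)"
proof (rule Bochner_Integration.integrable_bound)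
  show "integrable M (\<lambda>x. (f x)\<^sup>2 + (g x)\<^sup>2)" using assms by (auto simp: L2_def)
  show "(\<lambda>x. f x * g x) \<in> borel_measurable M" using assms by (auto simp: L2_def)
  have "\<bar>a * b\<bar> \<le> a\<^sup>2 + b\<^sup>2" for a b :: real
  proof -
    have "2 * \<bar>a * b\<bar> \<le> a\<^sup>2 + b\<^sup>2"
      using sum_squares_bound[of "\<bar>a\<bar>" "\<bar>b\<bar>"] by (simp add: abs_mult)
    then show ?thesis by linarith
  qed
  then show "AE x in M. norm (f x * g x) \<le> norm ((f x)\<^sup>2 + (g x)\<^sup>2)"
    by (auto intro!: AE_I2)
qed

lemma L2_bounded_mult:
  assumes "f \<in> L2 M" and [measurable]: "a \<in> borel_measurable M" and "AE x in M. \<bar>a x\<bar> \<le> C"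
  shows "(\<lambda>x. a x * f x) \<in> L2 M"
proof -
  have [measurable]: "f \<in> borel_measurable M" using assms by (auto simp: L2_def)
  have "integrable M (\<lambda>x. (a x * f x)\<^sup>2)"
  proof (rule Bochner_Integration.integrable_bound)
    show "integrable M (\<lambda>x. C\<^sup>2 * (f x)\<^sup>2)" using assms by (auto simp: L2_def)
    show "AE x in M. norm ((a x * f x)\<^sup>2) \<le> norm (C\<^sup>2 * (f x)\<^sup>2)"
      using assms(3)
    proof eventually_elim
      case (elim x)
      then have "(a x)\<^sup>2 \<le> C\<^sup>2" by (rule power2_le_iff_abs_le[THEN iffD2, rotated]) (use elim in linarith)
      then show ?case by (simp add: power_mult_distrib mult_right_mono)
    qed
  qed measurable
  then show ?thesis by (auto simp: L2_def)
qed

lemma L2_add: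
  assumes "f \<in> L2 M" "g \<in> L2 M"
  shows "(\<lambda>x. f x + g x) \<in> L2 M"
proof -
  have [measurable]: "f \<in> borel_measurable M" "g \<in> borel_measurable M" using assms by (auto simp: L2_def)
  have "integrable M (\<lambda>x. (f x)\<^sup>2 + (g x)\<^sup>2 + 2 * (f x * g x))"
    using assms L2_integrable_mult[OF assms] by (auto simp: L2_def)
  then show ?thesis by (auto simp: L2_def power2_sum mult.assoc)
qed

lemma L2_cmult: "f \<in> L2 M \<Longrightarrow> (\<lambda>x. c * f x) \<in> L2 M"
  by (rule L2_bounded_mult[where C="\<bar>c\<bar>"]) auto

lemma L2_diff: "f \<in> L2 M \<Longrightarrow> g \<in> L2 M \<Longrightarrow> (\<lambda>x. f x - g x) \<in> L2 M"
  using L2_add[of f M "\<lambda>x. -1 * g x"] L2_cmult[of g M "-1"] by simp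

lemma L2_sum: "(\<And>i. i \<in> I \<Longrightarrow> f i \<in> L2 M) \<Longrightarrow> (\<lambda>x. \<Sum>i\<in>I. f i x) \<in> L2 M"
  by (induction I rule: infinite_finite_induct) (auto simp: L2_add, auto simp: L2_def)

lemma tendsto_L2_mem:
  assumes "tendsto_L2 M \<phi> w" "\<And>k. \<phi> k \<in> L2 M"
  shows "w \<in> L2 M"
  using L2_diff[of "\<phi> 0" M "\<lambda>x. \<phi> 0 x - w x"] assms by (simp add: tendsto_L2_def)

text \<open>Strong convergence implies weak convergence; every integral identity passes from smooth
  approximants to Sobolev functions through this. A weighted Young inequality takes the place of
  Cauchy-Schwarz.\<close>

lemma tendsto_L2_integral:
  assumes t: "tendsto_L2 M \<phi> w" and w: "w \<in> L2 M" and u: "u \<in> L2 M"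
  shows "(\<lambda>k. \<integral>x. \<phi> k x * u x \<partial>M) \<longlonglongrightarrow> (\<integral>x. w x * u x \<partial>M)"
proof (rule LIMSEQ_I)
  fix e :: real assume e: "e > 0"
  define U where "U = (\<integral>x. (u x)\<^sup>2 \<partial>M)"
  have U: "U \<ge> 0" by (simp add: U_def)
  \<comment> \<open>The weight in Young's inequality: \<open>d * U\<close> stays below
    \<open>e / 2\<close>, and the +1 keeps the denominator positive when \<open>u\<close>
    vanishes.\<close>
  define d where "d = e / (2 * (U + 1))"
  have d: "d > 0" using e U by (simp add: d_def)
  have dU: "d * U < e / 2"
    using e U by (simp add: d_def field_simps)
  have "(\<lambda>k. \<integral>x. (\<phi> k x - w x)\<^sup>2 \<partial>M) \<longlonglongrightarrow> 0" using t by (simp add: tendsto_L2_def)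
  then obtain K where K: "\<And>k. k \<ge> K \<Longrightarrow> norm ((\<integral>x. (\<phi> k x - w x)\<^sup>2 \<partial>M) - 0) < d * e / 2"
    using LIMSEQ_D[of "\<lambda>k. \<integral>x. (\<phi> k x - w x)\<^sup>2 \<partial>M" 0 "d*e/2"] d e by auto
  have "norm ((\<integral>x. \<phi> k x * u x \<partial>M) - (\<integral>x. w x * u x \<partial>M)) < e" if "k \<ge> K" for k
  proof -
    let ?f = "\<lambda>x. \<phi> k x - w x"
    have f: "?f \<in> L2 M" using t by (simp add: tendsto_L2_def)
    have phi: "\<phi> k \<in> L2 M" using L2_add[OF f w] by simp
    have "(\<integral>x. \<phi> k x * u x \<partial>M) - (\<integral>x. w x * u x \<partial>M) = (\<integral>x. ?f x * u x \<partial>M)"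
      by (subst Bochner_Integration.integral_diff[symmetric])
        (auto intro: L2_integrable_mult phi w u simp: left_diff_distrib)
    also have "norm \<dots> \<le> (\<integral>x. norm (?f x * u x) \<partial>M)" by (rule integral_norm_bound)
    also have "\<dots> \<le> (\<integral>x. (1/d) * (?f x)\<^sup>2 + d * (u x)\<^sup>2 \<partial>M)"
    proof (rule integral_mono)
      show "integrable M (\<lambda>x. norm (?f x * u x))" using L2_integrable_mult[OF f u] by auto
      show "integrable M (\<lambda>x. (1/d) * (?f x)\<^sup>2 + d * (u x)\<^sup>2)" using f u by (auto simp: L2_def)
      fix x
      have "\<bar>a * b\<bar> \<le> a\<^sup>2 / d + d * b\<^sup>2" for a b
      proof -
        have "0 \<le> (\<bar>a\<bar> - d * \<bar>b\<bar>)\<^sup>2" by simp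
        then have "2 * d * (\<bar>a\<bar> * \<bar>b\<bar>) \<le> a\<^sup>2 + d\<^sup>2 * b\<^sup>2"
          by (simp add: power2_eq_square algebra_simps)
        moreover have "0 \<le> d * (\<bar>a\<bar> * \<bar>b\<bar>)" using d by simp
        ultimately have "d * (\<bar>a\<bar> * \<bar>b\<bar>) \<le> a\<^sup>2 + d\<^sup>2 * b\<^sup>2" by linarith
        then show ?thesis using d by (simp add: abs_mult field_simps power2_eq_square)
      qed
      then show "norm (?f x * u x) \<le> (1/d) * (?f x)\<^sup>2 + d * (u x)\<^sup>2" by simp
    qed
    also have "\<dots> = (1/d) * (\<integral>x. (?f x)\<^sup>2 \<partial>M) + d * U"
      using f u by (subst Bochner_Integration.integral_add) (auto simp: L2_def U_def)
    also have "\<dots> < e"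
    proof -
      have "(\<integral>x. (?f x)\<^sup>2 \<partial>M) < d * e / 2" using K[OF that] by simp
      then have "(1/d) * (\<integral>x. (?f x)\<^sup>2 \<partial>M) < e / 2" using d by (simp add: field_simps)
      then show ?thesis using dU by linarith
    qed
    finally show ?thesis .
  qed
  then show "\<exists>no. \<forall>n\<ge>no. norm ((\<integral>x. \<phi> n x * u x \<partial>M) - (\<integral>x. w x * u x \<partial>M)) < e" by blast
qed

text \<open>Integrable majorants with vanishing integrals suffice; limits of products and sums then
  reduce to pointwise inequalities.\<close>

lemma tendsto_L2I:
  assumes L: "\<And>k. (\<lambda>x. \<phi> k x - w x) \<in> L2 M" and c: "\<And>k. integrable M (c k)"
    and le: "\<And>k. AE x in M. (\<phi> k x - w x)\<^sup>2 \<le> c k x" and lim: "(\<lambda>k. \<integral>x. c k x \<partial>M) \<longlonglongrightarrow> 0"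
  shows "tendsto_L2 M \<phi> w"
  unfolding tendsto_L2_def
proof (intro conjI allI L tendsto_sandwich[OF _ _ tendsto_const lim] always_eventually)
  show "(\<integral>x. (\<phi> k x - w x)\<^sup>2 \<partial>M) \<le> (\<integral>x. c k x \<partial>M)" for k
    by (rule integral_mono_AE[OF L2D(2)[OF L] c le])
qed simp

lemma tendsto_L2_bounded_mult:
  assumes t: "tendsto_L2 M \<phi> w" and a: "a \<in> borel_measurable M" "AE x in M. \<bar>a x\<bar> \<le> C"
  shows "tendsto_L2 M (\<lambda>k x. a x * \<phi> k x) (\<lambda>x. a x * w x)"
proof (rule tendsto_L2I)
  have L: "(\<lambda>x. \<phi> k x - w x) \<in> L2 M" for k using t by (simp add: tendsto_L2_def)
  show "(\<lambda>x. a x * \<phi> k x - a x * w x) \<in> L2 M" for k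
    using L2_bounded_mult[OF L a] by (simp add: right_diff_distrib)
  show "integrable M (\<lambda>x. C\<^sup>2 * (\<phi> k x - w x)\<^sup>2)" for k using L2D(2)[OF L[of k]] by auto
  show "AE x in M. (a x * \<phi> k x - a x * w x)\<^sup>2 \<le> C\<^sup>2 * (\<phi> k x - w x)\<^sup>2" for k
    using a(2)
  proof eventually_elim
    case (elim x)
    then have "(a x)\<^sup>2 \<le> C\<^sup>2" by (rule power2_le_iff_abs_le[THEN iffD2, rotated]) (use elim in linarith)
    then show ?case by (simp add: power_mult_distrib mult_right_mono flip: right_diff_distrib)
  qed
  show "(\<lambda>k. \<integral>x. C\<^sup>2 * (\<phi> k x - w x)\<^sup>2 \<partial>M) \<longlonglongrightarrow> 0"
    using t tendsto_mult_right_zero by (auto simp: tendsto_L2_def)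
qed

lemma tendsto_L2_add:
  assumes "tendsto_L2 M \<phi> w" "tendsto_L2 M \<phi>' w'"
  shows "tendsto_L2 M (\<lambda>k x. \<phi> k x + \<phi>' k x) (\<lambda>x. w x + w' x)"
proof (rule tendsto_L2I)
  have L: "(\<lambda>x. \<phi> k x - w x) \<in> L2 M" and L': "(\<lambda>x. \<phi>' k x - w' x) \<in> L2 M" for k
    using assms by (auto simp: tendsto_L2_def)
  show "(\<lambda>x. \<phi> k x + \<phi>' k x - (w x + w' x)) \<in> L2 M" for k
    using L2_add[OF L L'] by (simp add: algebra_simps)
  show "integrable M (\<lambda>x. 2 * (\<phi> k x - w x)\<^sup>2 + 2 * (\<phi>' k x - w' x)\<^sup>2)" for k
    using L2D(2)[OF L[of k]] L2D(2)[OF L'[of k]] by auto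
  have "(a + b)\<^sup>2 \<le> 2 * a\<^sup>2 + 2 * b\<^sup>2" for a b :: real
    using sum_squares_bound[of a b] by (simp add: power2_sum)
  then show "AE x in M. (\<phi> k x + \<phi>' k x - (w x + w' x))\<^sup>2 \<le> 2 * (\<phi> k x - w x)\<^sup>2 + 2 * (\<phi>' k x - w' x)\<^sup>2" for k
    by (intro AE_I2) (metis add_diff_add)
  have "(\<lambda>k. 2 * (\<integral>x. (\<phi> k x - w x)\<^sup>2 \<partial>M) + 2 * (\<integral>x. (\<phi>' k x - w' x)\<^sup>2 \<partial>M)) \<longlonglongrightarrow> 0"
    using assms by (auto simp: tendsto_L2_def intro!: tendsto_add_zero tendsto_mult_right_zero)
  then show "(\<lambda>k. \<integral>x. 2 * (\<phi> k x - w x)\<^sup>2 + 2 * (\<phi>' k x - w' x)\<^sup>2 \<partial>M) \<longlonglongrightarrow> 0"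
    using L2D(2)[OF L] L2D(2)[OF L'] by (simp add: Bochner_Integration.integral_add)
qed

lemma tendsto_L2_diff:
  assumes "tendsto_L2 M \<phi> w" "tendsto_L2 M \<phi>' w'"
  shows "tendsto_L2 M (\<lambda>k x. \<phi> k x - \<phi>' k x) (\<lambda>x. w x - w' x)"
  using tendsto_L2_add[OF assms(1) tendsto_L2_bounded_mult[OF assms(2), of "\<lambda>_. -1" 1]] by simp

section \<open>Continuously differentiable functions\<close>

text \<open>The gradient is a parameter instead of being computed with \<open>partial\<close>:
  product and chain rules then yield explicit derivative families, which is the form that
  \<open>H1_approx\<close> and the integrations by parts consume.\<close>

definition C1_grad :: "(real^'n::finite \<Rightarrow> real) \<Rightarrow> ('n \<Rightarrow> real^'n \<Rightarrow> real) \<Rightarrow> bool"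
  where "C1_grad a da \<longleftrightarrow> (\<forall>x. (a has_derivative (\<lambda>v. \<Sum>i\<in>UNIV. da i x * v $ i)) (at x)) \<and>
    (\<forall>i. continuous_on UNIV (da i))"

lemma C1_grad_continuous: "C1_grad a da \<Longrightarrow> continuous_on UNIV a"
  unfolding C1_grad_def
  by (meson continuous_at_imp_continuous_on has_derivative_continuous)

lemma C1_grad_continuous': "C1_grad a da \<Longrightarrow> continuous_on UNIV (da i)"
  by (auto simp: C1_grad_def)

lemma C1_grad_partial:
  assumes "C1_grad a da" shows "partial i a x = da i x"
proof -
  have "frechet_derivative a (at x) = (\<lambda>v. \<Sum>i\<in>UNIV. da i x * v $ i)"
    using assms by (metis C1_grad_def frechet_derivative_at)
  then show ?thesis by (simp add: partial_def axis_def if_distrib cong: if_cong)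
qed

lemma smooth_partial: "smooth f \<Longrightarrow> smooth (partial i f)"
  unfolding smooth_def
proof (intro allI)
  fix "is" x assume "\<forall>is x. foldr partial is f differentiable at x"
  then have "foldr partial (is @ [i]) f differentiable at x" by blast
  then show "foldr partial is (partial i f) differentiable at x" by simp
qed

lemma smooth_differentiable: "smooth f \<Longrightarrow> f differentiable at x"
  unfolding smooth_def by (metis foldr_Nil id_apply)

lemma smooth_continuous: "smooth f \<Longrightarrow> continuous_on S f"
  by (meson continuous_at_imp_continuous_on differentiable_imp_continuous_within smooth_differentiable)

lemma C1_grad_smooth:
  assumes "smooth f" shows "C1_grad f (\<lambda>i. partial i f)"
proof -
  have "(f has_derivative (\<lambda>v. \<Sum>i\<in>UNIV. partial i f x * v $ i)) (at x)" for x
  proof -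
    let ?D = "frechet_derivative f (at x)"
    have d: "(f has_derivative ?D) (at x)"
      using smooth_differentiable[OF assms] frechet_derivative_works by blast
    interpret D: bounded_linear ?D using d by (rule has_derivative_bounded_linear)
    have "?D v = (\<Sum>i\<in>UNIV. partial i f x * v $ i)" for v
    proof -
      have "?D v = ?D (\<Sum>i\<in>UNIV. v $ i *\<^sub>R axis i 1)"
        by (simp add: basis_expansion flip: scalar_mult_eq_scaleR)
      also have "\<dots> = (\<Sum>i\<in>UNIV. v $ i *\<^sub>R ?D (axis i 1))" by (simp add: D.sum D.scaleR)
      finally show ?thesis by (simp add: partial_def mult.commute)
    qed
    with d show ?thesis by (rule has_derivative_eq_rhs[OF _ ext])
  qed
  then show ?thesis unfolding C1_grad_def
    using smooth_continuous[OF smooth_partial[OF assms]] by auto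
qed

lemma C1_grad_mult:
  assumes "C1_grad a da" "C1_grad b db"
  shows "C1_grad (\<lambda>x. a x * b x) (\<lambda>i x. da i x * b x + a x * db i x)"
  unfolding C1_grad_def
proof (intro conjI allI)
  fix x
  have "((\<lambda>x. a x * b x) has_derivative
    (\<lambda>v. a x * (\<Sum>i\<in>UNIV. db i x * v $ i) + (\<Sum>i\<in>UNIV. da i x * v $ i) * b x)) (at x)"
    using assms by (intro has_derivative_mult) (auto simp: C1_grad_def)
  moreover have "a x * (\<Sum>i\<in>UNIV. db i x * v $ i) + (\<Sum>i\<in>UNIV. da i x * v $ i) * b x
     = (\<Sum>i\<in>UNIV. (da i x * b x + a x * db i x) * v $ i)" for v
    by (simp add: sum_distrib_left sum_distrib_right algebra_simps sum.distrib)
  ultimately show "((\<lambda>x. a x * b x) has_derivative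
    (\<lambda>v. \<Sum>i\<in>UNIV. (da i x * b x + a x * db i x) * v $ i)) (at x)"
    by (rule has_derivative_eq_rhs[OF _ ext])
next
  fix i show "continuous_on UNIV (\<lambda>x. da i x * b x + a x * db i x)"
    using assms C1_grad_continuous C1_grad_continuous' by (intro continuous_intros) blast+
qed

lemma C1_grad_add:
  assumes "C1_grad a da" "C1_grad b db"
  shows "C1_grad (\<lambda>x. a x + b x) (\<lambda>i x. da i x + db i x)"
  unfolding C1_grad_def
proof (intro conjI allI)
  fix x
  have "((\<lambda>x. a x + b x) has_derivative
    (\<lambda>v. (\<Sum>i\<in>UNIV. da i x * v $ i) + (\<Sum>i\<in>UNIV. db i x * v $ i))) (at x)"
    using assms by (intro has_derivative_add) (auto simp: C1_grad_def)
  then show "((\<lambda>x. a x + b x) has_derivative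
    (\<lambda>v. \<Sum>i\<in>UNIV. (da i x + db i x) * v $ i)) (at x)"
    by (simp add: distrib_right sum.distrib)
next
  fix i show "continuous_on UNIV (\<lambda>x. da i x + db i x)"
    using assms C1_grad_continuous' by (intro continuous_intros) blast+
qed

lemma C1_grad_const: "C1_grad (\<lambda>x. c) (\<lambda>i x. 0)"
  by (auto simp: C1_grad_def)

lemma C1_grad_cmult: "C1_grad a da \<Longrightarrow> C1_grad (\<lambda>x. c * a x) (\<lambda>i x. c * da i x)"
  using C1_grad_mult[OF C1_grad_const[of c]] by simp

lemma C1_grad_sum: "(\<And>k. k \<in> K \<Longrightarrow> C1_grad (a k) (da k)) \<Longrightarrow>
  C1_grad (\<lambda>x. \<Sum>k\<in>K. a k x) (\<lambda>i x. \<Sum>k\<in>K. da k i x)"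
  by (induction K rule: infinite_finite_induct) (auto simp: C1_grad_const C1_grad_add)

text \<open>Coordinates, bump factors and the Carleman weight each depend on a single coordinate, so
  this one chain rule covers them all.\<close>

lemma C1_grad_compose_coord:
  fixes k :: "'n::finite"
  assumes "\<And>t. (g has_real_derivative g' t) (at t)" and "continuous_on UNIV g'"
  shows "C1_grad (\<lambda>x. g (x $ k)) (\<lambda>i x. if i = k then g' (x $ k) else 0)"
  unfolding C1_grad_def
proof (intro conjI allI)
  fix x
  have "((\<lambda>x. g (x $ k)) has_derivative (\<lambda>v. g' (x $ k) * v $ k)) (at x)"
  proof (rule has_derivative_compose[where g=g and f="\<lambda>x. x $ k" and f'="\<lambda>v. v $ k"])
    show "((\<lambda>x. x $ k) has_derivative (\<lambda>v. v $ k)) (at x)"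
      by (simp add: bounded_linear_imp_has_derivative bounded_linear_vec_nth)
    show "(g has_derivative (*) (g' (x $ k))) (at (x $ k))"
      using assms(1) by (simp add: has_field_derivative_def)
  qed
  then show "((\<lambda>x. g (x $ k)) has_derivative (\<lambda>v. \<Sum>i\<in>UNIV. (if i = k then g' (x $ k) else 0) * v $ i)) (at x)"
    by (simp add: if_distrib[of "\<lambda>t. t * _"] cong: if_cong)
next
  fix i show "continuous_on UNIV (\<lambda>x. if i = k then g' (x $ k) else 0)"
    by (cases "i = k") (auto intro!: continuous_intros continuous_on_compose2[OF assms(2)])
qed

lemma C1_grad_coord: "C1_grad (\<lambda>x. x $ k) (\<lambda>i x. if i = k then 1 else 0)"
  using C1_grad_compose_coord[of "\<lambda>t. t" "\<lambda>_. 1"] by auto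

lemma C1_grad_line:
  assumes "C1_grad f df"
  shows "((\<lambda>t. f (x + t *\<^sub>R axis i 1)) has_real_derivative df i (x + t *\<^sub>R axis i 1)) (at t within S)"
proof -
  have "((\<lambda>t. f (x + t *\<^sub>R axis i 1)) has_derivative
     (\<lambda>s. \<Sum>k\<in>UNIV. df k (x + t *\<^sub>R axis i 1) * (s *\<^sub>R axis i 1) $ k)) (at t within S)"
  proof (rule has_derivative_compose[where g=f])
    show "((\<lambda>t. x + t *\<^sub>R axis i 1) has_derivative (\<lambda>s. s *\<^sub>R axis i 1)) (at t within S)"
      by (auto intro!: derivative_eq_intros)
    show "(f has_derivative (\<lambda>v. \<Sum>k\<in>UNIV. df k (x + t *\<^sub>R axis i 1) * v $ k)) (at (x + t *\<^sub>R axis i 1))"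
      using assms by (auto simp: C1_grad_def)
  qed
  moreover have "(\<lambda>s. \<Sum>k\<in>UNIV. df k (x + t *\<^sub>R axis i 1) * (s *\<^sub>R axis i 1) $ k)
     = (*) (df i (x + t *\<^sub>R axis i 1))"
    by (auto simp: axis_def if_distrib cong: if_cong)
  ultimately show ?thesis by (simp add: has_field_derivative_def)
qed

text \<open>Both mixed derivatives are limits of the same second difference quotient.\<close>

lemma C2_second_difference:
  fixes f :: "real^'n \<Rightarrow> real"
  assumes f: "C1_grad f df" and df: "C1_grad (df i) ddf" and h: "h > 0"
  obtains \<xi> \<eta> where "0 < \<xi>" "\<xi> < h" "0 < \<eta>" "\<eta> < h"
    "f (x + h *\<^sub>R axis i 1 + h *\<^sub>R axis j 1) - f (x + h *\<^sub>R axis i 1) - f (x + h *\<^sub>R axis j 1) + f x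
      = h\<^sup>2 * ddf j (x + \<xi> *\<^sub>R axis i 1 + \<eta> *\<^sub>R axis j 1)"
proof -
  \<comment> \<open>Two mean value theorems: one along axis \<open>i\<close> for the increment in
    direction \<open>j\<close>, then one along axis \<open>j\<close> for
    \<open>df i\<close>.\<close>
  define g where "g s = f (x + h *\<^sub>R axis j 1 + s *\<^sub>R axis i 1) - f (x + s *\<^sub>R axis i 1)" for s
  have g: "(g has_real_derivative df i (x + h *\<^sub>R axis j 1 + s *\<^sub>R axis i 1) - df i (x + s *\<^sub>R axis i 1)) (at s)" for s
    unfolding g_def by (intro DERIV_diff C1_grad_line[OF f])
  obtain \<xi> where \<xi>: "0 < \<xi>" "\<xi> < h"
    "g h - g 0 = (h - 0) * (df i (x + h *\<^sub>R axis j 1 + \<xi> *\<^sub>R axis i 1) - df i (x + \<xi> *\<^sub>R axis i 1))"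
    using MVT2[OF h, of g "\<lambda>s. df i (x + h *\<^sub>R axis j 1 + s *\<^sub>R axis i 1) - df i (x + s *\<^sub>R axis i 1)"] g by blast
  define k where "k s = df i (x + \<xi> *\<^sub>R axis i 1 + s *\<^sub>R axis j 1)" for s
  have k: "(k has_real_derivative ddf j (x + \<xi> *\<^sub>R axis i 1 + s *\<^sub>R axis j 1)) (at s)" for s
    unfolding k_def by (intro C1_grad_line[OF df])
  obtain \<eta> where \<eta>: "0 < \<eta>" "\<eta> < h" "k h - k 0 = (h - 0) * ddf j (x + \<xi> *\<^sub>R axis i 1 + \<eta> *\<^sub>R axis j 1)"
    using MVT2[OF h, of k "\<lambda>s. ddf j (x + \<xi> *\<^sub>R axis i 1 + s *\<^sub>R axis j 1)"] k by blast
  have "g h - g 0 = h * (k h - k 0)" using \<xi>(3) by (simp add: k_def add_ac)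
  then have "g h - g 0 = h\<^sup>2 * ddf j (x + \<xi> *\<^sub>R axis i 1 + \<eta> *\<^sub>R axis j 1)"
    using \<eta>(3) by (simp add: power2_eq_square)
  then show ?thesis using \<xi>(1,2) \<eta>(1,2) by (intro that[of \<xi> \<eta>]) (auto simp: g_def add_ac)
qed

lemma mixed_partials_eq:
  fixes f :: "real^'n \<Rightarrow> real"
  assumes f: "C1_grad f df" and df: "\<And>i. C1_grad (df i) (ddf i)"
  shows "ddf i j x = ddf j i x"
proof -
  define h where "h n = inverse (real (Suc n))" for n
  have h: "h n > 0" for n by (simp add: h_def)
  have h0: "h \<longlonglongrightarrow> 0" unfolding h_def by (rule LIMSEQ_inverse_real_of_nat)
  have "\<exists>\<xi> \<eta>. 0 < \<xi> \<and> \<xi> < h n \<and> 0 < \<eta> \<and> \<eta> < h n \<and>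
    f (x + h n *\<^sub>R axis i 1 + h n *\<^sub>R axis j 1) - f (x + h n *\<^sub>R axis i 1) - f (x + h n *\<^sub>R axis j 1) + f x
      = (h n)\<^sup>2 * ddf i j (x + \<xi> *\<^sub>R axis i 1 + \<eta> *\<^sub>R axis j 1)" for n i j
    using C2_second_difference[OF f df h[of n], of x i j] by metis
  then obtain \<xi> \<eta> where \<xi>: "\<And>n i j. 0 < \<xi> n i j" "\<And>n i j. \<xi> n i j < h n"
    and \<eta>: "\<And>n i j. 0 < \<eta> n i j" "\<And>n i j. \<eta> n i j < h n"
    and eq: "\<And>n i j. f (x + h n *\<^sub>R axis i 1 + h n *\<^sub>R axis j 1) - f (x + h n *\<^sub>R axis i 1) - f (x + h n *\<^sub>R axis j 1) + f x
      = (h n)\<^sup>2 * ddf i j (x + \<xi> n i j *\<^sub>R axis i 1 + \<eta> n i j *\<^sub>R axis j 1)" by metis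
  let ?q = "\<lambda>i j n. ddf i j (x + \<xi> n i j *\<^sub>R axis i 1 + \<eta> n i j *\<^sub>R axis j 1)"
  have q: "?q i j = ?q j i"
  proof
    fix n
    have "(h n)\<^sup>2 * ?q i j n = (h n)\<^sup>2 * ?q j i n"
      unfolding eq[symmetric] by (simp add: add_ac)
    then show "?q i j n = ?q j i n" using h[of n] by simp
  qed
  have lim: "?q i j \<longlonglongrightarrow> ddf i j x" for i j
  proof -
    have a: "(\<lambda>n. \<xi> n i j) \<longlonglongrightarrow> 0"
      by (rule tendsto_sandwich[OF _ _ tendsto_const h0]) (use \<xi> in \<open>auto intro!: always_eventually less_imp_le\<close>)
    have b: "(\<lambda>n. \<eta> n i j) \<longlonglongrightarrow> 0"
      by (rule tendsto_sandwich[OF _ _ tendsto_const h0]) (use \<eta> in \<open>auto intro!: always_eventually less_imp_le\<close>)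
    have "(\<lambda>n. x + \<xi> n i j *\<^sub>R axis i 1 + \<eta> n i j *\<^sub>R axis j 1) \<longlonglongrightarrow> x + 0 *\<^sub>R axis i 1 + 0 *\<^sub>R axis j 1"
      by (intro tendsto_intros a b)
    moreover have "isCont (ddf i j) x"
      using C1_grad_continuous'[OF df] by (simp add: continuous_on_eq_continuous_at)
    ultimately show ?thesis by (auto intro: isCont_tendsto_compose)
  qed
  show ?thesis using lim[of i j] lim[of j i] unfolding q by (rule LIMSEQ_unique)
qed

section \<open>The divergence theorem on the cube\<close>

lemma borel_measurable_vec_lambda:
  assumes "\<And>j. (\<lambda>x. f x j) \<in> borel_measurable M"
  shows "(\<lambda>x. \<chi> j. f x j) \<in> M \<rightarrow>\<^sub>M (borel :: (real^'n::finite) measure)"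
proof (subst borel_measurable_euclidean_space, intro ballI)
  fix b :: "real^'n" assume "b \<in> Basis"
  then obtain j where "b = axis j 1" by (auto simp: Basis_vec_def)
  then show "(\<lambda>x. (\<chi> j. f x j) \<bullet> b) \<in> borel_measurable M"
    using assms by (simp add: inner_axis)
qed

section \<open>Lebesgue measure on the cube as a product measure\<close>

text \<open>Identified by its values on boxes. \<open>face_measure\<close> is built from a product
  measure in coordinates, so volume integrals have to be brought to the same form before Fubini can
  relate the two.\<close>

lemma lborel_vec_eq_PiM:
  "(lborel :: (real^'n::finite) measure) = distr (\<Pi>\<^sub>M j\<in>UNIV. lborel) borel (\<lambda>y. \<chi> j. y j)"
proof (rule lborel_eqI)
  interpret product_sigma_finite "\<lambda>_::'n. lborel :: real measure" by standard
  have [measurable]: "(\<lambda>y. \<chi> j. y j) \<in> (\<Pi>\<^sub>M j\<in>UNIV. lborel) \<rightarrow>\<^sub>M (borel :: (real^'n) measure)"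
    by (rule borel_measurable_vec_lambda) simp
  fix l u :: "real^'n" assume lu: "\<And>b. b \<in> Basis \<Longrightarrow> l \<bullet> b \<le> u \<bullet> b"
  have lu': "l $ j \<le> u $ j" for j
    using lu[of "axis j 1"] by (auto simp: inner_axis Basis_vec_def)
  have "emeasure (distr (\<Pi>\<^sub>M j\<in>UNIV. lborel) borel (\<lambda>y. \<chi> j. y j)) (box l u)
      = emeasure (\<Pi>\<^sub>M j\<in>UNIV. lborel) (Pi\<^sub>E UNIV (\<lambda>j. {l $ j <..< u $ j}))"
    by (subst emeasure_distr) (auto intro!: arg_cong2[where f=emeasure] simp: mem_box_cart space_PiM PiE_iff)
  also have "\<dots> = (\<Prod>j\<in>UNIV. emeasure lborel {l $ j <..< u $ j})"
    by (rule emeasure_PiM) auto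
  also have "\<dots> = (\<Prod>j\<in>UNIV. ennreal (u $ j - l $ j))"
    using lu' by simp
  also have "\<dots> = ennreal (\<Prod>j\<in>UNIV. u $ j - l $ j)"
    using lu' by (intro prod_ennreal) auto
  also have "(\<Prod>j\<in>UNIV. u $ j - l $ j) = (\<Prod>b\<in>Basis. (u - l) \<bullet> b)"
    by (simp add: Basis_vec_def UNION_singleton_eq_range prod.reindex inj_on_def axis_eq_axis inner_axis)
  finally show "emeasure (distr (\<Pi>\<^sub>M j\<in>UNIV. lborel) borel (\<lambda>y. \<chi> j. y j)) (box l u)
    = ennreal (\<Prod>b\<in>Basis. (u - l) \<bullet> b)" .
qed simp

abbreviation side_measure :: "real \<Rightarrow> real measure"
  where "side_measure R \<equiv> restrict_space lborel {-R..R}"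

lemma finite_measure_side: "finite_measure (side_measure R)"
  by standard (auto simp: emeasure_restrict_space space_restrict_space emeasure_lborel_Icc_eq)

lemma product_sigma_finite_side: "product_sigma_finite (\<lambda>_. side_measure R)"
  by (simp add: product_sigma_finite_def finite_measure_side finite_measure.axioms(1))

lemma measurable_vec_PiM_side [measurable]:
  "(\<lambda>y. \<chi> j. if j = i then c else y j) \<in> (\<Pi>\<^sub>M j\<in>UNIV - {i}. side_measure R) \<rightarrow>\<^sub>M (borel :: (real^'n::finite) measure)"
proof (rule borel_measurable_vec_lambda)
  fix j
  have "(\<lambda>y. y j) \<in> (\<Pi>\<^sub>M j\<in>UNIV - {i}. side_measure R) \<rightarrow>\<^sub>M borel" if "j \<noteq> i"
  proof -
    have "(\<lambda>y. y j) \<in> (\<Pi>\<^sub>M j\<in>UNIV - {i}. side_measure R) \<rightarrow>\<^sub>M side_measure R"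
      using that by (intro measurable_component_singleton) auto
    moreover have "(\<lambda>x. x) \<in> side_measure R \<rightarrow>\<^sub>M borel"
      by (intro measurable_restrict_space1) simp
    ultimately show ?thesis by (rule measurable_compose)
  qed
  then show "(\<lambda>y. if j = i then c else y j) \<in> (\<Pi>\<^sub>M j\<in>UNIV - {i}. side_measure R) \<rightarrow>\<^sub>M borel"
    by (cases "j = i") auto
qed

lemma measurable_vec_PiM_side' [measurable]:
  "(\<lambda>y. \<chi> j. y j) \<in> (\<Pi>\<^sub>M j\<in>UNIV. side_measure R) \<rightarrow>\<^sub>M (borel :: (real^'n::finite) measure)"
proof (rule borel_measurable_vec_lambda)
  fix j :: 'n
  have "(\<lambda>y. y j) \<in> (\<Pi>\<^sub>M j\<in>UNIV. side_measure R) \<rightarrow>\<^sub>M side_measure R"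
    by (intro measurable_component_singleton) auto
  moreover have "(\<lambda>x. x) \<in> side_measure R \<rightarrow>\<^sub>M borel"
    by (intro measurable_restrict_space1) simp
  ultimately show "(\<lambda>y. y j) \<in> (\<Pi>\<^sub>M j\<in>UNIV. side_measure R) \<rightarrow>\<^sub>M borel" by (rule measurable_compose)
qed

text \<open>The closed cube: compact, so continuous coefficients are bounded on it, and the set that
  carries the product of the side measures.\<close>

definition ccube :: "real \<Rightarrow> (real^'n) set"
  where "ccube R = cbox (\<chi> i. - R) (\<chi> i. R)"

lemma mem_cube: "x \<in> cube R \<longleftrightarrow> (\<forall>i. \<bar>x $ i\<bar> < R)"
  by (auto simp: cube_def mem_box_cart abs_less_iff) (metis minus_less_iff)+

lemma mem_ccube: "x \<in> ccube R \<longleftrightarrow> (\<forall>i. \<bar>x $ i\<bar> \<le> R)"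
  by (auto simp: ccube_def mem_box_cart abs_le_iff) (metis minus_le_iff)+

lemma ccubeI: "(\<And>i. x $ i \<in> {-R..R}) \<Longrightarrow> x \<in> ccube R"
  by (auto simp: ccube_def mem_box_cart)

lemma compact_ccube: "compact (ccube R)" by (simp add: ccube_def)

lemma cube_subset_ccube: "cube R \<subseteq> ccube R"
  by (auto simp: mem_cube mem_ccube less_imp_le)

lemma cube_sets [measurable]: "cube R \<in> sets lebesgue" "cube R \<in> sets borel"
  by (auto simp: cube_def)

lemma ccube_sets [measurable]: "ccube R \<in> sets lebesgue" "ccube R \<in> sets borel"
  by (auto simp: ccube_def)

abbreviation QM :: "real \<Rightarrow> (real^'n) measure"
  where "QM R \<equiv> lebesgue_on (cube R)"

lemma finite_measure_cube: "finite_measure (QM R :: (real^'n) measure)"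
proof
  have "emeasure lborel (cube R :: (real^'n) set) < \<infinity>"
    unfolding cube_def by (rule emeasure_bounded_finite) simp
  then show "emeasure (QM R) (space (QM R :: (real^'n) measure)) \<noteq> \<infinity>"
    by (simp add: emeasure_restrict_space space_restrict_space)
qed

lemma AE_cube: "AE x in QM R. x \<in> cube R"
  by (metis AE_space space_lebesgue_on)

lemma continuous_measurable_cube:
  "continuous_on UNIV g \<Longrightarrow> g \<in> borel_measurable (QM R)"
  for g :: "real^'n \<Rightarrow> real"
  by (rule measurable_restrict_space1, rule measurable_completion)
    (simp add: borel_measurable_continuous_onI)

lemma continuous_bounded_ccube:
  fixes g :: "real^'n \<Rightarrow> real"
  assumes "continuous_on UNIV g"
  obtains C where "C \<ge> 0" "\<And>x. x \<in> ccube R \<Longrightarrow> \<bar>g x\<bar> \<le> C"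
proof -
  have "compact (g ` ccube R)"
    by (rule compact_continuous_image[OF continuous_on_subset[OF assms] compact_ccube]) simp
  then obtain C where "\<And>y. y \<in> g ` ccube R \<Longrightarrow> norm y \<le> C"
    by (meson bounded_iff compact_imp_bounded)
  then show ?thesis by (intro that[of "max C 0"]) (auto simp: le_max_iff_disj)
qed

lemma continuous_AE_bounded_cube:
  fixes g :: "real^'n \<Rightarrow> real"
  assumes "continuous_on UNIV g"
  obtains C where "C \<ge> 0" "AE x in QM R. \<bar>g x\<bar> \<le> C"
proof -
  obtain C where C: "C \<ge> 0" "\<And>x. x \<in> ccube R \<Longrightarrow> \<bar>g x\<bar> \<le> C"
    using continuous_bounded_ccube[OF assms] by metis
  have "AE x in QM R. \<bar>g x\<bar> \<le> C"
    using AE_cube by (rule eventually_mono) (use C(2) cube_subset_ccube in blast)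
  with C(1) show ?thesis by (rule that)
qed

lemma L2_continuous_cube:
  fixes g :: "real^'n \<Rightarrow> real"
  assumes "continuous_on UNIV g" shows "g \<in> L2 (QM R)"
proof -
  obtain C where C: "AE x in QM R. \<bar>g x\<bar> \<le> C"
    using continuous_AE_bounded_cube[OF assms] by metis
  interpret finite_measure "QM R :: (real^'n) measure" by (rule finite_measure_cube)
  have "(\<lambda>x. g x * 1) \<in> L2 (QM R)"
    by (rule L2_bounded_mult[OF _ continuous_measurable_cube[OF assms] C]) (simp add: L2_def)
  then show ?thesis by simp
qed

lemma L2_continuous_mult:
  fixes g :: "real^'n \<Rightarrow> real"
  assumes "continuous_on UNIV g" and "f \<in> L2 (QM R)"
  shows "(\<lambda>x. g x * f x) \<in> L2 (QM R)"
  using continuous_AE_bounded_cube[OF assms(1)]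
    L2_bounded_mult[OF assms(2) continuous_measurable_cube[OF assms(1)]] by metis

lemma measurable_vec_nth_side [measurable]:
  "(\<lambda>x j. x $ j) \<in> restrict_space lborel (ccube R :: (real^'n::finite) set) \<rightarrow>\<^sub>M (\<Pi>\<^sub>M j\<in>UNIV. side_measure R)"
proof (rule measurable_PiM_single')
  fix j :: 'n
  show "(\<lambda>x. x $ j) \<in> restrict_space lborel (ccube R) \<rightarrow>\<^sub>M side_measure R"
    by (rule measurable_restrict_space3) (auto simp: mem_ccube abs_le_iff, metis minus_le_iff)
qed (auto simp: mem_ccube abs_le_iff space_restrict_space, metis minus_le_iff)

text \<open>Both measures agree on rectangles, which determine a finite product. The closed sides
  are dictated by \<open>face_measure\<close>.\<close>

lemma PiM_side_eq: "(\<Pi>\<^sub>M j\<in>UNIV. side_measure R) = distr (restrict_space lborel (ccube R :: (real^'n::finite) set))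
  (\<Pi>\<^sub>M j\<in>UNIV. side_measure R) (\<lambda>x j. x $ j)"
proof -
  interpret product_sigma_finite "\<lambda>_::'n. side_measure R" by (rule product_sigma_finite_side)
  interpret L: product_sigma_finite "\<lambda>_::'n. lborel :: real measure" by standard
  let ?C = "ccube R :: (real^'n) set"
  have [measurable]: "(\<lambda>y. \<chi> j. y j) \<in> (\<Pi>\<^sub>M j\<in>UNIV. lborel) \<rightarrow>\<^sub>M (borel :: (real^'n) measure)"
    by (rule borel_measurable_vec_lambda) simp
  have "distr (restrict_space lborel ?C) (\<Pi>\<^sub>M j\<in>UNIV. side_measure R) (\<lambda>x j. x $ j) = (\<Pi>\<^sub>M j\<in>UNIV. side_measure R)"
  proof (rule PiM_eqI)
    fix A :: "'n \<Rightarrow> real set" assume A: "\<And>i. i \<in> UNIV \<Longrightarrow> A i \<in> sets (side_measure R)"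
    have AR: "A i \<subseteq> {-R..R}" and [measurable]: "A i \<in> sets borel" for i
      using A[of i] by (auto simp: sets_restrict_space)
    have sub: "{x. \<forall>j. x $ j \<in> A j} \<subseteq> ?C"
      using AR by (blast intro: ccubeI)
    have eq: "(\<lambda>x j. x $ j) -` Pi\<^sub>E UNIV A \<inter> space (restrict_space lborel ?C) = {x. \<forall>j. x $ j \<in> A j}"
      using sub by (auto simp: space_restrict_space PiE_UNIV_domain)
    have meas: "{x. \<forall>j. x $ j \<in> A j} \<in> sets (borel :: (real^'n) measure)"
      by measurable
    have "Pi\<^sub>E UNIV A \<in> sets (\<Pi>\<^sub>M j\<in>UNIV. side_measure R)" using A by auto
    then have "emeasure (distr (restrict_space lborel ?C) (\<Pi>\<^sub>M j\<in>UNIV. side_measure R) (\<lambda>x j. x $ j)) (Pi\<^sub>E UNIV A)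
       = emeasure (restrict_space lborel ?C) {x. \<forall>j. x $ j \<in> A j}"
      by (simp only: emeasure_distr[OF measurable_vec_nth_side] eq)
    also have "\<dots> = emeasure lborel {x::real^'n. \<forall>j. x $ j \<in> A j}"
      using sub by (subst emeasure_restrict_space) auto
    also have "\<dots> = emeasure (\<Pi>\<^sub>M j\<in>UNIV. lborel) (Pi\<^sub>E UNIV A)"
      unfolding lborel_vec_eq_PiM
      by (subst emeasure_distr[OF _ meas]) (auto simp: space_PiM intro!: arg_cong2[where f=emeasure])
    also have "\<dots> = (\<Prod>j\<in>UNIV. emeasure lborel (A j))"
      by (rule L.emeasure_PiM) auto
    also have "\<dots> = (\<Prod>j\<in>UNIV. emeasure (side_measure R) (A j))"
      using AR by (intro prod.cong refl, subst emeasure_restrict_space) auto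
    finally show "emeasure (distr (restrict_space lborel ?C) (\<Pi>\<^sub>M j\<in>UNIV. side_measure R) (\<lambda>x j. x $ j)) (Pi\<^sub>E UNIV A)
      = (\<Prod>i\<in>UNIV. emeasure (side_measure R) (A i))" .
  qed auto
  then show ?thesis by simp
qed

lemma integral_cube_PiM:
  fixes g :: "real^'n \<Rightarrow> real"
  assumes g: "continuous_on UNIV g"
  shows "(\<integral>x. g x \<partial>QM R) = (\<integral>y. g (\<chi> j. y j) \<partial>(\<Pi>\<^sub>M j\<in>UNIV. side_measure R))"
proof -
  have [measurable]: "g \<in> borel_measurable borel" using g by (rule borel_measurable_continuous_onI)
  have "(\<integral>y. g (\<chi> j. y j) \<partial>(\<Pi>\<^sub>M j\<in>UNIV. side_measure R)) = (\<integral>x. g x \<partial>restrict_space lborel (ccube R))"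
    by (subst PiM_side_eq, subst integral_distr[OF measurable_vec_nth_side]) auto
  also have "\<dots> = (\<integral>x. indicator (ccube R) x *\<^sub>R g x \<partial>lborel)"
    by (subst integral_restrict_space) auto
  also have "\<dots> = (\<integral>x. indicator (ccube R) x *\<^sub>R g x \<partial>lebesgue)"
    by (rule integral_completion[symmetric]) auto
  also have "\<dots> = (\<integral>x. indicator (cube R) x *\<^sub>R g x \<partial>lebesgue)"
  proof (rule integral_cong_AE)
    \<comment> \<open>The product lives on the closed cube and \<open>QM R\<close> on the open one;
      they differ by the frontier of an interval.\<close>
    have "negligible (ccube R - cube R :: (real^'n) set)"
      unfolding cube_def ccube_def
      by (metis box_subset_cbox negligible_frontier_interval)
    then have "AE x in lebesgue. x \<notin> (ccube R - cube R :: (real^'n) set)"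
      unfolding negligible_iff_null_sets by (rule AE_not_in)
    then show "AE x in lebesgue. indicator (ccube R) x *\<^sub>R g x = indicator (cube R) x *\<^sub>R g x"
      by eventually_elim (use cube_subset_ccube[of R] in \<open>auto simp: indicator_def\<close>)
  qed (auto intro!: borel_measurable_scaleR borel_measurable_indicator measurable_completion)
  also have "\<dots> = (\<integral>x. g x \<partial>QM R)"
    by (subst integral_restrict_space) auto
  finally show ?thesis by simp
qed

lemma finite_measure_PiM_side: "finite I \<Longrightarrow> finite_measure (\<Pi>\<^sub>M j\<in>I. side_measure R)"
proof
  interpret product_sigma_finite "\<lambda>_. side_measure R" by (rule product_sigma_finite_side)
  interpret N: finite_measure "side_measure R" by (rule finite_measure_side)
  assume "finite I"
  then show "emeasure (\<Pi>\<^sub>M j\<in>I. side_measure R) (space (\<Pi>\<^sub>M j\<in>I. side_measure R)) \<noteq> \<infinity>"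
    unfolding space_PiM using sets.top[of "side_measure R"]
    by (subst emeasure_PiM) (auto simp: ennreal_prod_eq_top N.emeasure_finite power_eq_top_ennreal)
qed

lemma face_point_ccube:
  assumes "y \<in> space (\<Pi>\<^sub>M j\<in>UNIV - {i}. side_measure R)" "\<bar>c\<bar> \<le> R"
  shows "(\<chi> j. if j = i then c else y j) \<in> ccube R"
proof -
  have "y j \<in> {-R..R}" if "j \<noteq> i" for j
    using assms that by (auto simp: space_PiM PiE_def Pi_def space_restrict_space)
  then show ?thesis using assms(2) by (fastforce simp: mem_ccube abs_le_iff)
qed

section \<open>Faces up to null sets\<close>

lemma AE_face:
  assumes "AE y in \<Pi>\<^sub>M j\<in>UNIV - {i}. side_measure R. P (\<chi> j. if j = i then \<sigma> * R else y j)"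
    and "{x. P x} \<in> sets (borel :: (real^'n::finite) measure)"
  shows "AE x in face_measure R i \<sigma>. P x"
  unfolding face_measure_def
  by (rule AE_completion) (use assms in \<open>simp add: AE_distr_iff\<close>)

lemma AE_face_ccube:
  assumes "\<sigma> \<in> {-1, 1}" "R > 0"
  shows "AE x in face_measure R i \<sigma>. x \<in> (ccube R :: (real^'n::finite) set)"
  by (rule AE_face) (use assms in \<open>auto intro!: AE_I2 face_point_ccube\<close>)

lemma AE_face_coord:
  assumes "\<sigma> \<in> {-1, 1}" "R > 0"
  shows "AE x in face_measure R i \<sigma>. x $ i = \<sigma> * R"
  by (rule AE_face) auto

text \<open>The part of the face where coordinate \<open>j\<close> is R or -R is a product with a
  two-point factor, hence null. Off all such edges exactly one coordinate has modulus R, and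
  \<open>normal\<close> is the true unit normal.\<close>

lemma AE_face_interior:
  assumes "\<sigma> \<in> {-1, 1}" "R > 0" "j \<noteq> (i :: 'n::finite)"
  shows "AE x in face_measure R i \<sigma>. \<bar>x $ j\<bar> \<noteq> R"
proof (rule AE_face)
  interpret product_sigma_finite "\<lambda>_::'n. side_measure R" by (rule product_sigma_finite_side)
  let ?I = "UNIV - {i}"
  let ?A = "\<lambda>k. if k = j then {-R, R} else {-R..R}"
  have A: "?A k \<in> sets (side_measure R)" for k using assms(2) by (auto simp: sets_restrict_space_iff)
  have e: "emeasure (\<Pi>\<^sub>M j\<in>?I. side_measure R) (Pi\<^sub>E ?I ?A) = (\<Prod>k\<in>?I. emeasure (side_measure R) (?A k))"
    by (rule emeasure_PiM) (use A in auto)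
  have "emeasure (side_measure R) (?A j) = 0"
    using assms(2) by (subst emeasure_restrict_space) (auto intro!: emeasure_lborel_countable)
  then have "(\<Prod>k\<in>?I. emeasure (side_measure R) (?A k)) = 0"
    using assms(3) by (intro prod_zero bexI[of _ j]) simp_all
  moreover have "Pi\<^sub>E ?I ?A \<in> sets (\<Pi>\<^sub>M j\<in>?I. side_measure R)" using A by (intro sets_PiM_I_finite) auto
  ultimately have "Pi\<^sub>E ?I ?A \<in> null_sets (\<Pi>\<^sub>M j\<in>?I. side_measure R)" using e by (intro null_setsI) simp_all
  then have "AE y in \<Pi>\<^sub>M j\<in>?I. side_measure R. y \<notin> Pi\<^sub>E ?I ?A" by (rule AE_not_in)
  then show "AE y in \<Pi>\<^sub>M j\<in>?I. side_measure R. \<bar>(\<chi> j. if j = i then \<sigma> * R else y j) $ j\<bar> \<noteq> R"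
  proof (rule AE_mp[OF _ AE_I2], intro impI)
    fix y assume y: "y \<in> space (\<Pi>\<^sub>M j\<in>?I. side_measure R)" and n: "y \<notin> Pi\<^sub>E ?I ?A"
    have "y j \<notin> {-R, R}"
    proof
      assume "y j \<in> {-R, R}"
      with y have "y \<in> Pi\<^sub>E ?I ?A" by (auto simp: space_PiM PiE_def Pi_def space_restrict_space)
      with n show False by simp
    qed
    then show "\<bar>(\<chi> j. if j = i then \<sigma> * R else y j) $ j\<bar> \<noteq> R" using assms(2,3) by auto
  qed
qed measurable

lemma finite_measure_face: "finite_measure (face_measure R i \<sigma>)"
proof -
  interpret F: finite_measure "distr (\<Pi>\<^sub>M j\<in>UNIV - {i}. side_measure R) borel (\<lambda>y. \<chi> j. if j = i then \<sigma> * R else y j)"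
    by (rule finite_measure.finite_measure_distr[OF finite_measure_PiM_side]) auto
  show ?thesis unfolding face_measure_def by standard simp
qed

lemma continuous_measurable_face:
  "continuous_on UNIV g \<Longrightarrow> g \<in> borel_measurable (face_measure R i \<sigma>)"
  for g :: "real^'n::finite \<Rightarrow> real"
  unfolding face_measure_def
  by (auto intro!: measurable_completion borel_measurable_continuous_onI)

lemma continuous_AE_bounded_face:
  fixes g :: "real^'n::finite \<Rightarrow> real"
  assumes "continuous_on UNIV g" "\<sigma> \<in> {-1, 1}" "R > 0"
  obtains C where "C \<ge> 0" "AE x in face_measure R i \<sigma>. \<bar>g x\<bar> \<le> C"
proof -
  obtain C where C: "C \<ge> 0" "\<And>x. x \<in> ccube R \<Longrightarrow> \<bar>g x\<bar> \<le> C"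
    using continuous_bounded_ccube[OF assms(1)] by metis
  have "AE x in face_measure R i \<sigma>. \<bar>g x\<bar> \<le> C"
    using AE_face_ccube[OF assms(2,3)] by (rule eventually_mono) (rule C(2))
  with C(1) show ?thesis by (rule that)
qed

lemma L2_continuous_face:
  fixes g :: "real^'n::finite \<Rightarrow> real"
  assumes g: "continuous_on UNIV g" and "\<sigma> \<in> {-1, 1}" "R > 0" shows "g \<in> L2 (face_measure R i \<sigma>)"
proof -
  obtain C where C: "AE x in face_measure R i \<sigma>. \<bar>g x\<bar> \<le> C"
    using continuous_AE_bounded_face[OF assms] by metis
  interpret finite_measure "face_measure R i \<sigma>" by (rule finite_measure_face)
  have "(\<lambda>x. g x * 1) \<in> L2 (face_measure R i \<sigma>)"
    by (rule L2_bounded_mult[OF _ continuous_measurable_face[OF g] C]) (simp add: L2_def)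
  then show ?thesis by simp
qed

lemma integrable_continuous_PiM_side:
  assumes g: "g \<in> borel_measurable (\<Pi>\<^sub>M j\<in>I. side_measure R)" and I: "finite I"
    and b: "\<And>y. y \<in> space (\<Pi>\<^sub>M j\<in>I. side_measure R) \<Longrightarrow> \<bar>g y\<bar> \<le> C"
  shows "integrable (\<Pi>\<^sub>M j\<in>I. side_measure R) (g :: _ \<Rightarrow> real)"
proof -
  interpret finite_measure "\<Pi>\<^sub>M j\<in>I. side_measure R" by (rule finite_measure_PiM_side[OF I])
  show ?thesis by (rule integrable_const_bound[where B=C]) (use assms in auto)
qed

text \<open>Fubini with coordinate \<open>i\<close> innermost, then the fundamental theorem of
  calculus on each segment joining opposite faces.\<close>

lemma cube_divergence:
  fixes F :: "real^'n::finite \<Rightarrow> real"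
  assumes F: "C1_grad F dF" and R: "R > 0"
  shows "(\<integral>x. dF i x \<partial>QM R) =
    (\<integral>x. F x \<partial>face_measure R i 1) - (\<integral>x. F x \<partial>face_measure R i (-1))"
proof -
  interpret product_sigma_finite "\<lambda>_::'n. side_measure R" by (rule product_sigma_finite_side)
  have cF: "continuous_on UNIV F" and cdF: "continuous_on UNIV (dF i)"
    using F C1_grad_continuous C1_grad_continuous' by blast+
  have [measurable]: "F \<in> borel_measurable borel" "dF i \<in> borel_measurable borel"
    using cF cdF by (auto intro: borel_measurable_continuous_onI)
  let ?P = "\<Pi>\<^sub>M j\<in>UNIV - {i}. side_measure R"
  obtain C where C: "\<And>x. x \<in> ccube R \<Longrightarrow> \<bar>dF i x\<bar> \<le> C"
    using continuous_bounded_ccube[OF cdF] by metis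
  obtain C' where C': "\<And>x. x \<in> ccube R \<Longrightarrow> \<bar>F x\<bar> \<le> C'"
    using continuous_bounded_ccube[OF cF] by metis
  have "(\<integral>x. dF i x \<partial>QM R) = (\<integral>y. dF i (\<chi> j. y j) \<partial>(\<Pi>\<^sub>M j\<in>UNIV. side_measure R))"
    by (rule integral_cube_PiM[OF cdF])
  also have "\<dots> = (\<integral>y. dF i (\<chi> j. y j) \<partial>(\<Pi>\<^sub>M j\<in>insert i (UNIV - {i}). side_measure R))"
    by (simp add: insert_absorb)
  also have "\<dots> = (\<integral>y. (\<integral>t. dF i (\<chi> j. (y(i := t)) j) \<partial>side_measure R) \<partial>?P)"
  proof (rule product_integral_insert)
    have "integrable (\<Pi>\<^sub>M j\<in>UNIV. side_measure R) (\<lambda>y. dF i (\<chi> j. y j))"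
    proof (rule integrable_continuous_PiM_side[where C=C])
      fix y :: "'n \<Rightarrow> real" assume "y \<in> space (\<Pi>\<^sub>M j\<in>UNIV. side_measure R)"
      then have "y j \<in> {-R..R}" for j by (auto simp: space_PiM PiE_def Pi_def space_restrict_space)
      then have "(\<chi> j. y j) \<in> ccube R" by (intro ccubeI) simp
      then show "\<bar>dF i (\<chi> j. y j)\<bar> \<le> C" by (rule C)
    qed auto
    then show "integrable (\<Pi>\<^sub>M j\<in>insert i (UNIV - {i}). side_measure R) (\<lambda>y. dF i (\<chi> j. y j))"
      by (simp add: insert_absorb)
  qed auto
  also have "\<dots> = (\<integral>y. F (\<chi> j. if j = i then 1 * R else y j) - F (\<chi> j. if j = i then -1 * R else y j) \<partial>?P)"
  proof (rule Bochner_Integration.integral_cong[OF refl])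
    fix y :: "'n \<Rightarrow> real"
    \<comment> \<open>Coordinate \<open>i\<close> is set to 0, so the segment is
      \<open>x0 + t *\<^sub>R axis i 1\<close> with \<open>t\<close> running from -R to R.\<close>
    define x0 where "x0 = (\<chi> j. if j = i then 0 else y j)"
    have x: "(\<chi> j. if j = i then t else y j) = x0 + t *\<^sub>R axis i 1" for t
      by (auto simp: vec_eq_iff axis_def x0_def)
    have "(\<integral>t. dF i (\<chi> j. (y(i := t)) j) \<partial>side_measure R) = (\<integral>t. indicator {-R..R} t *\<^sub>R dF i (x0 + t *\<^sub>R axis i 1) \<partial>lborel)"
      by (subst integral_restrict_space) (auto simp: x fun_upd_def)
    also have "\<dots> = F (x0 + R *\<^sub>R axis i 1) - F (x0 + (-R) *\<^sub>R axis i 1)"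
    proof (rule integral_FTC_Icc)
      show "- R \<le> R" using R by simp
      show "((\<lambda>t. F (x0 + t *\<^sub>R axis i 1)) has_vector_derivative dF i (x0 + t *\<^sub>R axis i 1)) (at t within {-R..R})" for t
        using C1_grad_line[OF F] by (simp add: has_real_derivative_iff_has_vector_derivative)
      show "continuous_on {-R..R} (\<lambda>t. dF i (x0 + t *\<^sub>R axis i 1))"
        by (intro continuous_on_compose2[OF cdF] continuous_intros) auto
    qed
    finally show "(\<integral>t. dF i (\<chi> j. (y(i := t)) j) \<partial>side_measure R)
      = F (\<chi> j. if j = i then 1 * R else y j) - F (\<chi> j. if j = i then -1 * R else y j)"
      by (simp only: x mult_1 mult_minus1)
  qed
  also have "\<dots> = (\<integral>y. F (\<chi> j. if j = i then 1 * R else y j) \<partial>?P) - (\<integral>y. F (\<chi> j. if j = i then -1 * R else y j) \<partial>?P)"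
    using R by (intro Bochner_Integration.integral_diff integrable_continuous_PiM_side[where C=C'] C' face_point_ccube) auto
  also have "\<dots> = (\<integral>x. F x \<partial>face_measure R i 1) - (\<integral>x. F x \<partial>face_measure R i (-1))"
    by (simp only: face_measure_def integral_completion integral_distr)
      (simp add: integral_completion integral_distr)
  finally show ?thesis .
qed

section \<open>Test functions and uniqueness of weak derivatives\<close>

text \<open>The flat function exp(-1/t), multiplied by a polynomial in 1/t so that the family is
  closed under differentiation.\<close>

definition ebump :: "real poly \<Rightarrow> real \<Rightarrow> real"
  where "ebump p t = (if t \<le> 0 then 0 else poly p (1 / t) * exp (- (1 / t)))"

lemma tendsto_poly_exp_0: "((\<lambda>x. poly p x * exp (- x)) \<longlongrightarrow> 0) at_top" for p :: "real poly"
proof -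
  have "((\<lambda>x. \<Sum>k\<le>degree p. coeff p k * (x ^ k / exp x)) \<longlongrightarrow> (\<Sum>k\<le>degree p. coeff p k * 0)) at_top"
    by (intro tendsto_sum tendsto_mult tendsto_const tendsto_power_div_exp_0)
  then show ?thesis by (simp add: poly_altdef exp_minus sum_distrib_right divide_inverse mult.assoc)
qed

text \<open>In the variable s = 1/t the t-derivative of p(s) exp(-s) is s^2 (p(s) - p'(s)) exp(-s);
  \<open>[:0, 0, 1:]\<close> is the factor s^2.\<close>

lemma ebump_deriv: "(ebump p has_real_derivative ebump ([:0, 0, 1:] * (p - pderiv p)) t) (at t)"
proof -
  consider "t < 0" | "t > 0" | "t = 0" by linarith
  then show ?thesis
  proof cases
    case 1
    have "((\<lambda>_. 0) has_real_derivative 0) (at t)" by simp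
    then have "(ebump p has_real_derivative 0) (at t)"
      by (rule has_field_derivative_transform_within_open[where S="{..<0}"]) (use 1 in \<open>auto simp: ebump_def\<close>)
    then show ?thesis using 1 by (simp add: ebump_def)
  next
    case 2
    have "((\<lambda>t. poly p (1 / t) * exp (- (1 / t))) has_real_derivative
      poly (pderiv p) (1 / t) * (- 1 / t\<^sup>2) * exp (- (1 / t)) + exp (- (1 / t)) * (1 / t\<^sup>2) * poly p (1 / t)) (at t)"
      using 2 by (auto intro!: derivative_eq_intros DERIV_chain'[OF _ poly_DERIV] simp: power2_eq_square)
    then have "(ebump p has_real_derivative
      poly (pderiv p) (1 / t) * (- 1 / t\<^sup>2) * exp (- (1 / t)) + exp (- (1 / t)) * (1 / t\<^sup>2) * poly p (1 / t)) (at t)"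
      by (rule has_field_derivative_transform_within_open[where S="{0<..}"]) (use 2 in \<open>auto simp: ebump_def\<close>)
    moreover have "poly (pderiv p) (1 / t) * (- 1 / t\<^sup>2) * exp (- (1 / t)) + exp (- (1 / t)) * (1 / t\<^sup>2) * poly p (1 / t)
      = ebump ([:0, 0, 1:] * (p - pderiv p)) t"
      using 2 by (simp add: ebump_def field_simps power2_eq_square)
    ultimately show ?thesis by simp
  next
    case 3
    \<comment> \<open>From the right, the difference quotient at 0 is s p(s) exp(-s) with s = 1/h;
      exponential decay beats the polynomial.\<close>
    have "((\<lambda>h. poly ([:0, 1:] * p) (inverse h) * exp (- inverse h)) \<longlongrightarrow> 0) (at_right (0::real))"
      by (rule filterlim_compose[OF tendsto_poly_exp_0 filterlim_inverse_at_top_right])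
    then have "((\<lambda>h. (ebump p h - ebump p 0) / (h - 0)) \<longlongrightarrow> 0) (at_right (0::real))"
      by (rule Lim_transform_eventually)
        (auto simp: ebump_def eventually_at_filter field_simps)
    moreover have "((\<lambda>h. (ebump p h - ebump p 0) / (h - 0)) \<longlongrightarrow> 0) (at_left (0::real))"
      by (rule Lim_transform_eventually[OF tendsto_const])
        (auto simp: ebump_def eventually_at_filter field_simps)
    ultimately have "((\<lambda>h. (ebump p h - ebump p 0) / (h - 0)) \<longlongrightarrow> 0) (at (0::real))"
      by (rule filterlim_split_at[rotated])
    then show ?thesis using 3 by (simp add: has_field_derivative_iff ebump_def)
  qed
qed

lemma ebump_continuous: "continuous_on UNIV (ebump p)"
  by (rule DERIV_continuous_on) (rule ebump_deriv)

text \<open>\<open>smooth\<close> speaks of all iterated partial derivatives. A set of C1 functions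
  closed under partial derivatives consists of smooth functions at one stroke, so it is enough to
  take an algebra whose generators have their derivatives in it.\<close>

inductive_set bump_alg :: "(real^'n::finite \<Rightarrow> real) set" where
  const: "(\<lambda>x. c) \<in> bump_alg"
| coord: "(\<lambda>x. x $ i) \<in> bump_alg"
| bump: "(\<lambda>x. ebump p (c + s * x $ i)) \<in> bump_alg"
| add: "f \<in> bump_alg \<Longrightarrow> g \<in> bump_alg \<Longrightarrow> (\<lambda>x. f x + g x) \<in> bump_alg"
| mult: "f \<in> bump_alg \<Longrightarrow> g \<in> bump_alg \<Longrightarrow> (\<lambda>x. f x * g x) \<in> bump_alg"

lemma bump_alg_C1: "f \<in> bump_alg \<Longrightarrow> \<exists>df. C1_grad f df \<and> (\<forall>i. df i \<in> bump_alg)"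
proof (induction rule: bump_alg.induct)
  case (const c)
  show ?case by (rule exI[of _ "\<lambda>i x. 0"]) (simp add: C1_grad_const bump_alg.const)
next
  case (coord i)
  show ?case by (rule exI[of _ "\<lambda>j x. if j = i then 1 else 0"]) (simp add: C1_grad_coord bump_alg.const)
next
  case (bump p c s i)
  let ?q = "[:0, 0, 1:] * (p - pderiv p)"
  have d: "((\<lambda>t. ebump p (c + s * t)) has_real_derivative s * ebump ?q (c + s * t)) (at t)" for t
  proof -
    have "((\<lambda>t. c + s * t) has_real_derivative s) (at t)" by (auto intro!: derivative_eq_intros)
    from DERIV_chain'[OF this ebump_deriv, of p] show ?thesis by (simp only: mult.commute[of s])
  qed
  have c: "continuous_on UNIV (\<lambda>t. s * ebump ?q (c + s * t))"
    by (intro continuous_intros continuous_on_compose2[OF ebump_continuous]) auto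
  have "C1_grad (\<lambda>x. ebump p (c + s * x $ i)) (\<lambda>j x. if j = i then s * ebump ?q (c + s * x $ i) else 0)"
    by (rule C1_grad_compose_coord[OF d c])
  moreover have "(\<lambda>x. if j = i then s * ebump ?q (c + s * x $ i) else 0) \<in> bump_alg" for j
    using bump_alg.mult[OF bump_alg.const[of s] bump_alg.bump[of ?q c s i]] bump_alg.const[of 0]
    by (cases "j = i") (simp_all only: if_True if_False simp_thms)
  ultimately show ?case by (intro exI conjI allI)
next
  case (add f g)
  then obtain df dg where "C1_grad f df" "C1_grad g dg" "\<And>i. df i \<in> bump_alg" "\<And>i. dg i \<in> bump_alg"
    by auto
  then show ?case
    using C1_grad_add[of f df g dg] by (intro exI[of _ "\<lambda>i x. df i x + dg i x"]) (simp add: bump_alg.add)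
next
  case (mult f g)
  then obtain df dg where "C1_grad f df" "C1_grad g dg" "\<And>i. df i \<in> bump_alg" "\<And>i. dg i \<in> bump_alg"
    by auto
  then show ?case
    using C1_grad_mult[of f df g dg] mult.hyps
    by (intro exI[of _ "\<lambda>i x. df i x * g x + f x * dg i x"]) (simp add: bump_alg.add bump_alg.mult)
qed

lemma bump_alg_partial: "f \<in> bump_alg \<Longrightarrow> partial i f \<in> bump_alg"
proof -
  assume "f \<in> bump_alg"
  then obtain df where "C1_grad f df" "df i \<in> bump_alg" using bump_alg_C1 by blast
  moreover have "partial i f = df i" using C1_grad_partial[OF \<open>C1_grad f df\<close>] by (rule ext)
  ultimately show ?thesis by simp
qed

lemma bump_alg_smooth:
  assumes "f \<in> bump_alg" shows "smooth f"
  unfolding smooth_def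
proof (intro allI)
  fix "is" x
  have "foldr partial is f \<in> bump_alg"
    by (induction "is") (use assms bump_alg_partial in auto)
  then obtain df where "C1_grad (foldr partial is f) df" using bump_alg_C1 by blast
  then show "foldr partial is f differentiable at x" by (auto simp: C1_grad_def differentiable_def)
qed

lemma bump_alg_sum: "(\<And>i. i \<in> I \<Longrightarrow> f i \<in> bump_alg) \<Longrightarrow> (\<lambda>x. \<Sum>i\<in>I. f i x) \<in> bump_alg"
  by (induction I rule: infinite_finite_induct) (simp_all add: bump_alg.const bump_alg.add)

lemma bump_alg_prod: "(\<And>i. i \<in> I \<Longrightarrow> f i \<in> bump_alg) \<Longrightarrow> (\<lambda>x. \<Prod>i\<in>I. f i x) \<in> bump_alg"
  by (induction I rule: infinite_finite_induct) (simp_all add: bump_alg.const bump_alg.mult)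

text \<open>Puts polynomials into the same algebra as the cutoffs, so that a cutoff times a
  polynomial is a legitimate test function.\<close>

lemma polynomial_bump_alg:
  fixes f :: "real^'n::finite \<Rightarrow> real"
  assumes "real_polynomial_function f" shows "f \<in> bump_alg"
  using assms
proof (induction rule: real_polynomial_function.induct)
  case (linear f)
  then interpret bounded_linear f .
  have "f x = (\<Sum>i\<in>UNIV. f (axis i 1) * x $ i)" for x
  proof -
    have "f x = f (\<Sum>i\<in>UNIV. x $ i *\<^sub>R axis i 1)"
      by (simp add: basis_expansion flip: scalar_mult_eq_scaleR)
    then show ?thesis by (simp add: sum scaleR mult.commute)
  qed
  then have "(\<lambda>x. \<Sum>i\<in>UNIV. f (axis i 1) * x $ i) = f" by (intro ext) (rule sym)
  moreover have "(\<lambda>x. \<Sum>i\<in>UNIV. f (axis i 1) * x $ i) \<in> bump_alg"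
    by (intro bump_alg_sum bump_alg.mult bump_alg.const bump_alg.coord)
  ultimately show ?case by (rule back_subst[of "\<lambda>g. g \<in> bump_alg", rotated])
qed (simp_all add: bump_alg.const bump_alg.add bump_alg.mult)

text \<open>A product of one-dimensional bumps, positive on \<open>cube r\<close> and zero
  elsewhere. The unsimplified coefficients -1 and 1 match the shape demanded by the rule
  \<open>bump\<close>.\<close>

definition cutoff :: "real \<Rightarrow> real^'n::finite \<Rightarrow> real"
  where "cutoff r x = (\<Prod>i\<in>UNIV. ebump 1 (r + (-1) * x $ i) * ebump 1 (r + 1 * x $ i))"

lemma cutoff_bump_alg: "cutoff r \<in> bump_alg"
  unfolding cutoff_def by (intro bump_alg_prod bump_alg.mult bump_alg.bump)

lemma cutoff_pos: "x \<in> cube r \<Longrightarrow> cutoff r x > 0"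
  unfolding cutoff_def
proof (intro prod_pos ballI)
  fix i assume "x \<in> cube r"
  then have "\<bar>x $ i\<bar> < r" by (simp add: mem_cube)
  then show "0 < ebump 1 (r + (-1) * x $ i) * ebump 1 (r + 1 * x $ i)"
    by (simp add: ebump_def abs_less_iff)
qed

lemma cutoff_eq_0: "x \<notin> cube r \<Longrightarrow> cutoff r x = 0"
proof -
  assume "x \<notin> cube r"
  then obtain i where "\<not> \<bar>x $ i\<bar> < r" by (auto simp: mem_cube)
  then have "ebump 1 (r + (-1) * x $ i) * ebump 1 (r + 1 * x $ i) = 0"
    by (auto simp: ebump_def abs_less_iff)
  then show ?thesis unfolding cutoff_def by (intro prod_zero) auto
qed

lemma ccube_subset_cube: "r < R \<Longrightarrow> ccube r \<subseteq> cube R"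
  unfolding subset_eq mem_cube Ball_def mem_ccube by (meson le_less_trans)

lemma support_subsetI: "closed K \<Longrightarrow> (\<And>x. x \<notin> K \<Longrightarrow> f x = 0) \<Longrightarrow> support f \<subseteq> K"
  unfolding support_def by (rule closure_minimal) auto

text \<open>A factor that vanishes off a compact subset upgrades local integrability to
  integrability over the whole cube.\<close>

lemma loc_integrable_mult:
  fixes f :: "real^'n \<Rightarrow> real"
  assumes w: "loc_integrable (cube R) w" and f: "continuous_on UNIV f"
    and K: "compact K" "K \<subseteq> cube R" "\<And>x. x \<notin> K \<Longrightarrow> f x = 0"
  shows "integrable (QM R) (\<lambda>x. w x * f x)"
proof -
  have "bounded (f ` K)"
    using compact_continuous_image[OF continuous_on_subset[OF f] K(1)] compact_imp_bounded by blast
  then obtain C where "\<And>x. x \<in> K \<Longrightarrow> \<bar>f x\<bar> \<le> C" by (auto simp: bounded_iff)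
  then have C: "\<bar>f x\<bar> \<le> max C 0" for x using K(3) by (cases "x \<in> K") (auto simp: le_max_iff_disj)
  have i: "integrable lebesgue (\<lambda>x. indicator K x *\<^sub>R w x)"
    using w K(1,2) by (auto simp: loc_integrable_def set_integrable_def)
  have m: "f \<in> borel_measurable lebesgue"
    using f by (intro measurable_completion) (simp add: borel_measurable_continuous_onI)
  have "integrable lebesgue (\<lambda>x. (indicator K x *\<^sub>R w x) * f x)"
  proof (rule Bochner_Integration.integrable_bound)
    show "integrable lebesgue (\<lambda>x. max C 0 *\<^sub>R (indicator K x *\<^sub>R w x))" using i by simp
    show "(\<lambda>x. (indicator K x *\<^sub>R w x) * f x) \<in> borel_measurable lebesgue"
      using i m by (intro borel_measurable_times) auto
    show "AE x in lebesgue. norm ((indicator K x *\<^sub>R w x) * f x) \<le> norm (max C 0 *\<^sub>R (indicator K x *\<^sub>R w x))"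
    proof (rule AE_I2)
      fix x
      have "\<bar>indicator K x * w x\<bar> * \<bar>f x\<bar> \<le> \<bar>indicator K x * w x\<bar> * max C 0"
        by (intro mult_left_mono C) simp
      then show "norm ((indicator K x *\<^sub>R w x) * f x) \<le> norm (max C 0 *\<^sub>R (indicator K x *\<^sub>R w x))"
        by (simp add: abs_mult mult.commute)
    qed
  qed
  moreover have "(\<lambda>x. (indicator K x *\<^sub>R w x) * f x) = (\<lambda>x. indicator (cube R) x *\<^sub>R (w x * f x))"
    using K(2,3) by (fastforce simp: indicator_def)
  moreover have "cube R \<inter> space lebesgue \<in> sets (lebesgue :: (real^'n) measure)" by auto
  ultimately show ?thesis by (simp only: integrable_restrict_space)
qed

text \<open>No mollification is involved: a cutoff times a polynomial is a test function, so the
  localized function W annihilates all polynomials, by Stone-Weierstrass all continuous functions,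
  and by approximation a bounded measurable function with the sign of W.\<close>

lemma fundamental_lemma:
  fixes w :: "real^'n::finite \<Rightarrow> real"
  assumes R: "R > 0" and w: "loc_integrable (cube R) w"
    and z: "\<And>f. smooth f \<Longrightarrow> compact (support f) \<Longrightarrow> support f \<subseteq> cube R \<Longrightarrow>
      (\<integral>x. w x * f x \<partial>QM R) = 0"
  shows "AE x in QM R. w x = 0"
proof -
  let ?M = "QM R :: (real^'n) measure"
  have *: "AE x in ?M. x \<in> cube r \<longrightarrow> w x = 0" if r: "r < R" for r
  proof -
    let ?\<chi> = "cutoff r :: real^'n \<Rightarrow> real"
    define W where "W x = w x * ?\<chi> x" for x
    have K: "compact (ccube r :: (real^'n) set)" "ccube r \<subseteq> (cube R :: (real^'n) set)"
      using compact_ccube ccube_subset_cube[OF r] by auto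
    have \<chi>0: "?\<chi> x = 0" if "x \<notin> ccube r" for x
      using that cube_subset_ccube[of r] by (intro cutoff_eq_0) auto
    have \<chi>c: "continuous_on UNIV ?\<chi>"
      by (rule smooth_continuous[OF bump_alg_smooth[OF cutoff_bump_alg]])
    have iW: "integrable ?M W" unfolding W_def
      by (rule loc_integrable_mult[OF w \<chi>c K]) (rule \<chi>0)
    have poly: "(\<integral>x. W x * p x \<partial>?M) = 0" if "real_polynomial_function p" for p
    proof -
      let ?f = "\<lambda>x. ?\<chi> x * p x"
      have "?f \<in> bump_alg" by (intro bump_alg.mult cutoff_bump_alg polynomial_bump_alg that)
      then have "smooth ?f" by (rule bump_alg_smooth)
      moreover have s: "support ?f \<subseteq> ccube r"
        by (rule support_subsetI) (use K \<chi>0 in \<open>auto intro: compact_imp_closed\<close>)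
      moreover have "compact (support ?f)"
        using s K(1) by (metis closed_closure compact_Int_closed inf.absorb2 support_def)
      ultimately have "(\<integral>x. w x * ?f x \<partial>?M) = 0" using K(2) by (intro z) auto
      then show ?thesis by (simp add: W_def mult.assoc)
    qed
    \<comment> \<open>A polynomial is uniformly within \<open>e\<close> of \<open>g\<close> on the
      closed cube and W is integrable, so the integral is at most a fixed multiple of every
      \<open>e\<close>.\<close>
    have cont: "(\<integral>x. W x * g x \<partial>?M) = 0" if g: "continuous_on UNIV g" for g
    proof -
      let ?Wg = "\<integral>x. W x * g x \<partial>?M"
      have int: "integrable ?M (\<lambda>x. W x * h x)" if "continuous_on UNIV h" for h
        unfolding W_def mult.assoc
        by (rule loc_integrable_mult[OF w _ K]) (use \<chi>0 in \<open>auto intro!: continuous_intros that \<chi>c\<close>)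
      have "\<bar>?Wg\<bar> \<le> e * (\<integral>x. \<bar>W x\<bar> \<partial>?M)" if e: "e > 0" for e
      proof -
        obtain p where p: "real_polynomial_function p" "\<And>x. x \<in> ccube R \<Longrightarrow> \<bar>g x - p x\<bar> < e"
          using Stone_Weierstrass_real_polynomial_function[OF compact_ccube continuous_on_subset[OF g] e] by (metis subset_UNIV)
        have cp: "continuous_on UNIV p"
          using smooth_continuous[OF bump_alg_smooth[OF polynomial_bump_alg[OF p(1)]]] .
        have "?Wg = ?Wg - (\<integral>x. W x * p x \<partial>?M)"
          using poly[OF p(1)] by simp
        also have "\<dots> = (\<integral>x. W x * g x - W x * p x \<partial>?M)"
          using int[OF g] int[OF cp] by simp
        finally have "\<bar>?Wg\<bar> \<le> (\<integral>x. \<bar>W x * g x - W x * p x\<bar> \<partial>?M)"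
          by (simp add: integral_abs_bound)
        also have "\<dots> \<le> (\<integral>x. e * \<bar>W x\<bar> \<partial>?M)"
        proof (rule integral_mono_AE)
          show "integrable ?M (\<lambda>x. \<bar>W x * g x - W x * p x\<bar>)" using int[OF g] int[OF cp] by auto
          show "integrable ?M (\<lambda>x. e * \<bar>W x\<bar>)" using iW by auto
          show "AE x in ?M. \<bar>W x * g x - W x * p x\<bar> \<le> e * \<bar>W x\<bar>"
            using AE_cube
          proof eventually_elim
            case (elim x)
            then have "\<bar>g x - p x\<bar> \<le> e" using p(2) cube_subset_ccube less_imp_le by blast
            then have "\<bar>W x\<bar> * \<bar>g x - p x\<bar> \<le> \<bar>W x\<bar> * e" by (intro mult_left_mono) auto
            then show ?case by (simp add: abs_mult mult.commute flip: right_diff_distrib)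
          qed
        qed
        finally show ?thesis by simp
      qed
      then have "\<bar>?Wg\<bar> \<le> e" if e: "e > 0" for e
      proof -
        let ?I = "\<integral>x. \<bar>W x\<bar> \<partial>?M"
        have I: "?I \<ge> 0" by simp
        then have "e / (?I + 1) > 0" using e by (intro divide_pos_pos) linarith+
        have "\<bar>?Wg\<bar> \<le> e / (?I + 1) * ?I"
          by (rule \<open>\<And>e. e > 0 \<Longrightarrow> \<bar>?Wg\<bar> \<le> e * ?I\<close>) fact
        also have "e / (I + 1) * I \<le> e" if "I \<ge> 0" for I using that e by (simp add: field_simps)
        then have "e / (?I + 1) * ?I \<le> e" using I .
        finally show ?thesis .
      qed
      then show ?thesis using field_le_epsilon[of "\<bar>?Wg\<bar>" 0] by fastforce
    qed
    \<comment> \<open>A bounded surrogate for the sign: W s = W^2 / (1 + |W|) is nonnegative and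
      vanishes only where W does.\<close>
    define s where "s x = W x / (1 + \<bar>W x\<bar>)" for x
    have sm: "s \<in> borel_measurable ?M" unfolding s_def using iW by measurable
    have s1: "\<bar>s x\<bar> \<le> 1" for x
    proof -
      have "\<bar>s x\<bar> = \<bar>W x\<bar> / (1 + \<bar>W x\<bar>)"
        unfolding s_def abs_divide by (rule arg_cong2[where f="(/)"]) auto
      also have "\<dots> \<le> 1" by (subst divide_le_eq_1_pos) auto
      finally show ?thesis .
    qed
    have "s measurable_on cube R"
      using sm by (subst measurable_on_iff_borel_measurable) auto
    then obtain N g where N: "negligible N" and g: "\<And>n. continuous_on UNIV (g n)"
      and lim: "\<And>x. x \<notin> N \<Longrightarrow> (\<lambda>n. g n x) \<longlonglongrightarrow> (if x \<in> cube R then s x else 0)"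
      unfolding measurable_on_def by blast
    \<comment> \<open>Truncation to [-1, 1] does not disturb the limit, since |s| <= 1, and makes
      |W| a dominating function.\<close>
    let ?g = "\<lambda>n x. max (-1) (min 1 (g n x))"
    have cg: "continuous_on UNIV (?g n)" for n by (intro continuous_intros g)
    have "(\<lambda>n. \<integral>x. W x * ?g n x \<partial>?M) \<longlonglongrightarrow> (\<integral>x. W x * s x \<partial>?M)"
    proof (rule integral_dominated_convergence[where w="\<lambda>x. \<bar>W x\<bar>"])
      show "(\<lambda>x. W x * s x) \<in> borel_measurable ?M" using iW sm by measurable
      show "(\<lambda>x. W x * ?g n x) \<in> borel_measurable ?M" for n
        using iW continuous_measurable_cube[OF cg] by measurable
      show "integrable ?M (\<lambda>x. \<bar>W x\<bar>)" using iW by simp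
      have "AE x in lebesgue. x \<notin> N" using N unfolding negligible_iff_null_sets by (rule AE_not_in)
      then have "AE x in ?M. x \<notin> N" by (simp add: AE_restrict_space_iff) (auto elim: eventually_mono)
      then show "AE x in ?M. (\<lambda>n. W x * ?g n x) \<longlonglongrightarrow> W x * s x"
        using AE_cube
      proof eventually_elim
        case (elim x)
        have "(\<lambda>n. ?g n x) \<longlonglongrightarrow> max (-1) (min 1 (s x))"
          using lim[OF elim(1)] elim(2) by (intro tendsto_intros) simp
        moreover have "max (-1) (min 1 (s x)) = s x" using s1[of x] by (auto simp: abs_le_iff)
        ultimately show ?case by (intro tendsto_intros) simp
      qed
      show "AE x in ?M. norm (W x * ?g n x) \<le> \<bar>W x\<bar>" for n
      proof (rule AE_I2)
        fix x
        have "\<bar>?g n x\<bar> \<le> 1" by (auto simp: abs_le_iff)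
        then have "\<bar>W x\<bar> * \<bar>?g n x\<bar> \<le> \<bar>W x\<bar> * 1" by (intro mult_left_mono) auto
        then show "norm (W x * ?g n x) \<le> \<bar>W x\<bar>" by (simp add: abs_mult)
      qed
    qed
    then have I0: "(\<integral>x. W x * s x \<partial>?M) = 0"
      using cont[OF cg] by (simp add: LIMSEQ_const_iff)
    have "integrable ?M (\<lambda>x. W x * s x)"
    proof (rule Bochner_Integration.integrable_bound)
      show "integrable ?M (\<lambda>x. \<bar>W x\<bar>)" using iW by simp
      show "(\<lambda>x. W x * s x) \<in> borel_measurable ?M" using iW sm by measurable
      have "\<bar>W x\<bar> * \<bar>s x\<bar> \<le> \<bar>W x\<bar> * 1" for x by (intro mult_left_mono s1) auto
      then show "AE x in ?M. norm (W x * s x) \<le> norm \<bar>W x\<bar>" by (auto simp: abs_mult)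
    qed
    moreover have "W x * s x \<ge> 0" for x by (simp add: s_def)
    ultimately have "AE x in ?M. W x * s x = 0" using I0 by (subst (asm) integral_nonneg_eq_0_iff_AE) auto
    then show ?thesis
    proof eventually_elim
      case (elim x)
      then have "W x = 0" by (auto simp: s_def add_nonneg_eq_0_iff)
      then show ?case using cutoff_pos[of x r] by (auto simp: W_def)
    qed
  qed
  \<comment> \<open>Countably many smaller cubes exhaust the open cube, and on each of them the
    cutoff is positive.\<close>
  have "AE x in ?M. \<forall>n. x \<in> cube (R - inverse (real (Suc n))) \<longrightarrow> w x = 0"
    by (subst AE_all_countable) (auto intro: *)
  then show ?thesis using AE_cube
  proof eventually_elim
    case (elim x)
    let ?m = "Max (range (\<lambda>i. \<bar>x $ i\<bar>))"
    have "?m < R" using elim(2) by (subst Max_less_iff) (auto simp: mem_cube)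
    then obtain n where n: "inverse (real (Suc n)) < R - ?m" using reals_Archimedean[of "R - ?m"] by auto
    have "\<bar>x $ i\<bar> \<le> ?m" for i by (rule Max_ge) auto
    then have "x \<in> cube (R - inverse (real (Suc n)))"
      using n unfolding mem_cube by (smt (verit, ccfv_SIG))
    then show ?case using elim(1) by blast
  qed
qed

lemma has_wpartial_unique:
  fixes w :: "real^'n::finite \<Rightarrow> real"
  assumes "R > 0" "has_wpartial (cube R) i w g" "has_wpartial (cube R) i w g'"
  shows "AE x in QM R. g x = g' x"
proof -
  have l: "loc_integrable (cube R) g" "loc_integrable (cube R) g'"
    using assms by (auto simp: has_wpartial_def)
  have "AE x in QM R. g x - g' x = 0"
  proof (rule fundamental_lemma[OF assms(1)])
    show "loc_integrable (cube R) (\<lambda>x. g x - g' x)"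
      using l by (auto simp: loc_integrable_def intro: set_integral_diff(1))
    fix f :: "real^'n \<Rightarrow> real" assume f: "smooth f" "compact (support f)" "support f \<subseteq> cube R"
    have f0: "f x = 0" if "x \<notin> support f" for x
      using that closure_subset[of "{x. f x \<noteq> 0}"] by (auto simp: support_def)
    have int: "integrable (QM R) (\<lambda>x. g x * f x)" "integrable (QM R) (\<lambda>x. g' x * f x)"
      using loc_integrable_mult[OF l(1) smooth_continuous[OF f(1)] f(2,3) f0]
        loc_integrable_mult[OF l(2) smooth_continuous[OF f(1)] f(2,3) f0] by simp_all
    have "(\<integral>x. w x * partial i f x \<partial>QM R) = - (\<integral>x. g x * f x \<partial>QM R)"
      using assms(2) f by (simp add: has_wpartial_def)
    moreover have "(\<integral>x. w x * partial i f x \<partial>QM R) = - (\<integral>x. g' x * f x \<partial>QM R)"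
      using assms(3) f by (simp add: has_wpartial_def)
    ultimately show "(\<integral>x. (g x - g' x) * f x \<partial>QM R) = 0"
      using int by (simp add: left_diff_distrib)
  qed
  then show ?thesis by simp
qed

section \<open>Functions with vanishing Cauchy data\<close>

text \<open>The closure of C1 functions in H1, with the gradient \<open>g\<close> carried along.
  Sums and Leibniz rules act on explicit families here, whereas \<open>wpartial\<close> is a choice
  and obeys such rules only almost everywhere.\<close>

definition H1_approx :: "real \<Rightarrow> (real^'n::finite \<Rightarrow> real) \<Rightarrow> ('n \<Rightarrow> real^'n \<Rightarrow> real) \<Rightarrow> bool"
  where "H1_approx R h g \<longleftrightarrow> h \<in> L2 (QM R) \<and> (\<forall>i. g i \<in> L2 (QM R)) \<and>
    (\<exists>p dp. (\<forall>k. C1_grad (p k) (dp k)) \<and> tendsto_L2 (QM R) p h \<and>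
      (\<forall>i. tendsto_L2 (QM R) (\<lambda>k. dp k i) (g i)))"

text \<open>The test functions are not required to vanish near the boundary, so this encodes a zero trace.\<close>

definition H10 :: "real \<Rightarrow> (real^'n::finite \<Rightarrow> real) \<Rightarrow> ('n \<Rightarrow> real^'n \<Rightarrow> real) \<Rightarrow> bool"
  where "H10 R h g \<longleftrightarrow> H1_approx R h g \<and>
    (\<forall>\<psi> d\<psi> i. C1_grad \<psi> d\<psi> \<longrightarrow> (\<integral>x. g i x * \<psi> x + h x * d\<psi> i x \<partial>QM R) = 0)"

lemma integrable_L2_mult3:
  fixes a f g :: "real^'n \<Rightarrow> real"
  assumes "continuous_on UNIV a" "f \<in> L2 (QM R)" "g \<in> L2 (QM R)"
  shows "integrable (QM R) (\<lambda>x. a x * f x * g x)"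
  using L2_integrable_mult[OF L2_continuous_mult[OF assms(1,2)] assms(3)] .

lemma tendsto_L2_continuous_mult:
  fixes a f :: "real^'n \<Rightarrow> real"
  assumes "continuous_on UNIV a" "tendsto_L2 (QM R) p f"
  shows "tendsto_L2 (QM R) (\<lambda>k x. a x * p k x) (\<lambda>x. a x * f x)"
  using continuous_AE_bounded_cube[OF assms(1)]
    tendsto_L2_bounded_mult[OF assms(2) continuous_measurable_cube[OF assms(1)]] by metis

lemma H1_approx_L2: "H1_approx R h g \<Longrightarrow> h \<in> L2 (QM R)" "H1_approx R h g \<Longrightarrow> g i \<in> L2 (QM R)"
  by (auto simp: H1_approx_def)

lemma H10_approx: "H10 R h g \<Longrightarrow> H1_approx R h g"
  by (simp add: H10_def)

lemma H1_approx_mult: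
  assumes a: "C1_grad a da" and h: "H1_approx R h g"
  shows "H1_approx R (\<lambda>x. a x * h x) (\<lambda>i x. da i x * h x + a x * g i x)"
proof -
  have ca: "continuous_on UNIV a" "continuous_on UNIV (da i)" for i
    using C1_grad_continuous[OF a] C1_grad_continuous'[OF a] by auto
  obtain p dp where p: "\<And>k. C1_grad (p k) (dp k)" "tendsto_L2 (QM R) p h"
    "\<And>i. tendsto_L2 (QM R) (\<lambda>k. dp k i) (g i)" and L: "h \<in> L2 (QM R)" "\<And>i. g i \<in> L2 (QM R)"
    using h unfolding H1_approx_def by auto
  have "\<forall>k. C1_grad (\<lambda>x. a x * p k x) (\<lambda>i x. da i x * p k x + a x * dp k i x)"
    using C1_grad_mult[OF a p(1)] by auto
  moreover have "tendsto_L2 (QM R) (\<lambda>k x. a x * p k x) (\<lambda>x. a x * h x)"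
    by (intro tendsto_L2_continuous_mult ca p)
  moreover have "\<forall>i. tendsto_L2 (QM R) (\<lambda>k x. da i x * p k x + a x * dp k i x) (\<lambda>x. da i x * h x + a x * g i x)"
    by (intro allI tendsto_L2_add tendsto_L2_continuous_mult ca p)
  moreover have "(\<lambda>x. a x * h x) \<in> L2 (QM R)" "(\<lambda>x. da i x * h x + a x * g i x) \<in> L2 (QM R)" for i
    by (intro L2_add L2_continuous_mult ca L)+
  ultimately show ?thesis unfolding H1_approx_def by (intro conjI allI exI) (assumption | erule allE)+
qed

lemma H1_approx_add:
  assumes "H1_approx R h g" "H1_approx R h' g'"
  shows "H1_approx R (\<lambda>x. h x + h' x) (\<lambda>i x. g i x + g' i x)"
proof -
  obtain p dp where p: "\<And>k. C1_grad (p k) (dp k)" "tendsto_L2 (QM R) p h"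
    "\<And>i. tendsto_L2 (QM R) (\<lambda>k. dp k i) (g i)" and L: "h \<in> L2 (QM R)" "\<And>i. g i \<in> L2 (QM R)"
    using assms(1) unfolding H1_approx_def by auto
  obtain p' dp' where p': "\<And>k. C1_grad (p' k) (dp' k)" "tendsto_L2 (QM R) p' h'"
    "\<And>i. tendsto_L2 (QM R) (\<lambda>k. dp' k i) (g' i)" and L': "h' \<in> L2 (QM R)" "\<And>i. g' i \<in> L2 (QM R)"
    using assms(2) unfolding H1_approx_def by auto
  have "\<forall>k. C1_grad (\<lambda>x. p k x + p' k x) (\<lambda>i x. dp k i x + dp' k i x)"
    using C1_grad_add[OF p(1) p'(1)] by auto
  moreover have "tendsto_L2 (QM R) (\<lambda>k x. p k x + p' k x) (\<lambda>x. h x + h' x)"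
    by (intro tendsto_L2_add p p')
  moreover have "\<forall>i. tendsto_L2 (QM R) (\<lambda>k x. dp k i x + dp' k i x) (\<lambda>x. g i x + g' i x)"
    by (intro allI tendsto_L2_add p p')
  moreover have "(\<lambda>x. h x + h' x) \<in> L2 (QM R)" "(\<lambda>x. g i x + g' i x) \<in> L2 (QM R)" for i
    by (intro L2_add L L')+
  ultimately show ?thesis unfolding H1_approx_def by (intro conjI allI exI) (assumption | erule allE)+
qed

lemma H10_mult:
  fixes h :: "real^'n::finite \<Rightarrow> real"
  assumes a: "C1_grad a da" and h: "H10 R h g"
  shows "H10 R (\<lambda>x. a x * h x) (\<lambda>i x. da i x * h x + a x * g i x)"
  unfolding H10_def
proof (intro conjI allI impI)
  show "H1_approx R (\<lambda>x. a x * h x) (\<lambda>i x. da i x * h x + a x * g i x)"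
    by (rule H1_approx_mult[OF a H10_approx[OF h]])
  fix \<psi> :: "real^'n \<Rightarrow> real" and d\<psi> i assume "C1_grad \<psi> d\<psi>"
  from C1_grad_mult[OF a this]
  have "(\<integral>x. g i x * (a x * \<psi> x) + h x * (da i x * \<psi> x + a x * d\<psi> i x) \<partial>QM R) = 0"
    using h unfolding H10_def by blast
  then show "(\<integral>x. (da i x * h x + a x * g i x) * \<psi> x + a x * h x * d\<psi> i x \<partial>QM R) = 0"
    by (simp add: algebra_simps)
qed

lemma H10_add:
  fixes h :: "real^'n::finite \<Rightarrow> real"
  assumes "H10 R h g" "H10 R h' g'"
  shows "H10 R (\<lambda>x. h x + h' x) (\<lambda>i x. g i x + g' i x)"
  unfolding H10_def
proof (intro conjI allI impI)
  show "H1_approx R (\<lambda>x. h x + h' x) (\<lambda>i x. g i x + g' i x)"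
    using assms by (intro H1_approx_add H10_approx)
  fix \<psi> :: "real^'n \<Rightarrow> real" and d\<psi> i assume \<psi>: "C1_grad \<psi> d\<psi>"
  have c: "\<psi> \<in> L2 (QM R)" "d\<psi> i \<in> L2 (QM R)"
    by (intro L2_continuous_cube C1_grad_continuous[OF \<psi>] C1_grad_continuous'[OF \<psi>])+
  have int: "integrable (QM R) (\<lambda>x. g i x * \<psi> x + h x * d\<psi> i x)"
     "integrable (QM R) (\<lambda>x. g' i x * \<psi> x + h' x * d\<psi> i x)"
    by (intro Bochner_Integration.integrable_add L2_integrable_mult c
        H1_approx_L2[OF H10_approx[OF assms(1)]] H1_approx_L2[OF H10_approx[OF assms(2)]])+
  have "(\<integral>x. (g i x * \<psi> x + h x * d\<psi> i x) + (g' i x * \<psi> x + h' x * d\<psi> i x) \<partial>QM R) = 0"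
    using assms \<psi> int unfolding H10_def by simp
  then show "(\<integral>x. (g i x + g' i x) * \<psi> x + (h x + h' x) * d\<psi> i x \<partial>QM R) = 0"
    by (simp add: algebra_simps)
qed

text \<open>\<open>H10\<close> states the identity for C1 test functions; its left-hand side is
  continuous in the second factor under H1 convergence. The zero trace of one factor removes the
  boundary term.\<close>

lemma H10_parts:
  assumes f: "H10 R f df" and g: "H1_approx R g dg"
  shows "(\<integral>x. df i x * g x + f x * dg i x \<partial>QM R) = 0"
proof -
  obtain p dp where p: "\<And>k. C1_grad (p k) (dp k)" "tendsto_L2 (QM R) p g"
    "\<And>i. tendsto_L2 (QM R) (\<lambda>k. dp k i) (dg i)" and L: "g \<in> L2 (QM R)" "\<And>i. dg i \<in> L2 (QM R)"
    using g unfolding H1_approx_def by auto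
  have Lf: "f \<in> L2 (QM R)" "df i \<in> L2 (QM R)" using H1_approx_L2[OF H10_approx[OF f]] by auto
  have Lp: "p k \<in> L2 (QM R)" "dp k i \<in> L2 (QM R)" for k
    by (intro L2_continuous_cube C1_grad_continuous[OF p(1)] C1_grad_continuous'[OF p(1)])+
  have "(\<lambda>k. (\<integral>x. p k x * df i x \<partial>QM R) + (\<integral>x. dp k i x * f x \<partial>QM R))
    \<longlonglongrightarrow> (\<integral>x. g x * df i x \<partial>QM R) + (\<integral>x. dg i x * f x \<partial>QM R)"
    by (intro tendsto_add tendsto_L2_integral p L Lf)
  moreover have "(\<integral>x. p k x * df i x \<partial>QM R) + (\<integral>x. dp k i x * f x \<partial>QM R) = 0" for k
  proof -
    have "(\<integral>x. df i x * p k x + f x * dp k i x \<partial>QM R) = 0"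
      using f p(1) unfolding H10_def by blast
    then show ?thesis
      by (subst (asm) Bochner_Integration.integral_add) (auto intro: L2_integrable_mult Lf Lp simp: mult.commute)
  qed
  ultimately have "(\<integral>x. g x * df i x \<partial>QM R) + (\<integral>x. dg i x * f x \<partial>QM R) = 0"
    by (simp add: LIMSEQ_const_iff)
  then show ?thesis
    by (subst Bochner_Integration.integral_add) (auto intro: L2_integrable_mult Lf L simp: mult.commute)
qed

text \<open>The working form of integration by parts for the Carleman estimate; the coefficient is
  absorbed into the factor with zero trace.\<close>

lemma H10_parts_coeff:
  assumes c: "C1_grad c dc" and f: "H10 R f df" and g: "H1_approx R g dg"
  shows "(\<integral>x. c x * df i x * g x \<partial>QM R) =
    - (\<integral>x. c x * f x * dg i x \<partial>QM R) - (\<integral>x. dc i x * f x * g x \<partial>QM R)"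
proof -
  have cc: "continuous_on UNIV c" "continuous_on UNIV (dc i)"
    using C1_grad_continuous[OF c] C1_grad_continuous'[OF c] by auto
  have Lf: "f \<in> L2 (QM R)" "df i \<in> L2 (QM R)" using H1_approx_L2[OF H10_approx[OF f]] by auto
  have L: "g \<in> L2 (QM R)" "dg i \<in> L2 (QM R)" using H1_approx_L2[OF g] by auto
  have "(\<integral>x. (dc i x * f x + c x * df i x) * g x + c x * f x * dg i x \<partial>QM R) = 0"
    by (rule H10_parts[OF H10_mult[OF c f] g])
  then have "(\<integral>x. (dc i x * f x * g x + c x * df i x * g x) + c x * f x * dg i x \<partial>QM R) = 0"
    by (simp add: algebra_simps)
  then show ?thesis
    by (subst (asm) Bochner_Integration.integral_add;
        (subst (asm) Bochner_Integration.integral_add)?;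
        (intro Bochner_Integration.integrable_add integrable_L2_mult3 cc Lf L)?) simp
qed

definition C2_grad :: "(real^'n::finite \<Rightarrow> real) \<Rightarrow> ('n \<Rightarrow> real^'n \<Rightarrow> real) \<Rightarrow> ('n \<Rightarrow> 'n \<Rightarrow> real^'n \<Rightarrow> real) \<Rightarrow> bool"
  where "C2_grad a da dda \<longleftrightarrow> C1_grad a da \<and> (\<forall>i. C1_grad (da i) (dda i))"

lemma C2_grad_smooth: "smooth f \<Longrightarrow> C2_grad f (\<lambda>i. partial i f) (\<lambda>i j. partial j (partial i f))"
  by (simp add: C2_grad_def C1_grad_smooth smooth_partial)

lemma C2_grad_sym: "C2_grad f df ddf \<Longrightarrow> ddf i j x = ddf j i x"
  unfolding C2_grad_def by (rule mixed_partials_eq) auto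

lemma C2_grad_mult:
  assumes "C2_grad a da dda" "C2_grad b db ddb"
  shows "\<exists>ddc. C2_grad (\<lambda>x. a x * b x) (\<lambda>i x. da i x * b x + a x * db i x) ddc"
proof -
  have "\<exists>dd. C1_grad (\<lambda>x. da i x * b x + a x * db i x) dd" for i
  proof -
    have "C1_grad (da i) (dda i)" "C1_grad b db" "C1_grad a da" "C1_grad (db i) (ddb i)"
      using assms by (auto simp: C2_grad_def)
    from C1_grad_add[OF C1_grad_mult[OF this(1,2)] C1_grad_mult[OF this(3,4)]] show ?thesis by blast
  qed
  then obtain ddc where "\<And>i. C1_grad (\<lambda>x. da i x * b x + a x * db i x) (ddc i)" by metis
  then show ?thesis using assms C1_grad_mult unfolding C2_grad_def by blast
qed

lemma C1_grad_diff:
  assumes "C1_grad a da" "C1_grad b db"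
  shows "C1_grad (\<lambda>x. a x - b x) (\<lambda>i x. da i x - db i x)"
  using C1_grad_add[OF assms(1) C1_grad_cmult[OF assms(2), of "-1"]] by simp

lemma C2_grad_coord: "C2_grad (\<lambda>x. x $ k) (\<lambda>i x. if i = k then 1 else 0) (\<lambda>i j x. 0)"
  by (simp add: C2_grad_def C1_grad_coord C1_grad_const)

section \<open>Traces and Green's formula\<close>

text \<open>C2 approximants are demanded because they later become test functions themselves, at a
  place where the symmetry of their second derivatives is used. The smooth approximants of
  \<open>has_trace\<close> qualify.\<close>

definition H1_trace :: "real \<Rightarrow> (real^'n::finite \<Rightarrow> real) \<Rightarrow> ('n \<Rightarrow> real^'n \<Rightarrow> real) \<Rightarrow> (real^'n \<Rightarrow> real) \<Rightarrow> bool"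
  where "H1_trace R h g \<tau> \<longleftrightarrow>
    (\<exists>p dp ddp. (\<forall>k. C2_grad (p k) (dp k) (ddp k)) \<and> tendsto_L2 (QM R) p h \<and>
      (\<forall>i. tendsto_L2 (QM R) (\<lambda>k. dp k i) (g i)) \<and>
      (\<forall>i. \<forall>\<sigma>\<in>{-1, 1}. tendsto_L2 (face_measure R i \<sigma>) p \<tau>))"

lemma H1_traceE:
  assumes "H1_trace R h g \<tau>"
  obtains p dp ddp where "\<And>k. C2_grad (p k) (dp k) (ddp k)" "\<And>k. C1_grad (p k) (dp k)"
    "tendsto_L2 (QM R) p h" "\<And>i. tendsto_L2 (QM R) (\<lambda>k. dp k i) (g i)"
    "\<And>i \<sigma>. \<sigma> \<in> {-1, 1} \<Longrightarrow> tendsto_L2 (face_measure R i \<sigma>) p \<tau>"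
proof -
  from assms obtain p dp ddp where *: "\<forall>k. C2_grad (p k) (dp k) (ddp k)"
    "tendsto_L2 (QM R) p h" "\<forall>i. tendsto_L2 (QM R) (\<lambda>k. dp k i) (g i)"
    "\<forall>i. \<forall>\<sigma>\<in>{-1, 1}. tendsto_L2 (face_measure R i \<sigma>) p \<tau>"
    unfolding H1_trace_def by (elim exE conjE)
  show thesis
    by (rule that[of p dp ddp]) (use * in \<open>auto simp: C2_grad_def\<close>)
qed

lemma has_trace_H1_trace:
  assumes "has_trace R w \<tau>" shows "H1_trace R w (\<lambda>i. wpartial (cube R) i w) \<tau>"
proof -
  obtain p where p: "\<And>k. smooth (p k)" "tendsto_L2 (QM R) p w"
    "\<forall>i. tendsto_L2 (QM R) (\<lambda>k. partial i (p k)) (wpartial (cube R) i w)"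
    "\<forall>i. \<forall>\<sigma>\<in>{-1, 1}. tendsto_L2 (face_measure R i \<sigma>) p \<tau>"
    using assms unfolding has_trace_def by auto
  show ?thesis unfolding H1_trace_def
    by (rule exI[of _ p], rule exI[of _ "\<lambda>k i. partial i (p k)"], rule exI[of _ "\<lambda>k i j. partial j (partial i (p k))"])
      (use p C2_grad_smooth in auto)
qed

lemma H1_trace_diff:
  assumes "H1_trace R h g \<tau>" "H1_trace R h' g' \<tau>'"
  shows "H1_trace R (\<lambda>x. h x - h' x) (\<lambda>i x. g i x - g' i x) (\<lambda>x. \<tau> x - \<tau>' x)"
proof -
  obtain p dp ddp where p: "\<And>k. C2_grad (p k) (dp k) (ddp k)" and C: "\<And>k. C1_grad (p k) (dp k)"
    and hp: "tendsto_L2 (QM R) p h" and gp: "\<And>i. tendsto_L2 (QM R) (\<lambda>k. dp k i) (g i)"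
    and \<tau>p: "\<And>i \<sigma>. \<sigma> \<in> {-1, 1} \<Longrightarrow> tendsto_L2 (face_measure R i \<sigma>) p \<tau>"
    by (rule H1_traceE[OF assms(1)]) blast
  obtain p' dp' ddp' where p': "\<And>k. C2_grad (p' k) (dp' k) (ddp' k)" and C': "\<And>k. C1_grad (p' k) (dp' k)"
    and hp': "tendsto_L2 (QM R) p' h'" and gp': "\<And>i. tendsto_L2 (QM R) (\<lambda>k. dp' k i) (g' i)"
    and \<tau>p': "\<And>i \<sigma>. \<sigma> \<in> {-1, 1} \<Longrightarrow> tendsto_L2 (face_measure R i \<sigma>) p' \<tau>'"
    by (rule H1_traceE[OF assms(2)]) blast
  show ?thesis unfolding H1_trace_def
  proof (rule exI[of _ "\<lambda>k x. p k x - p' k x"], rule exI[of _ "\<lambda>k i x. dp k i x - dp' k i x"],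
      rule exI[of _ "\<lambda>k i j x. ddp k i j x - ddp' k i j x"], intro conjI allI ballI)
    show "C2_grad (\<lambda>x. p k x - p' k x) (\<lambda>i x. dp k i x - dp' k i x) (\<lambda>i j x. ddp k i j x - ddp' k i j x)" for k
      using p[of k] p'[of k] by (simp add: C2_grad_def C1_grad_diff)
  qed (intro tendsto_L2_diff hp hp' gp gp' \<tau>p \<tau>p'; assumption)+
qed

lemma H1_trace_approx:
  assumes "H1_trace R h g \<tau>" shows "H1_approx R h g"
proof -
  obtain p dp ddp where p: "\<And>k. C2_grad (p k) (dp k) (ddp k)" and C: "\<And>k. C1_grad (p k) (dp k)"
    and hp: "tendsto_L2 (QM R) p h" and gp: "\<And>i. tendsto_L2 (QM R) (\<lambda>k. dp k i) (g i)"
    and \<tau>p: "\<And>i \<sigma>. \<sigma> \<in> {-1, 1} \<Longrightarrow> tendsto_L2 (face_measure R i \<sigma>) p \<tau>"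
    by (rule H1_traceE[OF assms(1)]) blast
  have "h \<in> L2 (QM R)"
    by (rule tendsto_L2_mem[OF hp]) (intro L2_continuous_cube C1_grad_continuous[OF C])
  moreover have "g i \<in> L2 (QM R)" for i
    by (rule tendsto_L2_mem[OF gp]) (intro L2_continuous_cube C1_grad_continuous'[OF C])
  ultimately show ?thesis using C hp gp unfolding H1_approx_def by blast
qed

lemma H1_trace_L2_face:
  assumes "H1_trace R h g \<tau>" "R > 0" "\<sigma> \<in> {-1, 1}" shows "\<tau> \<in> L2 (face_measure R i \<sigma>)"
proof -
  obtain p dp ddp where p: "\<And>k. C2_grad (p k) (dp k) (ddp k)" and C: "\<And>k. C1_grad (p k) (dp k)"
    and hp: "tendsto_L2 (QM R) p h" and gp: "\<And>i. tendsto_L2 (QM R) (\<lambda>k. dp k i) (g i)"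
    and \<tau>p: "\<And>i \<sigma>. \<sigma> \<in> {-1, 1} \<Longrightarrow> tendsto_L2 (face_measure R i \<sigma>) p \<tau>"
    by (rule H1_traceE[OF assms(1)]) blast
  show ?thesis
    by (rule tendsto_L2_mem[OF \<tau>p[OF assms(3)]]) (intro L2_continuous_face C1_grad_continuous[OF C] assms)
qed

text \<open>The divergence theorem for \<open>p k * \<psi>\<close>, with the volume integrals and
  the face integrals passing to the limit separately.\<close>

lemma H1_trace_green:
  assumes h: "H1_trace R h g \<tau>" and R: "R > 0" and \<psi>: "C1_grad \<psi> d\<psi>"
  shows "(\<integral>x. g i x * \<psi> x + h x * d\<psi> i x \<partial>QM R) =
    (\<integral>x. \<tau> x * \<psi> x \<partial>face_measure R i 1) - (\<integral>x. \<tau> x * \<psi> x \<partial>face_measure R i (-1))"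
proof -
  obtain p dp ddp where p: "\<And>k. C2_grad (p k) (dp k) (ddp k)" and C: "\<And>k. C1_grad (p k) (dp k)"
    and hp: "tendsto_L2 (QM R) p h" and gp: "\<And>i. tendsto_L2 (QM R) (\<lambda>k. dp k i) (g i)"
    and \<tau>p: "\<And>i \<sigma>. \<sigma> \<in> {-1, 1} \<Longrightarrow> tendsto_L2 (face_measure R i \<sigma>) p \<tau>"
    by (rule H1_traceE[OF h]) blast
  have c: "continuous_on UNIV \<psi>" "continuous_on UNIV (d\<psi> i)"
    using C1_grad_continuous[OF \<psi>] C1_grad_continuous'[OF \<psi>] by auto
  have L: "h \<in> L2 (QM R)" "g i \<in> L2 (QM R)" using H1_approx_L2[OF H1_trace_approx[OF h]] by auto
  have Lp: "p k \<in> L2 (QM R)" "dp k i \<in> L2 (QM R)" for k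
    by (intro L2_continuous_cube C1_grad_continuous[OF C] C1_grad_continuous'[OF C])+
  have L\<psi>: "\<psi> \<in> L2 (QM R)" "d\<psi> i \<in> L2 (QM R)" by (intro L2_continuous_cube c)+
  have "(\<lambda>k. (\<integral>x. dp k i x * \<psi> x \<partial>QM R) + (\<integral>x. p k x * d\<psi> i x \<partial>QM R))
    \<longlonglongrightarrow> (\<integral>x. g i x * \<psi> x \<partial>QM R) + (\<integral>x. h x * d\<psi> i x \<partial>QM R)"
    by (intro tendsto_add tendsto_L2_integral gp hp L L\<psi>)
  moreover have "(\<integral>x. dp k i x * \<psi> x \<partial>QM R) + (\<integral>x. p k x * d\<psi> i x \<partial>QM R) =
      (\<integral>x. p k x * \<psi> x \<partial>face_measure R i 1) - (\<integral>x. p k x * \<psi> x \<partial>face_measure R i (-1))" for k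
    using cube_divergence[OF C1_grad_mult[OF C \<psi>] R, of k i]
    by (subst (asm) Bochner_Integration.integral_add) (auto intro: L2_integrable_mult Lp L\<psi>)
  moreover have "(\<lambda>k. (\<integral>x. p k x * \<psi> x \<partial>face_measure R i 1) - (\<integral>x. p k x * \<psi> x \<partial>face_measure R i (-1)))
    \<longlonglongrightarrow> (\<integral>x. \<tau> x * \<psi> x \<partial>face_measure R i 1) - (\<integral>x. \<tau> x * \<psi> x \<partial>face_measure R i (-1))"
    by (intro tendsto_diff tendsto_L2_integral \<tau>p H1_trace_L2_face[OF h R] L2_continuous_face c R) auto
  ultimately have "(\<integral>x. g i x * \<psi> x \<partial>QM R) + (\<integral>x. h x * d\<psi> i x \<partial>QM R) =
    (\<integral>x. \<tau> x * \<psi> x \<partial>face_measure R i 1) - (\<integral>x. \<tau> x * \<psi> x \<partial>face_measure R i (-1))"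
    by (simp only:) (rule LIMSEQ_unique)
  then show ?thesis
    by (subst Bochner_Integration.integral_add) (auto intro: L2_integrable_mult L L\<psi>)
qed

lemma integral_AE_zero: "AE x in M. f x = 0 \<Longrightarrow> (\<integral>x. f x * g x \<partial>M) = (0::real)"
  by (rule integral_eq_zero_AE) (auto elim!: eventually_mono)

lemma H1_trace_zero_H10:
  fixes h :: "real^'n::finite \<Rightarrow> real"
  assumes h: "H1_trace R h g \<tau>" and R: "R > 0"
    and z: "\<And>i \<sigma>. \<sigma> \<in> {-1, 1} \<Longrightarrow> AE x in face_measure R i \<sigma>. \<tau> x = 0"
  shows "H10 R h g"
  unfolding H10_def
proof (intro conjI allI impI)
  show "H1_approx R h g" by (rule H1_trace_approx[OF h])
  fix \<psi> :: "real^'n \<Rightarrow> real" and d\<psi> i assume \<psi>: "C1_grad \<psi> d\<psi>"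
  show "(\<integral>x. g i x * \<psi> x + h x * d\<psi> i x \<partial>QM R) = 0"
    by (simp add: H1_trace_green[OF h R \<psi>] integral_AE_zero z)
qed

section \<open>Symmetry of second derivatives and tangential traces\<close>

text \<open>The commutator of the weak second derivatives is a pure boundary term: after one
  integration by parts, a second one is free of boundary terms since \<open>h\<close> has zero
  trace, and it leaves \<open>h\<close> times the second derivatives of \<open>\<psi>\<close>, which
  are symmetric.\<close>

lemma second_derivs_pairing:
  assumes h: "H10 R h g" and g: "\<And>j. H1_trace R (g j) (\<lambda>i. G i j) (\<tau> j)" and R: "R > 0"
    and \<psi>: "C2_grad \<psi> d\<psi> dd\<psi>"
  shows "(\<integral>x. (G i j x - G j i x) * \<psi> x \<partial>QM R) =
    (\<integral>x. \<tau> j x * \<psi> x \<partial>face_measure R i 1) - (\<integral>x. \<tau> j x * \<psi> x \<partial>face_measure R i (-1))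
    - ((\<integral>x. \<tau> i x * \<psi> x \<partial>face_measure R j 1) - (\<integral>x. \<tau> i x * \<psi> x \<partial>face_measure R j (-1)))"
proof -
  have C: "C1_grad \<psi> d\<psi>" "\<And>i. C1_grad (d\<psi> i) (dd\<psi> i)" using \<psi> by (auto simp: C2_grad_def)
  have Lh: "h \<in> L2 (QM R)" "\<And>i. g i \<in> L2 (QM R)" using H1_approx_L2[OF H10_approx[OF h]] by auto
  have LG: "\<And>i j. G i j \<in> L2 (QM R)" using H1_approx_L2[OF H1_trace_approx[OF g]] by auto
  have L\<psi>: "\<psi> \<in> L2 (QM R)" "\<And>i. d\<psi> i \<in> L2 (QM R)" "\<And>i j. dd\<psi> i j \<in> L2 (QM R)"
    by (intro L2_continuous_cube C1_grad_continuous[OF C(1)] C1_grad_continuous[OF C(2)] C1_grad_continuous'[OF C(2)])+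
  have a: "(\<integral>x. G i j x * \<psi> x \<partial>QM R) + (\<integral>x. g j x * d\<psi> i x \<partial>QM R) =
    (\<integral>x. \<tau> j x * \<psi> x \<partial>face_measure R i 1) - (\<integral>x. \<tau> j x * \<psi> x \<partial>face_measure R i (-1))" for i j
    using H1_trace_green[OF g R C(1), of i j] Lh LG L\<psi>
    by (simp add: L2_integrable_mult)
  have b: "(\<integral>x. g j x * d\<psi> i x \<partial>QM R) = - (\<integral>x. h x * dd\<psi> i j x \<partial>QM R)" for i j
  proof -
    have "(\<integral>x. g j x * d\<psi> i x + h x * dd\<psi> i j x \<partial>QM R) = 0"
      using h C(2) unfolding H10_def by blast
    then show ?thesis using Lh L\<psi> by (simp add: L2_integrable_mult)
  qed
  have "(\<integral>x. h x * dd\<psi> i j x \<partial>QM R) = (\<integral>x. h x * dd\<psi> j i x \<partial>QM R)"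
    using C2_grad_sym[OF \<psi>] by metis
  then have s: "(\<integral>x. g j x * d\<psi> i x \<partial>QM R) = (\<integral>x. g i x * d\<psi> j x \<partial>QM R)"
    by (simp add: b)
  have "(\<integral>x. (G i j x - G j i x) * \<psi> x \<partial>QM R) = (\<integral>x. G i j x * \<psi> x \<partial>QM R) - (\<integral>x. G j i x * \<psi> x \<partial>QM R)"
    using LG L\<psi> by (simp add: left_diff_distrib L2_integrable_mult)
  then show ?thesis using a[of i j] a[of j i] s by linarith
qed

lemma L2_loc_integrable:
  fixes f :: "real^'n \<Rightarrow> real"
  assumes "f \<in> L2 (QM R)" shows "loc_integrable (cube R) f"
  unfolding loc_integrable_def
proof (intro allI impI)
  fix K :: "(real^'n) set" assume K: "compact K \<and> K \<subseteq> cube R"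
  have "integrable (QM R) (\<lambda>x. f x * 1)"
    by (rule L2_integrable_mult[OF assms]) (rule L2_continuous_cube, simp)
  then have "integrable (QM R) f" by simp
  then have "set_integrable lebesgue (cube R) f"
    unfolding set_integrable_def by (subst (asm) integrable_restrict_space) auto
  then show "f absolutely_integrable_on K"
    by (rule set_integrable_subset) (use K in \<open>auto intro: lmeasurable_compact fmeasurableD\<close>)
qed

lemma face_notin_cube: "\<bar>x $ i\<bar> = R \<Longrightarrow> x \<notin> cube R"
  by (auto simp: mem_cube)

lemma face_integral_zero:
  fixes f g :: "real^'n::finite \<Rightarrow> real"
  assumes "\<And>x. x \<notin> cube R \<Longrightarrow> f x = 0" "R > 0" "\<sigma> \<in> {-1, 1}"
  shows "(\<integral>x. g x * f x \<partial>face_measure R i \<sigma>) = 0"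
proof (rule integral_eq_zero_AE)
  show "AE x in face_measure R i \<sigma>. g x * f x = 0"
    using AE_face_coord[OF assms(3,2)]
  proof eventually_elim
    case (elim x)
    then have "\<bar>x $ i\<bar> = R" using assms(2,3) by auto
    then have "f x = 0" by (intro assms(1) face_notin_cube)
    then show ?case by simp
  qed
qed

text \<open>Test functions supported inside the cube remove the boundary terms of the
  commutator.\<close>

lemma second_derivs_sym:
  assumes h: "H10 R h g" and g: "\<And>j. H1_trace R (g j) (\<lambda>i. G i j) (\<tau> j)" and R: "R > 0"
  shows "AE x in QM R. G i j x = G j i x"
proof -
  have LG: "\<And>i j. G i j \<in> L2 (QM R)" using H1_approx_L2[OF H1_trace_approx[OF g]] by auto
  have "AE x in QM R. G i j x - G j i x = 0"
  proof (rule fundamental_lemma[OF R])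
    show "loc_integrable (cube R) (\<lambda>x. G i j x - G j i x)"
      by (intro L2_loc_integrable L2_diff LG)
    fix f :: "real^'a \<Rightarrow> real" assume f: "smooth f" "compact (support f)" "support f \<subseteq> cube R"
    have f0: "f x = 0" if "x \<notin> cube R" for x
      using that f(3) closure_subset[of "{x. f x \<noteq> 0}"] by (auto simp: support_def)
    show "(\<integral>x. (G i j x - G j i x) * f x \<partial>QM R) = 0"
      by (simp add: second_derivs_pairing[OF h g R C2_grad_smooth[OF f(1)]] face_integral_zero[OF f0 R])
  qed
  then show ?thesis by simp
qed

text \<open>The tangential derivatives vanish on the boundary along with the function itself: test the
  symmetry of the second derivatives against \<open>x\<^sub>i \<partial>\<^sub>j h\<close>.\<close>

lemma tangential_trace_zero:
  assumes h: "H10 R h g" and g: "\<And>j. H1_trace R (g j) (\<lambda>i. G i j) (\<tau> j)" and R: "R > 0"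
    and z: "\<And>i \<sigma>. \<sigma> \<in> {-1, 1} \<Longrightarrow> AE x in face_measure R i \<sigma>. \<tau> i x = 0"
    and \<sigma>: "\<sigma> \<in> {-1, 1}"
  shows "AE x in face_measure R i \<sigma>. \<tau> j x = 0"
proof -
  obtain p dp ddp where p: "\<And>k. C2_grad (p k) (dp k) (ddp k)" and C: "\<And>k. C1_grad (p k) (dp k)"
    and hp: "tendsto_L2 (QM R) p (g j)" and "\<And>i. tendsto_L2 (QM R) (\<lambda>k. dp k i) (G i j)"
    and \<tau>p: "\<And>i \<sigma>. \<sigma> \<in> {-1, 1} \<Longrightarrow> tendsto_L2 (face_measure R i \<sigma>) p (\<tau> j)"
    by (rule H1_traceE[OF g[of j]]) blast
  have cp: "continuous_on UNIV (p k)" for k by (rule C1_grad_continuous[OF C])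
  let ?F = "\<lambda>i \<sigma>. face_measure R i \<sigma>"
  have L\<tau>: "\<tau> m \<in> L2 (?F i \<sigma>)" if "\<sigma> \<in> {-1, 1}" for m i \<sigma>
    by (rule H1_trace_L2_face[OF g R that])
  have cx: "continuous_on UNIV (\<lambda>x::real^'a. x $ i)" for i by (intro continuous_intros)
  have Lx: "(\<lambda>x. x $ i * \<tau> m x) \<in> L2 (?F j \<sigma>)" if s: "\<sigma> \<in> {-1, 1}" for m i j \<sigma>
  proof -
    obtain C where "AE x in ?F j \<sigma>. \<bar>x $ i\<bar> \<le> C"
      using continuous_AE_bounded_face[OF cx s R] by blast
    then show ?thesis by (rule L2_bounded_mult[OF L\<tau>[OF s] continuous_measurable_face[OF cx]])
  qed
  \<comment> \<open>The commutator is already known to vanish, so its boundary terms cancel for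
    every C2 test function, including those that do not vanish on the boundary. The approximants
    \<open>p k\<close> stand in for \<open>g j\<close>.\<close>
  have eq: "(\<integral>x. p k x * (x $ i * \<tau> j x) \<partial>?F i 1) - (\<integral>x. p k x * (x $ i * \<tau> j x) \<partial>?F i (-1))
    - ((\<integral>x. p k x * (x $ i * \<tau> i x) \<partial>?F j 1) - (\<integral>x. p k x * (x $ i * \<tau> i x) \<partial>?F j (-1))) = 0" for k
  proof -
    obtain dd where dd: "C2_grad (\<lambda>x. x $ i * p k x) (\<lambda>l x. (if l = i then 1 else 0) * p k x + x $ i * dp k l x) dd"
      using C2_grad_mult[OF C2_grad_coord p] by blast
    have "AE x in QM R. G i j x - G j i x = 0"
      using second_derivs_sym[OF h g R, of i j] by simp
    then have "(\<integral>x. (G i j x - G j i x) * (x $ i * p k x) \<partial>QM R) = 0"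
      by (rule integral_AE_zero)
    then show ?thesis
      unfolding second_derivs_pairing[OF h g R dd] by (simp add: mult_ac)
  qed
  have lim: "(\<lambda>k. (\<integral>x. p k x * (x $ i * \<tau> j x) \<partial>?F i 1) - (\<integral>x. p k x * (x $ i * \<tau> j x) \<partial>?F i (-1))
    - ((\<integral>x. p k x * (x $ i * \<tau> i x) \<partial>?F j 1) - (\<integral>x. p k x * (x $ i * \<tau> i x) \<partial>?F j (-1)))) \<longlonglongrightarrow>
    (\<integral>x. \<tau> j x * (x $ i * \<tau> j x) \<partial>?F i 1) - (\<integral>x. \<tau> j x * (x $ i * \<tau> j x) \<partial>?F i (-1))
    - ((\<integral>x. \<tau> j x * (x $ i * \<tau> i x) \<partial>?F j 1) - (\<integral>x. \<tau> j x * (x $ i * \<tau> i x) \<partial>?F j (-1)))"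
    by (intro tendsto_diff tendsto_L2_integral \<tau>p L\<tau> Lx) auto
  \<comment> \<open>On the faces orthogonal to axis \<open>j\<close>, the trace
    \<open>\<tau> j\<close> is the normal component and vanishes by \<open>z\<close>.\<close>
  have j0: "(\<integral>x. \<tau> j x * (x $ i * \<tau> i x) \<partial>?F j 1) = 0" "(\<integral>x. \<tau> j x * (x $ i * \<tau> i x) \<partial>?F j (-1)) = 0"
    by (intro integral_AE_zero z; simp)+
  \<comment> \<open>The factor x_i is R on one face and -R on the opposite one; it turns the
    difference of the two face integrals into a sum of squares.\<close>
  have i0: "(\<integral>x. \<tau> j x * (x $ i * \<tau> j x) \<partial>?F i \<sigma>) = \<sigma> * R * (\<integral>x. (\<tau> j x)\<^sup>2 \<partial>?F i \<sigma>)" if \<sigma>: "\<sigma> \<in> {-1, 1}" for \<sigma>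
  proof -
    have "(\<integral>x. \<tau> j x * (x $ i * \<tau> j x) \<partial>?F i \<sigma>) = (\<integral>x. \<sigma> * R * (\<tau> j x)\<^sup>2 \<partial>?F i \<sigma>)"
    proof (rule integral_cong_AE)
      show "(\<lambda>x. \<tau> j x * (x $ i * \<tau> j x)) \<in> borel_measurable (?F i \<sigma>)"
        using L2D(1)[OF L\<tau>[OF \<sigma>]] continuous_measurable_face[OF cx] by (intro borel_measurable_times)
      show "(\<lambda>x. \<sigma> * R * (\<tau> j x)\<^sup>2) \<in> borel_measurable (?F i \<sigma>)"
        using L2D(1)[OF L\<tau>[OF \<sigma>]] by measurable
      show "AE x in ?F i \<sigma>. \<tau> j x * (x $ i * \<tau> j x) = \<sigma> * R * (\<tau> j x)\<^sup>2"
        using AE_face_coord[OF \<sigma> R] by eventually_elim (simp add: power2_eq_square)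
    qed
    then show ?thesis by simp
  qed
  let ?I1 = "\<integral>x. (\<tau> j x)\<^sup>2 \<partial>?F i 1" and ?I2 = "\<integral>x. (\<tau> j x)\<^sup>2 \<partial>?F i (-1)"
  have "?I1 + ?I2 = 0"
  proof -
    have "1 * R * ?I1 - (-1) * R * ?I2 = 0"
      using lim unfolding eq j0 by (simp add: LIMSEQ_const_iff i0)
    then have "R * (?I1 + ?I2) = 0"
      by (simp add: algebra_simps)
    then show ?thesis using R by simp
  qed
  moreover have "?I1 \<ge> 0" "?I2 \<ge> 0" by simp_all
  ultimately have "?I1 = 0 \<and> ?I2 = 0" by linarith
  then have "(\<integral>x. (\<tau> j x)\<^sup>2 \<partial>?F i \<sigma>) = 0" using \<sigma> by auto
  then have "AE x in ?F i \<sigma>. (\<tau> j x)\<^sup>2 = 0"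
    using L2D(2)[OF L\<tau>[OF \<sigma>]] by (subst (asm) integral_nonneg_eq_0_iff_AE) auto
  then show ?thesis by simp
qed

text \<open>\<open>G i j\<close> is the \<open>i\<close>-th derivative of \<open>g j\<close>. Each
  first derivative has zero trace itself, so second derivatives also integrate by parts without
  boundary terms. Symmetry holds only almost everywhere and is recorded separately.\<close>

definition H20 :: "real \<Rightarrow> (real^'n::finite \<Rightarrow> real) \<Rightarrow> ('n \<Rightarrow> real^'n \<Rightarrow> real) \<Rightarrow> ('n \<Rightarrow> 'n \<Rightarrow> real^'n \<Rightarrow> real) \<Rightarrow> bool"
  where "H20 R h g G \<longleftrightarrow> H10 R h g \<and> (\<forall>j. H10 R (g j) (\<lambda>i. G i j)) \<and>
    (AE x in QM R. \<forall>i j. G i j x = G j i x)"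

text \<open>The normal components have zero trace by \<open>z\<close> and the tangential ones by
  \<open>tangential_trace_zero\<close>, so the whole gradient has zero trace.\<close>

lemma zero_Cauchy_data_H20:
  assumes h: "H1_trace R h g (\<lambda>_. 0)" and g: "\<And>j. H1_trace R (g j) (\<lambda>i. G i j) (\<tau> j)" and R: "R > 0"
    and z: "\<And>i \<sigma>. \<sigma> \<in> {-1, 1} \<Longrightarrow> AE x in face_measure R i \<sigma>. \<tau> i x = 0"
  shows "H20 R h g G"
proof -
  have h0: "H10 R h g" by (rule H1_trace_zero_H10[OF h R]) auto
  have "H10 R (g j) (\<lambda>i. G i j)" for j
    by (rule H1_trace_zero_H10[OF g R tangential_trace_zero[OF h0 g R z]])
  moreover have "AE x in QM R. \<forall>i j. G i j x = G j i x"
    by (subst AE_all_countable, intro allI, subst AE_all_countable, intro allI)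
      (rule second_derivs_sym[OF h0 g R])
  ultimately show ?thesis using h0 by (simp add: H20_def)
qed

lemma H20_mult:
  assumes a: "C2_grad a da dda" and h: "H20 R h g G"
  shows "H20 R (\<lambda>x. a x * h x) (\<lambda>i x. da i x * h x + a x * g i x)
    (\<lambda>i j x. dda j i x * h x + da j x * g i x + (da i x * g j x + a x * G i j x))"
proof -
  have C: "C1_grad a da" "\<And>i. C1_grad (da i) (dda i)" using a by (auto simp: C2_grad_def)
  have H: "H10 R h g" "\<And>j. H10 R (g j) (\<lambda>i. G i j)" "AE x in QM R. \<forall>i j. G i j x = G j i x"
    using h by (auto simp: H20_def)
  have "H10 R (\<lambda>x. da j x * h x + a x * g j x)
    (\<lambda>i x. (dda j i x * h x + da j x * g i x) + (da i x * g j x + a x * G i j x))" for j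
    by (rule H10_add[OF H10_mult[OF C(2) H(1)] H10_mult[OF C(1) H(2)]])
  moreover have "AE x in QM R. \<forall>i j. dda j i x * h x + da j x * g i x + (da i x * g j x + a x * G i j x)
     = dda i j x * h x + da i x * g j x + (da j x * g i x + a x * G j i x)"
    using H(3)
  proof eventually_elim
    case (elim x)
    show ?case
    proof (intro allI)
      fix i j
      show "dda j i x * h x + da j x * g i x + (da i x * g j x + a x * G i j x)
        = dda i j x * h x + da i x * g j x + (da j x * g i x + a x * G j i x)"
        using elim[rule_format, of i j] C2_grad_sym[OF a, of i j x] by simp
    qed
  qed
  ultimately show ?thesis using H10_mult[OF C(1) H(1)] by (simp add: H20_def)
qed

section \<open>A Carleman estimate\<close>

lemma H20_L2:
  assumes "H20 R w w1 w2"
  shows "w \<in> L2 (QM R)" "w1 i \<in> L2 (QM R)" "w2 i j \<in> L2 (QM R)"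
  using assms H1_approx_L2[OF H10_approx] unfolding H20_def by blast+

definition sqgrad :: "('n::finite \<Rightarrow> real^'n \<Rightarrow> real) \<Rightarrow> real^'n \<Rightarrow> real"
  where "sqgrad w1 x = (\<Sum>j\<in>UNIV. (w1 j x)\<^sup>2)"

lemma sqgrad_nonneg: "sqgrad w1 x \<ge> 0"
  by (simp add: sqgrad_def sum_nonneg)

lemma le_sqgrad: "(w1 j x)\<^sup>2 \<le> sqgrad w1 x"
  unfolding sqgrad_def by (rule member_le_sum) auto

lemma mult_le_sqgrad: "\<bar>w1 i x * w1 j x\<bar> \<le> sqgrad w1 x"
proof -
  have "2 * \<bar>w1 i x * w1 j x\<bar> \<le> (w1 i x)\<^sup>2 + (w1 j x)\<^sup>2"
    using sum_squares_bound[of "\<bar>w1 i x\<bar>" "\<bar>w1 j x\<bar>"] by (simp add: abs_mult)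
  then show ?thesis using le_sqgrad[of w1 i x] le_sqgrad[of w1 j x] by linarith
qed

lemma integrable_sqgrad:
  assumes "\<And>j. w1 j \<in> L2 (QM R)" shows "integrable (QM R) (sqgrad w1)"
  unfolding sqgrad_def by (intro Bochner_Integration.integrable_sum L2D(2) assms)

lemma integral_mono_cube:
  fixes f g :: "real^'n \<Rightarrow> real"
  assumes "integrable (QM R) f" "integrable (QM R) g" "\<And>x. x \<in> cube R \<Longrightarrow> f x \<le> g x"
  shows "(\<integral>x. f x \<partial>QM R) \<le> (\<integral>x. g x \<partial>QM R)"
  by (rule integral_mono[OF assms(1,2)]) (use assms(3) in simp)

text \<open>A common bound for finitely many coefficients; the index may be a tuple, or
  \<open>unit\<close> for a single function.\<close>

lemma bounded_family:
  fixes f :: "'i::finite \<Rightarrow> real^'n \<Rightarrow> real"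
  assumes "\<And>i. continuous_on UNIV (f i)"
  obtains B where "B \<ge> 0" "\<And>i (x :: real^'n). x \<in> cube R \<Longrightarrow> \<bar>f i x\<bar> \<le> B"
proof -
  have "\<exists>C\<ge>0. \<forall>x\<in>cube R. \<bar>f i x\<bar> \<le> C" for i
    using continuous_bounded_ccube[OF assms, of R i] cube_subset_ccube[of R] by (metis subsetD)
  then obtain C where C: "\<And>i. C i \<ge> 0" "\<And>i x. x \<in> cube R \<Longrightarrow> \<bar>f i x\<bar> \<le> C i" by metis
  show ?thesis
  proof (rule that[of "\<Sum>i\<in>UNIV. C i"])
    show "(\<Sum>i\<in>UNIV. C i) \<ge> 0" by (simp add: C sum_nonneg)
    fix i and x :: "real^'n" assume "x \<in> cube R"
    then have "\<bar>f i x\<bar> \<le> C i" by (rule C)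
    also have "\<dots> \<le> (\<Sum>i\<in>UNIV. C i)" by (rule member_le_sum) (auto simp: C)
    finally show "\<bar>f i x\<bar> \<le> (\<Sum>i\<in>UNIV. C i)" .
  qed
qed

lemma integral_quadratic_bound:
  fixes d :: "real^'n::finite \<Rightarrow> real"
  assumes d: "continuous_on UNIV d" and B: "\<And>x. x \<in> cube R \<Longrightarrow> \<bar>d x\<bar> \<le> B"
    and L: "\<And>j. w1 j \<in> L2 (QM R)"
  shows "\<bar>\<integral>x. d x * w1 i x * w1 j x \<partial>QM R\<bar> \<le> B * (\<integral>x. sqgrad w1 x \<partial>QM R)"
proof -
  have int: "integrable (QM R) (\<lambda>x. d x * w1 i x * w1 j x)"
    by (rule integrable_L2_mult3[OF d L L])
  have "\<bar>\<integral>x. d x * w1 i x * w1 j x \<partial>QM R\<bar> \<le> (\<integral>x. \<bar>d x * w1 i x * w1 j x\<bar> \<partial>QM R)"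
    by (rule integral_abs_bound)
  also have "\<dots> \<le> (\<integral>x. B * sqgrad w1 x \<partial>QM R)"
  proof (rule integral_mono_cube)
    show "integrable (QM R) (\<lambda>x. \<bar>d x * w1 i x * w1 j x\<bar>)" using int by simp
    show "integrable (QM R) (\<lambda>x. B * sqgrad w1 x)" using integrable_sqgrad[OF L] by simp
    fix x :: "real^'n" assume x: "x \<in> cube R"
    have "\<bar>d x\<bar> * \<bar>w1 i x * w1 j x\<bar> \<le> B * sqgrad w1 x"
      by (rule mult_mono[OF B[OF x] mult_le_sqgrad]) (use B[OF x] in auto)
    then show "\<bar>d x * w1 i x * w1 j x\<bar> \<le> B * sqgrad w1 x" by (simp add: abs_mult mult.assoc)
  qed
  finally show ?thesis by simp
qed

section \<open>The principal part and its integral inequalities\<close>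

locale elliptic_coeff =
  fixes R \<mu> :: real and a :: "'n::finite \<Rightarrow> 'n \<Rightarrow> real^'n \<Rightarrow> real" and da
  assumes R: "R > 0" and \<mu>: "\<mu> > 0" and a_C1: "\<And>i j. C1_grad (a i j) (da i j)"
    and a_sym: "\<And>i j x. a i j x = a j i x"
    and ell: "\<And>x \<xi>. \<mu> * (\<Sum>i\<in>UNIV. (\<xi> i)\<^sup>2) \<le> (\<Sum>i\<in>UNIV. \<Sum>j\<in>UNIV. a i j x * \<xi> i * \<xi> j)"
begin

text \<open>Nondivergence form: derivatives of \<open>a\<close> arising from the divergence form are
  counted among the lower-order terms.\<close>

definition Aop :: "('n \<Rightarrow> 'n \<Rightarrow> real^'n \<Rightarrow> real) \<Rightarrow> real^'n \<Rightarrow> real"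
  where "Aop w2 x = (\<Sum>i\<in>UNIV. \<Sum>j\<in>UNIV. a i j x * w2 i j x)"

text \<open>The conormal derivative for axis \<open>k\<close>, the first-order term produced by
  conjugation with a weight in x_k.\<close>

definition Qop :: "'n \<Rightarrow> ('n \<Rightarrow> real^'n \<Rightarrow> real) \<Rightarrow> real^'n \<Rightarrow> real"
  where "Qop k w1 x = (\<Sum>l\<in>UNIV. a k l x * w1 l x)"

lemma a_cont: "continuous_on UNIV (a i j)" "continuous_on UNIV (da i j l)"
  using C1_grad_continuous[OF a_C1] C1_grad_continuous'[OF a_C1] by auto

lemma Aop_L2: "(\<And>i j. w2 i j \<in> L2 (QM R)) \<Longrightarrow> Aop w2 \<in> L2 (QM R)"
  unfolding Aop_def by (intro L2_sum L2_continuous_mult a_cont)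

lemma Qop_L2: "(\<And>j. w1 j \<in> L2 (QM R)) \<Longrightarrow> Qop k w1 \<in> L2 (QM R)"
  unfolding Qop_def by (intro L2_sum L2_continuous_mult a_cont)

text \<open>Ellipticity at the unit vector of axis \<open>k\<close>. Since the weight varies in x_k
  alone, this entry governs its strength.\<close>

lemma a_diag_ge: "a k k x \<ge> \<mu>"
proof -
  have delta: "(\<Sum>j\<in>UNIV. f j * (if j = k then 1 else 0)) = f k" for f :: "'n \<Rightarrow> real"
  proof -
    have "(\<Sum>j\<in>UNIV - {k}. f j * (if j = k then 1 else 0)) = 0" by (rule sum.neutral) auto
    then show ?thesis by (subst sum.remove[of UNIV k]) auto
  qed
  have "(\<Sum>i\<in>UNIV. \<Sum>j\<in>UNIV. a i j x * (if i = k then 1 else 0) * (if j = k then 1 else 0)) = a k k x"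
    by (simp only: delta)
  moreover have "(\<Sum>i\<in>UNIV. (if i = k then 1 else 0 :: real)\<^sup>2) = 1"
    by (simp add: if_distrib[of "\<lambda>t. t\<^sup>2"] cong: if_cong)
  ultimately show ?thesis using ell[of "\<lambda>i. if i = k then 1 else 0" x] by simp
qed

text \<open>A Rellich-type identity. A first derivative times a second derivative looks worse than
  |grad w|^2, but integrating by parts twice shows the integrand to be a divergence up to terms in
  which the coefficients are differentiated. The zero traces of all first derivatives remove the
  boundary terms.\<close>

lemma Qop_Aop_bound:
  "\<exists>C\<ge>0. \<forall>w w1 w2. H20 R w w1 w2 \<longrightarrow> (\<integral>x. Qop k w1 x * Aop w2 x \<partial>QM R) \<le> C * (\<integral>x. sqgrad w1 x \<partial>QM R)"
proof -
  let ?c = "\<lambda>l i j x. a k l x * a i j x"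
  define dc where "dc l i j m x = da k l m x * a i j x + a k l x * da i j m x" for l i j m x
  have c: "C1_grad (?c l i j) (dc l i j)" for l i j
    unfolding dc_def by (rule C1_grad_mult[OF a_C1 a_C1])
  have cc: "continuous_on UNIV (?c l i j)" "continuous_on UNIV (dc l i j m)" for l i j m
    using C1_grad_continuous[OF c] C1_grad_continuous'[OF c] by auto
  obtain B where B: "B \<ge> 0" "\<And>z x. x \<in> cube R \<Longrightarrow> \<bar>(case z of (l, i, j, m) \<Rightarrow> dc l i j m) x\<bar> \<le> B"
    by (rule bounded_family[of "\<lambda>z. case z of (l, i, j, m) \<Rightarrow> dc l i j m" R]) (use cc in \<open>auto split: prod.splits\<close>)
  have B': "\<bar>dc l i j m x\<bar> \<le> B" if "x \<in> cube R" for l i j m x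
    using B(2)[OF that, of "(l, i, j, m)"] by simp
  define n where "n = real CARD('n)"
  have "(\<integral>x. Qop k w1 x * Aop w2 x \<partial>QM R) \<le> 2 * n ^ 3 * B * (\<integral>x. sqgrad w1 x \<partial>QM R)" if H: "H20 R w w1 w2" for w w1 w2
  proof -
    have H1: "H10 R (w1 j) (\<lambda>i. w2 i j)" for j using H by (simp add: H20_def)
    have sym: "AE x in QM R. w2 i j x = w2 j i x" for i j
      using H unfolding H20_def by (auto elim!: eventually_mono)
    note L = H20_L2[OF H]
    let ?I = "\<integral>x. sqgrad w1 x \<partial>QM R"
    define T where "T l i j = (\<integral>x. ?c l i j x * w2 i j x * w1 l x \<partial>QM R)" for l i j
    define S where "S l i j = (\<integral>x. ?c l i j x * w1 j x * w2 i l x \<partial>QM R)" for l i j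
    define D where "D l i j m p q = (\<integral>x. dc l i j m x * w1 p x * w1 q x \<partial>QM R)" for l i j m p q
    have D: "\<bar>D l i j m p q\<bar> \<le> B * ?I" for l i j m p q
      unfolding D_def by (rule integral_quadratic_bound[OF cc(2) B' L(2)])
    \<comment> \<open>Derivative \<open>i\<close> moves off \<open>w2 i j\<close> onto
      \<open>w1 l\<close>; D collects the derivative of the coefficient.\<close>
    have TS: "T l i j = - S l i j - D l i j i j l" for l i j
      unfolding T_def S_def D_def
      by (rule H10_parts_coeff[OF c H1 H10_approx[OF H1], where i=i])
    \<comment> \<open>With \<open>i\<close> and \<open>j\<close> exchanged, S adds up to the
      coefficient times d_l (d_i w d_j w), because \<open>a i j\<close> and the second derivatives
      are symmetric. One more integration by parts leaves only D.\<close>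
    have SS: "S l i j + S l j i = - D l i j l i j" for l i j
    proof -
      have 1: "(\<integral>x. ?c l i j x * w2 l i x * w1 j x \<partial>QM R) = S l i j"
        unfolding S_def
      proof (rule integral_cong_AE)
        show "AE x in QM R. ?c l i j x * w2 l i x * w1 j x = ?c l i j x * w1 j x * w2 i l x"
          using sym[of l i] by eventually_elim simp
      qed (intro borel_measurable_integrable integrable_L2_mult3 cc L)+
      have 2: "(\<integral>x. ?c l i j x * w1 i x * w2 l j x \<partial>QM R) = S l j i"
        unfolding S_def
      proof (rule integral_cong_AE)
        show "AE x in QM R. ?c l i j x * w1 i x * w2 l j x = ?c l j i x * w1 i x * w2 j l x"
          using sym[of l j] by eventually_elim (simp add: a_sym[of i j])
      qed (intro borel_measurable_integrable integrable_L2_mult3 cc L)+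
      show ?thesis
        using H10_parts_coeff[OF c[of l i j] H1[of i] H10_approx[OF H1[of j]], of l] unfolding 1 2 D_def by linarith
    qed
    have "(\<integral>x. Qop k w1 x * Aop w2 x \<partial>QM R) = (\<integral>x. (\<Sum>l\<in>UNIV. \<Sum>i\<in>UNIV. \<Sum>j\<in>UNIV. ?c l i j x * w2 i j x * w1 l x) \<partial>QM R)"
      unfolding Qop_def Aop_def sum_distrib_right unfolding sum_distrib_left by (simp add: mult_ac)
    also have "\<dots> = (\<Sum>l\<in>UNIV. \<Sum>i\<in>UNIV. \<Sum>j\<in>UNIV. T l i j)"
      unfolding T_def
      by (subst Bochner_Integration.integral_sum;
          (intro Bochner_Integration.integrable_sum integrable_L2_mult3 cc L)?; intro sum.cong refl)+
    also have "\<dots> = (\<Sum>l\<in>UNIV. \<Sum>i\<in>UNIV. \<Sum>j\<in>UNIV. D l i j l i j / 2 - D l i j i j l)"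
    proof (rule sum.cong[OF refl])
      fix l
      \<comment> \<open>Renaming the summation indices symmetrizes S, so twice its sum is minus the
        sum of D; hence the factor 1/2.\<close>
      have "(\<Sum>i\<in>UNIV. \<Sum>j\<in>UNIV. S l i j) + (\<Sum>i\<in>UNIV. \<Sum>j\<in>UNIV. S l i j)
        = (\<Sum>i\<in>UNIV. \<Sum>j\<in>UNIV. S l i j) + (\<Sum>i\<in>UNIV. \<Sum>j\<in>UNIV. S l j i)"
        by (subst (3) sum.swap) simp
      also have "\<dots> = (\<Sum>i\<in>UNIV. \<Sum>j\<in>UNIV. - D l i j l i j)"
        unfolding sum.distrib[symmetric] SS ..
      finally have "(\<Sum>i\<in>UNIV. \<Sum>j\<in>UNIV. S l i j) = (\<Sum>i\<in>UNIV. \<Sum>j\<in>UNIV. - D l i j l i j) / 2"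
        by linarith
      then show "(\<Sum>i\<in>UNIV. \<Sum>j\<in>UNIV. T l i j) = (\<Sum>i\<in>UNIV. \<Sum>j\<in>UNIV. D l i j l i j / 2 - D l i j i j l)"
        unfolding TS by (simp add: sum_subtractf sum_negf sum_divide_distrib)
    qed
    also have "\<dots> \<le> (\<Sum>l\<in>(UNIV::'n set). \<Sum>i\<in>(UNIV::'n set). \<Sum>j\<in>(UNIV::'n set). 2 * (B * ?I))"
    proof (intro sum_mono)
      fix l i j
      show "D l i j l i j / 2 - D l i j i j l \<le> 2 * (B * ?I)"
        using D[of l i j l i j] D[of l i j i j l] by linarith
    qed
    also have "\<dots> = 2 * n ^ 3 * B * ?I" by (simp add: n_def power3_eq_cube)
    finally show ?thesis .
  qed
  moreover have "2 * n ^ 3 * B \<ge> 0" using B(1) by (simp add: n_def)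
  ultimately show ?thesis by blast
qed

text \<open>Testing against \<open>w\<close>: one integration by parts gives the elliptic form, and
  half of it absorbs the cross term with the derivatives of \<open>a\<close>.\<close>

lemma Aop_self_bound:
  "\<exists>C\<ge>0. \<forall>w w1 w2. H20 R w w1 w2 \<longrightarrow>
    \<mu> / 2 * (\<integral>x. sqgrad w1 x \<partial>QM R) \<le> C * (\<integral>x. (w x)\<^sup>2 \<partial>QM R) - (\<integral>x. Aop w2 x * w x \<partial>QM R)"
proof -
  obtain B where B: "B \<ge> 0" "\<And>z x. x \<in> cube R \<Longrightarrow> \<bar>(case z of (i, j) \<Rightarrow> da i j i) x\<bar> \<le> B"
    by (rule bounded_family[of "\<lambda>z. case z of (i, j) \<Rightarrow> da i j i" R]) (use a_cont in \<open>auto split: prod.splits\<close>)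
  have B': "\<bar>da i j i x\<bar> \<le> B" if "x \<in> cube R" for i j x
    using B(2)[OF that, of "(i, j)"] by simp
  define n where "n = real CARD('n)"
  \<comment> \<open>From Young: b s |w| <= (\<mu>/2) s^2 + b^2/(2 \<mu>) w^2, where b = n n B adds
    up the n^2 coefficient bounds and s is the length of the gradient.\<close>
  define C where "C = (n * n * B)\<^sup>2 / (2 * \<mu>)"
  have n: "n \<ge> 0" by (simp add: n_def)
  have "\<mu> / 2 * (\<integral>x. sqgrad w1 x \<partial>QM R) \<le> C * (\<integral>x. (w x)\<^sup>2 \<partial>QM R) - (\<integral>x. Aop w2 x * w x \<partial>QM R)"
    if H: "H20 R w w1 w2" for w w1 w2
  proof -
    have H0: "H10 R w w1" and H1: "H10 R (w1 j) (\<lambda>i. w2 i j)" for j using H by (simp_all add: H20_def)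
    note L = H20_L2[OF H]
    have i1: "integrable (QM R) (\<lambda>x. a i j x * w1 j x * w1 i x)" for i j
      by (intro integrable_L2_mult3 a_cont L)
    have i2: "integrable (QM R) (\<lambda>x. da i j i x * w1 j x * w x)" for i j
      by (intro integrable_L2_mult3 a_cont L)
    have i3: "integrable (QM R) (\<lambda>x. a i j x * w2 i j x * w x)" for i j
      by (intro integrable_L2_mult3 a_cont L)
    have iw: "integrable (QM R) (\<lambda>x. (w x)\<^sup>2)" using L2D(2)[OF L(1)] .
    have "(\<integral>x. Aop w2 x * w x \<partial>QM R) = (\<integral>x. (\<Sum>i\<in>UNIV. \<Sum>j\<in>UNIV. a i j x * w2 i j x * w x) \<partial>QM R)"
      by (simp add: Aop_def sum_distrib_right)
    also have "\<dots> = (\<Sum>i\<in>UNIV. \<Sum>j\<in>UNIV. (\<integral>x. a i j x * w2 i j x * w x \<partial>QM R))"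
      using i3 by (simp add: Bochner_Integration.integral_sum)
    also have "\<dots> = (\<Sum>i\<in>UNIV. \<Sum>j\<in>UNIV. - (\<integral>x. a i j x * w1 j x * w1 i x \<partial>QM R) - (\<integral>x. da i j i x * w1 j x * w x \<partial>QM R))"
      by (intro sum.cong refl H10_parts_coeff[OF a_C1 H1 H10_approx[OF H0]])
    also have "\<dots> = - (\<integral>x. (\<Sum>i\<in>UNIV. \<Sum>j\<in>UNIV. a i j x * w1 j x * w1 i x + da i j i x * w1 j x * w x) \<partial>QM R)"
      using i1 i2 by (simp add: Bochner_Integration.integral_sum sum_negf[symmetric])
    also have "\<dots> \<le> - (\<integral>x. \<mu> / 2 * sqgrad w1 x - C * (w x)\<^sup>2 \<partial>QM R)"
    proof (intro le_imp_neg_le integral_mono_cube)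
      show "integrable (QM R) (\<lambda>x. \<mu> / 2 * sqgrad w1 x - C * (w x)\<^sup>2)"
        using integrable_sqgrad[OF L(2)] iw by auto
      show "integrable (QM R) (\<lambda>x. \<Sum>i\<in>UNIV. \<Sum>j\<in>UNIV. a i j x * w1 j x * w1 i x + da i j i x * w1 j x * w x)"
        using i1 i2 by auto
      fix x :: "real^'n" assume x: "x \<in> cube R"
      let ?s = "sqrt (sqgrad w1 x)"
      have s: "?s\<^sup>2 = sqgrad w1 x" "?s \<ge> 0" using sqgrad_nonneg[of w1 x] by auto
      have "(\<Sum>i\<in>UNIV. \<Sum>j\<in>UNIV. a i j x * w1 j x * w1 i x) \<ge> \<mu> * sqgrad w1 x"
        using ell[of "\<lambda>i. w1 i x" x] by (simp add: sqgrad_def mult_ac)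
      moreover have "(\<Sum>i\<in>UNIV. \<Sum>j\<in>UNIV. da i j i x * w1 j x * w x) \<ge> (\<Sum>i\<in>(UNIV::'n set). \<Sum>j\<in>(UNIV::'n set). - (B * ?s * \<bar>w x\<bar>))"
      proof (intro sum_mono)
        fix i j
        have "\<bar>w1 j x\<bar> \<le> ?s" using le_sqgrad[of w1 j x] by (simp add: real_le_rsqrt)
        then have "\<bar>da i j i x\<bar> * \<bar>w1 j x\<bar> * \<bar>w x\<bar> \<le> B * ?s * \<bar>w x\<bar>"
          using B'[OF x] B(1) s(2) by (intro mult_mono mult_nonneg_nonneg) auto
        then show "- (B * ?s * \<bar>w x\<bar>) \<le> da i j i x * w1 j x * w x"
          by (simp add: abs_mult[symmetric] abs_le_iff)
      qed
      moreover have "(\<Sum>i\<in>(UNIV::'n set). \<Sum>j\<in>(UNIV::'n set). - (B * ?s * \<bar>w x\<bar>)) = - (n * n * B * (?s * \<bar>w x\<bar>))"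
        by (simp add: n_def)
      moreover have "n * n * B * (?s * \<bar>w x\<bar>) \<le> \<mu> / 2 * sqgrad w1 x + C * (w x)\<^sup>2"
      proof -
        let ?b = "n * n * B"
        have "0 \<le> (\<mu> * ?s - ?b * \<bar>w x\<bar>)\<^sup>2" by simp
        then have "2 * \<mu> * (?b * (?s * \<bar>w x\<bar>)) \<le> \<mu>\<^sup>2 * sqgrad w1 x + ?b\<^sup>2 * (w x)\<^sup>2"
          by (simp add: power2_diff power_mult_distrib s(1) mult_ac)
        then have "2 * \<mu> * (?b * (?s * \<bar>w x\<bar>)) / (2 * \<mu>) \<le> (\<mu>\<^sup>2 * sqgrad w1 x + ?b\<^sup>2 * (w x)\<^sup>2) / (2 * \<mu>)"
          using \<mu> by (intro divide_right_mono) auto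
        then show ?thesis using \<mu> by (simp add: C_def add_divide_distrib power2_eq_square)
      qed
      ultimately show "\<mu> / 2 * sqgrad w1 x - C * (w x)\<^sup>2 \<le> (\<Sum>i\<in>UNIV. \<Sum>j\<in>UNIV. a i j x * w1 j x * w1 i x + da i j i x * w1 j x * w x)"
        unfolding sum.distrib by linarith
    qed
    also have "\<dots> = - (\<mu> / 2 * (\<integral>x. sqgrad w1 x \<partial>QM R) - C * (\<integral>x. (w x)\<^sup>2 \<partial>QM R))"
      using integrable_sqgrad[OF L(2)] iw by simp
    finally show ?thesis by linarith
  qed
  moreover have "C \<ge> 0" using \<mu> by (simp add: C_def)
  ultimately show ?thesis by blast
qed

section \<open>The weight and the conjugated estimate\<close>

text \<open>The function r of the estimate, with \<open>\<kappa>\<close> standing for \<lambda>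
  \<beta>. Its derivative in x_k is \<beta> r, the source of the gain in
  \<open>\<beta>\<close>.\<close>

definition rate :: "'n \<Rightarrow> real \<Rightarrow> real \<Rightarrow> real^'n \<Rightarrow> real"
  where "rate k \<beta> \<kappa> x = \<kappa> * exp (\<beta> * x $ k)"

lemma rate_C1: "C1_grad (rate k \<beta> \<kappa>) (\<lambda>i x. if i = k then \<beta> * rate k \<beta> \<kappa> x else 0)"
  unfolding rate_def
  by (rule C1_grad_compose_coord[of "\<lambda>t. \<kappa> * exp (\<beta> * t)" "\<lambda>t. \<beta> * (\<kappa> * exp (\<beta> * t))"])
    (auto intro!: derivative_eq_intros continuous_intros)

lemma rate_cont: "continuous_on UNIV (rate k \<beta> \<kappa>)"
  by (rule C1_grad_continuous[OF rate_C1])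

text \<open>Since 2 w d_j w is the derivative of w^2, one integration by parts suffices: the
  derivative of r^2 gives the good term with \<open>\<beta>\<close>, and the derivatives of
  \<open>a\<close> give r^2 w^2 times a function free of \<open>\<beta>\<close> and
  \<open>\<kappa>\<close>. The bound \<open>B\<close> precedes these two in the quantifiers because
  \<open>\<beta>\<close> is chosen from it.\<close>

lemma Qop_weight:
  "\<exists>B\<ge>0. \<forall>\<beta> \<kappa> w w1 w2. H20 R w w1 w2 \<longrightarrow>
    4 * (\<integral>x. (rate k \<beta> \<kappa> x)\<^sup>2 * a k k x * w x * Qop k w1 x \<partial>QM R) \<le>
    (\<integral>x. (B - 4 * \<beta> * (a k k x)\<^sup>2) * (rate k \<beta> \<kappa> x)\<^sup>2 * (w x)\<^sup>2 \<partial>QM R)"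
proof -
  define q where "q x = (\<Sum>j\<in>UNIV. da k k j x * a k j x + a k k x * da k j j x)" for x
  have qc: "continuous_on UNIV q" unfolding q_def by (intro continuous_intros a_cont)
  obtain B where B: "B \<ge> 0" "\<And>z::unit. \<And>x. x \<in> cube R \<Longrightarrow> \<bar>q x\<bar> \<le> B"
    by (rule bounded_family[of "\<lambda>_. q" R]) (use qc in auto)
  have "4 * (\<integral>x. (rate k \<beta> \<kappa> x)\<^sup>2 * a k k x * w x * Qop k w1 x \<partial>QM R) \<le>
    (\<integral>x. (2 * B - 4 * \<beta> * (a k k x)\<^sup>2) * (rate k \<beta> \<kappa> x)\<^sup>2 * (w x)\<^sup>2 \<partial>QM R)" if H: "H20 R w w1 w2" for \<beta> \<kappa> w w1 w2
  proof -
    have H0: "H10 R w w1" using H by (simp_all add: H20_def)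
    note L = H20_L2[OF H]
    let ?r = "rate k \<beta> \<kappa>"
    define e where "e j x = ?r x * ?r x * (a k k x * a k j x)" for j x
    define de where "de j i x = ((if i = k then \<beta> * ?r x else 0) * ?r x + ?r x * (if i = k then \<beta> * ?r x else 0)) * (a k k x * a k j x)
      + ?r x * ?r x * (da k k i x * a k j x + a k k x * da k j i x)" for j i x
    have e: "C1_grad (e j) (de j)" for j
      unfolding e_def de_def by (intro C1_grad_mult rate_C1 a_C1)
    have ec: "continuous_on UNIV (e j)" "continuous_on UNIV (de j i)" for i j
      using C1_grad_continuous[OF e] C1_grad_continuous'[OF e] by auto
    have p: "2 * (\<integral>x. e j x * w1 j x * w x \<partial>QM R) = - (\<integral>x. de j j x * w x * w x \<partial>QM R)" for j
    proof -
      have "(\<integral>x. e j x * w1 j x * w x \<partial>QM R) = (\<integral>x. e j x * w x * w1 j x \<partial>QM R)"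
        by (simp add: mult_ac)
      then show ?thesis using H10_parts_coeff[OF e H0 H10_approx[OF H0], of j j] by linarith
    qed
    have "4 * (\<integral>x. (?r x)\<^sup>2 * a k k x * w x * Qop k w1 x \<partial>QM R) = 4 * (\<integral>x. (\<Sum>j\<in>UNIV. e j x * w1 j x * w x) \<partial>QM R)"
      by (simp add: Qop_def e_def sum_distrib_left power2_eq_square mult_ac)
    also have "\<dots> = (\<Sum>j\<in>UNIV. 2 * (2 * (\<integral>x. e j x * w1 j x * w x \<partial>QM R)))"
      by (subst Bochner_Integration.integral_sum) (auto intro!: integrable_L2_mult3 ec L simp: sum_distrib_left)
    also have "\<dots> = - 2 * (\<integral>x. (\<Sum>j\<in>UNIV. de j j x * w x * w x) \<partial>QM R)"
      unfolding p
      by (subst Bochner_Integration.integral_sum) (auto intro!: integrable_L2_mult3 ec L simp: sum_distrib_left)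
    \<comment> \<open>Only j = k sees the derivative of r^2, so the gain carries the square of
      \<open>a k k\<close>; \<open>q\<close> is what remains.\<close>
    also have "(\<lambda>x. \<Sum>j\<in>UNIV. de j j x * w x * w x) = (\<lambda>x. (2 * \<beta> * (a k k x)\<^sup>2 + q x) * (?r x)\<^sup>2 * (w x)\<^sup>2)"
    proof
      fix x
      have "(\<Sum>j\<in>UNIV. de j j x) = (\<Sum>j\<in>UNIV. (if j = k then 2 * \<beta> * (?r x)\<^sup>2 * (a k k x)\<^sup>2 else 0)
         + (?r x)\<^sup>2 * (da k k j x * a k j x + a k k x * da k j j x))"
        by (rule sum.cong) (auto simp: de_def power2_eq_square algebra_simps)
      also have "\<dots> = (\<Sum>j\<in>UNIV. if j = k then 2 * \<beta> * (?r x)\<^sup>2 * (a k k x)\<^sup>2 else 0) + (?r x)\<^sup>2 * q x"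
        unfolding q_def sum_distrib_left by (rule sum.distrib)
      also have "\<dots> = (2 * \<beta> * (a k k x)\<^sup>2 + q x) * (?r x)\<^sup>2"
        by (simp add: algebra_simps)
      finally show "(\<Sum>j\<in>UNIV. de j j x * w x * w x) = (2 * \<beta> * (a k k x)\<^sup>2 + q x) * (?r x)\<^sup>2 * (w x)\<^sup>2"
        by (simp add: sum_distrib_right[symmetric] power2_eq_square mult.assoc)
    qed
    also have "- 2 * (\<integral>x. (2 * \<beta> * (a k k x)\<^sup>2 + q x) * (?r x)\<^sup>2 * (w x)\<^sup>2 \<partial>QM R)
      = (\<integral>x. (- 2 * q x - 4 * \<beta> * (a k k x)\<^sup>2) * (?r x)\<^sup>2 * (w x)\<^sup>2 \<partial>QM R)"
      unfolding integral_mult_right_zero[symmetric] by (rule Bochner_Integration.integral_cong) (auto simp: algebra_simps)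
    also have "\<dots> \<le> (\<integral>x. (2 * B - 4 * \<beta> * (a k k x)\<^sup>2) * (?r x)\<^sup>2 * (w x)\<^sup>2 \<partial>QM R)"
    proof (rule integral_mono_cube)
      have i: "integrable (QM R) (\<lambda>x. c x * (?r x)\<^sup>2 * (w x)\<^sup>2)" if "continuous_on UNIV c" for c
        using integrable_L2_mult3[of "\<lambda>x. c x * (?r x)\<^sup>2" w R w] L that rate_cont
        by (simp add: power2_eq_square[of "w _"] mult.assoc continuous_intros)
      show "integrable (QM R) (\<lambda>x. (- 2 * q x - 4 * \<beta> * (a k k x)\<^sup>2) * (?r x)\<^sup>2 * (w x)\<^sup>2)"
        "integrable (QM R) (\<lambda>x. (2 * B - 4 * \<beta> * (a k k x)\<^sup>2) * (?r x)\<^sup>2 * (w x)\<^sup>2)"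
        by (intro i continuous_intros qc a_cont)+
      fix x :: "real^'n" assume "x \<in> cube R"
      then have "- 2 * q x - 4 * \<beta> * (a k k x)\<^sup>2 \<le> 2 * B - 4 * \<beta> * (a k k x)\<^sup>2" using B(2)[of x] by auto
      then show "(- 2 * q x - 4 * \<beta> * (a k k x)\<^sup>2) * (?r x)\<^sup>2 * (w x)\<^sup>2 \<le> (2 * B - 4 * \<beta> * (a k k x)\<^sup>2) * (?r x)\<^sup>2 * (w x)\<^sup>2"
        by (intro mult_right_mono) auto
    qed
    finally show ?thesis .
  qed
  moreover have "2 * B \<ge> 0" using B by simp
  ultimately show ?thesis by blast
qed

text \<open>The bound r >= 1 lets r^2 dominate lower powers, and r >= \<beta> absorbs \<beta>^2 r
  into \<beta> r^2. The factor 2 in front of the squared operator comes from splitting off the term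
  \<beta> r p w.\<close>

lemma carleman_conjugated:
  "\<exists>\<beta>>0. \<forall>\<kappa>. (\<forall>x\<in>cube R. rate k \<beta> \<kappa> x \<ge> max 1 \<beta>) \<longrightarrow> (\<forall>w w1 w2. H20 R w w1 w2 \<longrightarrow>
    (\<integral>x. (rate k \<beta> \<kappa> x)\<^sup>2 * (w x)\<^sup>2 + sqgrad w1 x \<partial>QM R) \<le>
    (\<integral>x. 2 * (Aop w2 x - 2 * rate k \<beta> \<kappa> x * Qop k w1 x
      + ((rate k \<beta> \<kappa> x)\<^sup>2 - \<beta> * rate k \<beta> \<kappa> x) * a k k x * w x)\<^sup>2 / rate k \<beta> \<kappa> x \<partial>QM R))"
proof -
  obtain C1 where C1: "C1 \<ge> 0" "\<And>w w1 w2. H20 R w w1 w2 \<Longrightarrow>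
    (\<integral>x. Qop k w1 x * Aop w2 x \<partial>QM R) \<le> C1 * (\<integral>x. sqgrad w1 x \<partial>QM R)"
    using Qop_Aop_bound[of k] by blast
  obtain C2 where C2: "C2 \<ge> 0" "\<And>\<beta> \<kappa> w w1 w2. H20 R w w1 w2 \<Longrightarrow>
    4 * (\<integral>x. (rate k \<beta> \<kappa> x)\<^sup>2 * a k k x * w x * Qop k w1 x \<partial>QM R) \<le>
    (\<integral>x. (C2 - 4 * \<beta> * (a k k x)\<^sup>2) * (rate k \<beta> \<kappa> x)\<^sup>2 * (w x)\<^sup>2 \<partial>QM R)"
    using Qop_weight[of k] by blast
  obtain C3 where C3: "C3 \<ge> 0" "\<And>w w1 w2. H20 R w w1 w2 \<Longrightarrow>
    \<mu> / 2 * (\<integral>x. sqgrad w1 x \<partial>QM R) \<le> C3 * (\<integral>x. (w x)\<^sup>2 \<partial>QM R) - (\<integral>x. Aop w2 x * w x \<partial>QM R)"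
    using Aop_self_bound by blast
  obtain Bp where Bp: "Bp \<ge> 0" "\<And>z::unit. \<And>x. x \<in> cube R \<Longrightarrow> \<bar>a k k x\<bar> \<le> Bp"
    by (rule bounded_family[of "\<lambda>_. a k k" R]) (use a_cont in auto)
  \<comment> \<open>The multiple of the test of Y against w: of the gradient coefficient K \<mu>/2,
    the part 4 C1 pays for Q times \<open>Aop\<close>, and 1 remains for the conclusion.\<close>
  define K where "K = 2 * (4 * C1 + 1) / \<mu>"
  have K: "K > 0" "K * (\<mu> / 2) = 4 * C1 + 1" using \<mu> C1(1) by (auto simp: K_def)
  \<comment> \<open>Everything to be paid in multiples of r^2 w^2: the error of
    \<open>Qop_weight\<close>, the zero-order term of \<open>Aop_self_bound\<close>, the term K r^2
    p w^2, the constant K^2/4 from completing a square, and 1 for the conclusion.\<close>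
  define D where "D = C2 + K * C3 + K * Bp + K\<^sup>2 / 4 + 1"
  have D: "D > 0" unfolding D_def using C2(1) C3(1) Bp(1) K(1) by (simp add: add_nonneg_pos)
  \<comment> \<open>Half of the gain 4 \<beta> p^2 pays for the square of \<beta> r p w; the other
    half is at least 2 \<beta> \<mu>^2, which is made equal to \<open>D\<close>.\<close>
  define \<beta> where "\<beta> = D / (2 * \<mu>\<^sup>2)"
  have \<beta>: "\<beta> > 0" "2 * \<beta> * \<mu>\<^sup>2 = D" using D \<mu> by (auto simp: \<beta>_def)
  have "(\<integral>x. (rate k \<beta> \<kappa> x)\<^sup>2 * (w x)\<^sup>2 + sqgrad w1 x \<partial>QM R) \<le>
    (\<integral>x. 2 * (Aop w2 x - 2 * rate k \<beta> \<kappa> x * Qop k w1 x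
      + ((rate k \<beta> \<kappa> x)\<^sup>2 - \<beta> * rate k \<beta> \<kappa> x) * a k k x * w x)\<^sup>2 / rate k \<beta> \<kappa> x \<partial>QM R)"
    if r: "\<And>x. x \<in> cube R \<Longrightarrow> rate k \<beta> \<kappa> x \<ge> max 1 \<beta>" and H: "H20 R w w1 w2" for \<kappa> w w1 w2
  proof -
    note L = H20_L2[OF H]
    let ?r = "rate k \<beta> \<kappa>" and ?p = "a k k" and ?A = "Aop w2" and ?Q = "Qop k w1"
    let ?P = "\<lambda>x. ?A x - 2 * ?r x * ?Q x + ((?r x)\<^sup>2 - \<beta> * ?r x) * ?p x * w x"
    let ?W = "\<integral>x. (?r x)\<^sup>2 * (w x)\<^sup>2 \<partial>QM R" and ?S = "\<integral>x. sqgrad w1 x \<partial>QM R" and ?w0 = "\<integral>x. (w x)\<^sup>2 \<partial>QM R"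
      and ?Aw = "\<integral>x. ?A x * w x \<partial>QM R" and ?QA = "\<integral>x. ?Q x * ?A x \<partial>QM R"
      and ?QW = "\<integral>x. (?r x)\<^sup>2 * ?p x * w x * ?Q x \<partial>QM R" and ?PP = "\<integral>x. 2 * (?P x)\<^sup>2 / ?r x \<partial>QM R"
      and ?pW = "\<integral>x. 2 * \<beta> * (?p x)\<^sup>2 * (?r x)\<^sup>2 * (w x)\<^sup>2 \<partial>QM R"
    have LA: "?A \<in> L2 (QM R)" by (intro Aop_L2 L)
    have LQ: "?Q \<in> L2 (QM R)" by (intro Qop_L2 L)
    have LP: "?P \<in> L2 (QM R)"
      by (intro L2_add L2_diff L2_continuous_mult LA LQ L continuous_intros rate_cont a_cont)
    have ip: "integrable (QM R) (\<lambda>x. c x * f x * g x)" if "continuous_on UNIV c" "f \<in> L2 (QM R)" "g \<in> L2 (QM R)" for c f g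
      by (rule integrable_L2_mult3[OF that])
    have iw: "integrable (QM R) (\<lambda>x. c x * (w x)\<^sup>2)" if "continuous_on UNIV c" for c
      using ip[OF that L(1) L(1)] by (simp add: power2_eq_square mult.assoc)
    have iA: "integrable (QM R) (\<lambda>x. ?A x * w x)" by (rule L2_integrable_mult[OF LA L(1)])
    have iQA: "integrable (QM R) (\<lambda>x. ?Q x * ?A x)" by (rule L2_integrable_mult[OF LQ LA])
    have iQ: "integrable (QM R) (\<lambda>x. (?r x)\<^sup>2 * ?p x * w x * ?Q x)"
      by (intro ip L LQ continuous_intros rate_cont a_cont)
    have ig: "integrable (QM R) (sqgrad w1)" by (rule integrable_sqgrad[OF L(2)])
    have rne: "?r x \<noteq> 0" if "\<kappa> \<noteq> 0" for x using that by (simp add: rate_def)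
    \<comment> \<open>The bound r >= 1 at the origin forces \<open>\<kappa>\<close> to be nonzero,
      so 1/r is continuous on the whole space.\<close>
    have "0 \<in> (cube R :: (real^'n) set)" using R by (simp add: mem_cube)
    then have "\<kappa> \<noteq> 0" using r[of 0] by (auto simp: rate_def)
    then have "continuous_on UNIV (\<lambda>x. 2 / ?r x)"
      using rne by (intro continuous_intros rate_cont) auto
    then have "integrable (QM R) (\<lambda>x. 2 / ?r x * ?P x * ?P x)" by (rule ip[OF _ LP LP])
    moreover have "2 / s * t * t = 2 * t\<^sup>2 / s" for s t :: real by (simp add: power2_eq_square)
    ultimately have iP: "integrable (QM R) (\<lambda>x. 2 * (?P x)\<^sup>2 / ?r x)" by (simp only:)
    have w0: "?w0 \<le> ?W"
    proof (rule integral_mono_cube)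
      show "integrable (QM R) (\<lambda>x. (w x)\<^sup>2)" using iw[of "\<lambda>_. 1"] by simp
      show "integrable (QM R) (\<lambda>x. (?r x)\<^sup>2 * (w x)\<^sup>2)" by (intro iw continuous_intros rate_cont)
      fix x :: "real^'n" assume "x \<in> cube R"
      then have "1 \<le> (?r x)\<^sup>2" using r[of x] by (intro one_le_power) auto
      then have "1 * (w x)\<^sup>2 \<le> (?r x)\<^sup>2 * (w x)\<^sup>2" by (rule mult_right_mono) simp
      then show "(w x)\<^sup>2 \<le> (?r x)\<^sup>2 * (w x)\<^sup>2" by simp
    qed
    define J where "J x = (C2 - 4 * \<beta> * (?p x)\<^sup>2) * (?r x)\<^sup>2 * (w x)\<^sup>2" for x
    have iJ: "integrable (QM R) J" unfolding J_def by (intro iw continuous_intros rate_cont a_cont)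
    let ?Z = "\<lambda>x. - K * (?A x * w x) - 4 * (?Q x * ?A x) - 4 * ((?r x)\<^sup>2 * ?p x * w x * ?Q x) - 2 * \<beta> * (?p x)\<^sup>2 * (?r x)\<^sup>2 * (w x)\<^sup>2"
    have pointwise: "(K * Bp + K\<^sup>2 / 4) * ((?r x)\<^sup>2 * (w x)\<^sup>2) + 2 * (?P x)\<^sup>2 / ?r x \<ge>
       ?Z x"
      if x: "x \<in> cube R" for x
    proof -
      let ?R = "?r x"
      have R1: "?R \<ge> 1" "?R \<ge> \<beta>" using r[OF x] by auto
      define Y where "Y = ?A x + ?R\<^sup>2 * ?p x * w x"
      have PY: "?P x = Y - 2 * ?R * ?Q x - \<beta> * ?R * ?p x * w x" by (simp add: Y_def algebra_simps)
      have "(Y - 2 * ?R * ?Q x)\<^sup>2 \<le> 2 * (?P x)\<^sup>2 + 2 * (\<beta> * ?R * ?p x * w x)\<^sup>2"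
      proof -
        have "(s + t)\<^sup>2 \<le> 2 * s\<^sup>2 + 2 * t\<^sup>2" for s t :: real
          using sum_squares_bound[of s t] by (simp add: power2_sum)
        from this[of "?P x" "\<beta> * ?R * ?p x * w x"] show ?thesis unfolding PY by simp
      qed
      then have "(Y - 2 * ?R * ?Q x)\<^sup>2 / ?R \<le> (2 * (?P x)\<^sup>2 + 2 * (\<beta> * ?R * ?p x * w x)\<^sup>2) / ?R"
        using R1 by (intro divide_right_mono) auto
      then have 1: "(Y - 2 * ?R * ?Q x)\<^sup>2 / ?R \<le> 2 * (?P x)\<^sup>2 / ?R + 2 * \<beta>\<^sup>2 * ?R * (?p x)\<^sup>2 * (w x)\<^sup>2"
        using R1 by (simp add: add_divide_distrib power2_eq_square mult_ac)
      \<comment> \<open>The dropped term 4 r Q^2 is nonnegative, and the division by r has freed Q Y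
        of its weight.\<close>
      have 2: "(Y - 2 * ?R * ?Q x)\<^sup>2 / ?R \<ge> Y\<^sup>2 / ?R - 4 * (?Q x * Y)"
      proof -
        have "(Y - 2 * ?R * ?Q x)\<^sup>2 / ?R = Y\<^sup>2 / ?R - 4 * (?Q x * Y) + 4 * ?R * (?Q x)\<^sup>2"
          using R1 by (simp add: field_simps power2_eq_square)
        then show ?thesis using R1 by simp
      qed
      \<comment> \<open>The square of Y + K r w / 2 trades Y^2 / r for the test of Y against w; r <=
        r^2 then raises the error to the common form.\<close>
      have 3: "Y\<^sup>2 / ?R \<ge> - K * (Y * w x) - K\<^sup>2 / 4 * (?R\<^sup>2 * (w x)\<^sup>2)"
      proof -
        have "0 \<le> (Y + K * ?R * w x / 2)\<^sup>2 / ?R" using R1 by simp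
        also have "\<dots> = Y\<^sup>2 / ?R + K * (Y * w x) + K\<^sup>2 / 4 * (?R * (w x)\<^sup>2)"
          using R1 by (simp add: field_simps power2_eq_square)
        finally have "Y\<^sup>2 / ?R \<ge> - K * (Y * w x) - K\<^sup>2 / 4 * (?R * (w x)\<^sup>2)" by linarith
        moreover have "K\<^sup>2 / 4 * (?R * (w x)\<^sup>2) \<le> K\<^sup>2 / 4 * (?R\<^sup>2 * (w x)\<^sup>2)"
          using R1 by (intro mult_left_mono mult_right_mono) (auto simp: power2_eq_square)
        ultimately show ?thesis by linarith
      qed
      \<comment> \<open>One factor \<open>\<beta>\<close> is replaced by r.\<close>
      have 4: "2 * \<beta>\<^sup>2 * ?R * (?p x)\<^sup>2 * (w x)\<^sup>2 \<le> 2 * \<beta> * (?p x)\<^sup>2 * ?R\<^sup>2 * (w x)\<^sup>2"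
      proof -
        have "\<beta> * (2 * \<beta> * ?R * (?p x)\<^sup>2 * (w x)\<^sup>2) \<le> ?R * (2 * \<beta> * ?R * (?p x)\<^sup>2 * (w x)\<^sup>2)"
          using R1 \<beta>(1) by (intro mult_right_mono) auto
        then show ?thesis by (simp add: power2_eq_square mult_ac)
      qed
      have 5: "K * (?R\<^sup>2 * ?p x * (w x)\<^sup>2) \<le> K * Bp * (?R\<^sup>2 * (w x)\<^sup>2)"
      proof -
        have "?p x \<le> Bp" using Bp(2)[OF x] by auto
        then have "?p x * (K * (?R\<^sup>2 * (w x)\<^sup>2)) \<le> Bp * (K * (?R\<^sup>2 * (w x)\<^sup>2))"
          using K(1) by (intro mult_right_mono) auto
        then show ?thesis by (simp add: mult_ac)
      qed
      have 6: "K * (Y * w x) = K * (?A x * w x) + K * (?R\<^sup>2 * ?p x * (w x)\<^sup>2)"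
        "?Q x * Y = ?Q x * ?A x + ?R\<^sup>2 * ?p x * w x * ?Q x"
        by (simp_all add: Y_def power2_eq_square algebra_simps)
      show ?thesis using 1 2 3 4 5 6 by (simp add: algebra_simps)
    qed
    have lin: "(\<integral>x. c * f x - 4 * g x - 4 * h x - e x \<partial>QM R)
      = c * (\<integral>x. f x \<partial>QM R) - 4 * (\<integral>x. g x \<partial>QM R) - 4 * (\<integral>x. h x \<partial>QM R) - (\<integral>x. e x \<partial>QM R)"
      if "integrable (QM R) f" "integrable (QM R) g" "integrable (QM R) h" "integrable (QM R) e"
      for c and f g h e :: "real^'n \<Rightarrow> real" using that by simp
    have "(\<integral>x. ?Z x \<partial>QM R)
      \<le> (\<integral>x. (K * Bp + K\<^sup>2 / 4) * ((?r x)\<^sup>2 * (w x)\<^sup>2) + 2 * (?P x)\<^sup>2 / ?r x \<partial>QM R)"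
    proof (rule integral_mono_cube[OF _ _ pointwise])
      show "integrable (QM R) (\<lambda>x. ?Z x)"
        by (intro Bochner_Integration.integrable_diff integrable_mult_right iA iQA iQ iw continuous_intros rate_cont a_cont)
      show "integrable (QM R) (\<lambda>x. (K * Bp + K\<^sup>2 / 4) * ((?r x)\<^sup>2 * (w x)\<^sup>2) + 2 * (?P x)\<^sup>2 / ?r x)"
        by (intro Bochner_Integration.integrable_add iP integrable_mult_right iw continuous_intros rate_cont)
    qed
    also have "(\<integral>x. ?Z x \<partial>QM R)
      = - K * ?Aw - 4 * ?QA - 4 * ?QW
        - ?pW"
      by (rule lin[OF iA iQA iQ iw]) (intro continuous_intros rate_cont a_cont)
    also have "(\<integral>x. (K * Bp + K\<^sup>2 / 4) * ((?r x)\<^sup>2 * (w x)\<^sup>2) + 2 * (?P x)\<^sup>2 / ?r x \<partial>QM R)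
      = (K * Bp + K\<^sup>2 / 4) * ?W + ?PP"
      by (subst Bochner_Integration.integral_add[OF _ iP])
        (auto intro!: iw continuous_intros rate_cont)
    finally have main: "- K * ?Aw - 4 * ?QA - 4 * ?QW
        - ?pW
      \<le> (K * Bp + K\<^sup>2 / 4) * ?W + ?PP" .
    have k3: "K * ?Aw \<le> K * C3 * ?w0 - (4 * C1 + 1) * ?S"
    proof -
      have "K * (\<mu> / 2 * ?S) \<le> K * (C3 * ?w0 - (\<integral>x. Aop w2 x * w x \<partial>QM R))"
        using C3(2)[OF H] K(1) by (intro mult_left_mono) auto
      then show ?thesis by (simp only: K(2)[symmetric]) (simp add: algebra_simps)
    qed
    have k3': "K * C3 * ?w0 \<le> K * C3 * ?W"
      using w0 K(1) C3(1) by (intro mult_left_mono) auto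
    \<comment> \<open>\<open>J\<close> contains -4 \<beta> p^2, and \<open>?pW\<close> gives half of
      it back; p >= \<mu> bounds what is left by -\<open>D\<close>.\<close>
    have kw: "(\<integral>x. J x \<partial>QM R) + ?pW \<le> (C2 - D) * ?W"
    proof -
      have i2: "integrable (QM R) (\<lambda>x. 2 * \<beta> * (?p x)\<^sup>2 * (?r x)\<^sup>2 * (w x)\<^sup>2)"
        by (intro iw continuous_intros rate_cont a_cont)
      have "(\<integral>x. J x \<partial>QM R) + ?pW = (\<integral>x. J x + 2 * \<beta> * (?p x)\<^sup>2 * (?r x)\<^sup>2 * (w x)\<^sup>2 \<partial>QM R)"
        using iJ i2 by simp
      also have "\<dots> \<le> (\<integral>x. (C2 - D) * ((?r x)\<^sup>2 * (w x)\<^sup>2) \<partial>QM R)"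
      proof (rule integral_mono_cube)
        show "integrable (QM R) (\<lambda>x. J x + 2 * \<beta> * (?p x)\<^sup>2 * (?r x)\<^sup>2 * (w x)\<^sup>2)"
          using iJ i2 by simp
        show "integrable (QM R) (\<lambda>x. (C2 - D) * ((?r x)\<^sup>2 * (w x)\<^sup>2))"
          by (intro integrable_mult_right iw continuous_intros rate_cont)
        fix x
        have "\<mu>\<^sup>2 \<le> (?p x)\<^sup>2" using a_diag_ge[of k x] \<mu> by (intro power_mono) auto
        then have "2 * \<beta> * \<mu>\<^sup>2 \<le> 2 * \<beta> * (?p x)\<^sup>2" using \<beta>(1) by (intro mult_left_mono) auto
        then have "D * ((?r x)\<^sup>2 * (w x)\<^sup>2) \<le> 2 * \<beta> * (?p x)\<^sup>2 * ((?r x)\<^sup>2 * (w x)\<^sup>2)"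
          unfolding \<beta>(2) by (intro mult_right_mono) auto
        then show "J x + 2 * \<beta> * (?p x)\<^sup>2 * (?r x)\<^sup>2 * (w x)\<^sup>2 \<le> (C2 - D) * ((?r x)\<^sup>2 * (w x)\<^sup>2)"
          by (simp add: J_def algebra_simps)
      qed
      finally show ?thesis by simp
    qed
    have k2: "4 * ?QW \<le> (\<integral>x. J x \<partial>QM R)"
      unfolding J_def by (rule C2(2)[OF H])
    have "(\<integral>x. (?r x)\<^sup>2 * (w x)\<^sup>2 + sqgrad w1 x \<partial>QM R) = ?W + ?S"
      by (intro Bochner_Integration.integral_add iw ig continuous_intros rate_cont)
    moreover have "(C2 - D) * ?W = - (K * C3 + K * Bp + K\<^sup>2 / 4 + 1) * ?W"
      by (simp add: D_def)
    ultimately show ?thesis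
      using main k3 k3' kw k2 C1(2)[OF H] by (simp add: algebra_simps)
  qed
  with \<beta>(1) show ?thesis by blast
qed

end

section \<open>From the conjugated estimate back to the original function\<close>

context elliptic_coeff
begin

text \<open>\<open>\<kappa> / \<beta>\<close> is the large parameter \<lambda>; with this
  normalization the logarithmic derivative in x_k is exactly \<open>rate\<close>.\<close>

definition weight :: "'n \<Rightarrow> real \<Rightarrow> real \<Rightarrow> real^'n \<Rightarrow> real"
  where "weight k \<beta> \<kappa> x = exp (\<kappa> / \<beta> * exp (\<beta> * x $ k))"

lemma weight_C2:
  assumes "\<beta> > 0"
  shows "C2_grad (weight k \<beta> \<kappa>) (\<lambda>i x. if i = k then rate k \<beta> \<kappa> x * weight k \<beta> \<kappa> x else 0)
    (\<lambda>i j x. if i = k \<and> j = k then ((rate k \<beta> \<kappa> x)\<^sup>2 + \<beta> * rate k \<beta> \<kappa> x) * weight k \<beta> \<kappa> x else 0)"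
proof -
  have 1: "C1_grad (weight k \<beta> \<kappa>) (\<lambda>i x. if i = k then rate k \<beta> \<kappa> x * weight k \<beta> \<kappa> x else 0)"
    unfolding weight_def rate_def
    by (rule C1_grad_compose_coord[of "\<lambda>t. exp (\<kappa> / \<beta> * exp (\<beta> * t))"
          "\<lambda>t. \<kappa> * exp (\<beta> * t) * exp (\<kappa> / \<beta> * exp (\<beta> * t))"])
      (use assms in \<open>auto intro!: derivative_eq_intros continuous_intros\<close>)
  have 2: "C1_grad (\<lambda>x. rate k \<beta> \<kappa> x * weight k \<beta> \<kappa> x)
    (\<lambda>j x. if j = k then ((rate k \<beta> \<kappa> x)\<^sup>2 + \<beta> * rate k \<beta> \<kappa> x) * weight k \<beta> \<kappa> x else 0)"
  proof -
    have "(\<lambda>j x. if j = k then ((rate k \<beta> \<kappa> x)\<^sup>2 + \<beta> * rate k \<beta> \<kappa> x) * weight k \<beta> \<kappa> x else 0) =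
      (\<lambda>j x. (if j = k then \<beta> * rate k \<beta> \<kappa> x else 0) * weight k \<beta> \<kappa> x
        + rate k \<beta> \<kappa> x * (if j = k then rate k \<beta> \<kappa> x * weight k \<beta> \<kappa> x else 0))"
      by (auto simp: fun_eq_iff power2_eq_square algebra_simps)
    then show ?thesis using C1_grad_mult[OF rate_C1 1] by simp
  qed
  have "C1_grad (\<lambda>x. if i = k then rate k \<beta> \<kappa> x * weight k \<beta> \<kappa> x else 0)
    (\<lambda>j x. if i = k \<and> j = k then ((rate k \<beta> \<kappa> x)\<^sup>2 + \<beta> * rate k \<beta> \<kappa> x) * weight k \<beta> \<kappa> x else 0)" for i
    using 2 C1_grad_const[of 0] by (cases "i = k") simp_all
  with 1 show ?thesis by (simp add: C2_grad_def)
qed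

lemma sum_delta_mult: "(\<Sum>j\<in>(UNIV::'n set). f j * (if j = k then c else 0)) = f k * (c::real)"
proof -
  have "(\<Sum>j\<in>UNIV - {k}. f j * (if j = k then c else 0)) = 0" by (rule sum.neutral) auto
  then show ?thesis by (subst sum.remove[of UNIV k]) auto
qed

text \<open>Conjugation of the operator with the weight: \<open>carleman_conjugated\<close> in terms of \<open>h = w / weight\<close>.\<close>

lemma conjugate_Aop:
  fixes h g G k \<beta> \<kappa>
  defines "r \<equiv> rate k \<beta> \<kappa>" and "E \<equiv> weight k \<beta> \<kappa>"
  defines "w1 \<equiv> \<lambda>i x. (if i = k then r x * E x else 0) * h x + E x * g i x"
  defines "w2 \<equiv> \<lambda>i j x. (if j = k \<and> i = k then ((r x)\<^sup>2 + \<beta> * r x) * E x else 0) * h x + (if j = k then r x * E x else 0) * g i x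
      + ((if i = k then r x * E x else 0) * g j x + E x * G i j x)"
  shows "Aop w2 x - 2 * r x * Qop k w1 x + ((r x)\<^sup>2 - \<beta> * r x) * a k k x * (E x * h x) = E x * Aop G x"
proof -
  let ?q = "\<Sum>l\<in>UNIV. a k l x * g l x"
  have Q: "Qop k w1 x = a k k x * (r x * E x * h x) + E x * ?q"
  proof -
    have "Qop k w1 x = (\<Sum>l\<in>UNIV. a k l x * (if l = k then r x * E x * h x else 0) + E x * (a k l x * g l x))"
      unfolding Qop_def w1_def by (rule sum.cong) (auto simp: algebra_simps)
    then show ?thesis by (simp only: sum.distrib sum_delta_mult sum_distrib_left)
  qed
  have inner: "(\<Sum>j\<in>UNIV. a i j x * w2 i j x) =
    a k k x * (if i = k then ((r x)\<^sup>2 + \<beta> * r x) * E x * h x else 0) + a i k x * (r x * E x * g i x)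
    + (\<Sum>j\<in>UNIV. a i j x * g j x) * (if i = k then r x * E x else 0) + E x * (\<Sum>j\<in>UNIV. a i j x * G i j x)" for i
  proof -
    have "(\<Sum>j\<in>UNIV. a i j x * w2 i j x) =
      (\<Sum>j\<in>UNIV. a i j x * (if j = k then (if i = k then ((r x)\<^sup>2 + \<beta> * r x) * E x * h x else 0) else 0)
        + a i j x * (if j = k then r x * E x * g i x else 0)
        + a i j x * g j x * (if i = k then r x * E x else 0) + E x * (a i j x * G i j x))"
      unfolding w2_def by (rule sum.cong) (auto simp: algebra_simps)
    also have "\<dots> = a i k x * (if i = k then ((r x)\<^sup>2 + \<beta> * r x) * E x * h x else 0) + a i k x * (r x * E x * g i x)
    + (\<Sum>j\<in>UNIV. a i j x * g j x) * (if i = k then r x * E x else 0) + E x * (\<Sum>j\<in>UNIV. a i j x * G i j x)"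
      by (simp only: sum.distrib sum_delta_mult sum_distrib_left sum_distrib_right)
    finally show ?thesis by auto
  qed
  have "Aop w2 x = a k k x * (((r x)\<^sup>2 + \<beta> * r x) * E x * h x) + (\<Sum>i\<in>UNIV. a i k x * (r x * E x * g i x))
    + ?q * (r x * E x) + E x * Aop G x"
    unfolding Aop_def inner
    by (simp only: sum.distrib sum_delta_mult sum_distrib_left[symmetric]) simp
  \<comment> \<open>Symmetry of \<open>a\<close> identifies the two cross terms; together they
    cancel the gradient part of -2 r Q.\<close>
  also have "(\<Sum>i\<in>UNIV. a i k x * (r x * E x * g i x)) = r x * E x * ?q"
    by (simp add: sum_distrib_left a_sym[of _ k] mult_ac)
  \<comment> \<open>The coefficients of \<open>a k k x * E x * h x\<close> add up to (r^2 + \<beta>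
    r) - 2 r^2 + (r^2 - \<beta> r) = 0.\<close>
  finally show ?thesis unfolding Q by (simp add: power2_eq_square algebra_simps)
qed

lemma carleman:
  "\<exists>\<beta>>0. \<forall>\<kappa>. (\<forall>x\<in>cube R. rate k \<beta> \<kappa> x \<ge> max 1 \<beta>) \<longrightarrow> (\<forall>h g G. H20 R h g G \<longrightarrow>
    (\<integral>x. (rate k \<beta> \<kappa> x)\<^sup>2 * (weight k \<beta> \<kappa> x * h x)\<^sup>2 +
        sqgrad (\<lambda>i x. (if i = k then rate k \<beta> \<kappa> x * weight k \<beta> \<kappa> x else 0) * h x + weight k \<beta> \<kappa> x * g i x) x \<partial>QM R) \<le>
    (\<integral>x. 2 * (weight k \<beta> \<kappa> x * Aop G x)\<^sup>2 / rate k \<beta> \<kappa> x \<partial>QM R))"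
proof -
  obtain \<beta> where \<beta>: "\<beta> > 0" and c: "\<And>\<kappa> w w1 w2. (\<forall>x\<in>cube R. rate k \<beta> \<kappa> x \<ge> max 1 \<beta>) \<Longrightarrow> H20 R w w1 w2 \<Longrightarrow>
    (\<integral>x. (rate k \<beta> \<kappa> x)\<^sup>2 * (w x)\<^sup>2 + sqgrad w1 x \<partial>QM R) \<le>
    (\<integral>x. 2 * (Aop w2 x - 2 * rate k \<beta> \<kappa> x * Qop k w1 x
      + ((rate k \<beta> \<kappa> x)\<^sup>2 - \<beta> * rate k \<beta> \<kappa> x) * a k k x * w x)\<^sup>2 / rate k \<beta> \<kappa> x \<partial>QM R)"
    using carleman_conjugated[of k] by blast
  show ?thesis
  proof (intro exI[of _ \<beta>] conjI \<beta> allI impI)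
    fix \<kappa> and h :: "real^'n \<Rightarrow> real" and g G assume r: "\<forall>x\<in>cube R. rate k \<beta> \<kappa> x \<ge> max 1 \<beta>" and H: "H20 R h g G"
    show "(\<integral>x. (rate k \<beta> \<kappa> x)\<^sup>2 * (weight k \<beta> \<kappa> x * h x)\<^sup>2 +
        sqgrad (\<lambda>i x. (if i = k then rate k \<beta> \<kappa> x * weight k \<beta> \<kappa> x else 0) * h x + weight k \<beta> \<kappa> x * g i x) x \<partial>QM R) \<le>
      (\<integral>x. 2 * (weight k \<beta> \<kappa> x * Aop G x)\<^sup>2 / rate k \<beta> \<kappa> x \<partial>QM R)"
      using c[OF r H20_mult[OF weight_C2[OF \<beta>, of k \<kappa>] H]] unfolding conjugate_Aop .
  qed
qed

section \<open>Absorption of the lower-order terms\<close>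

text \<open>Expresses the lower-order terms through the quantities that the Carleman estimate
  controls: E g is \<open>w1\<close>, the gradient of E h, minus r E h in direction
  \<open>k\<close>. The factor 3 comes from squaring a sum of three terms.\<close>

lemma weighted_bound:
  fixes h :: "'m \<Rightarrow> real" and g :: "'n \<Rightarrow> real"
  assumes I: "finite I" "m \<in> I" and C: "C \<ge> 0" and r: "r \<ge> 1" and E: "E > 0"
    and A: "\<bar>AG\<bar> \<le> C * ((\<Sum>j\<in>UNIV. \<bar>g j\<bar>) + (\<Sum>n\<in>I. \<bar>h n\<bar>))"
    and w1: "\<And>i. w1 i = (if i = k then r * E else 0) * h m + E * g i"
  shows "(E * AG)\<^sup>2 \<le> 3 * (C * (real CARD('n) + card I))\<^sup>2 *
    (r\<^sup>2 * (E * h m)\<^sup>2 + (\<Sum>j\<in>UNIV. (w1 j)\<^sup>2) + (\<Sum>n\<in>I. r\<^sup>2 * (E * h n)\<^sup>2))"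
proof -
  define s where "s = sqrt (\<Sum>j\<in>UNIV. (w1 j)\<^sup>2)"
  define t where "t = r * \<bar>E * h m\<bar>"
  define z where "z = sqrt (\<Sum>n\<in>I. r\<^sup>2 * (E * h n)\<^sup>2)"
  have nonneg: "s \<ge> 0" "t \<ge> 0" "z \<ge> 0" using r by (auto simp: s_def t_def z_def sum_nonneg)
  have sq: "s\<^sup>2 = (\<Sum>j\<in>UNIV. (w1 j)\<^sup>2)" "t\<^sup>2 = r\<^sup>2 * (E * h m)\<^sup>2" "z\<^sup>2 = (\<Sum>n\<in>I. r\<^sup>2 * (E * h n)\<^sup>2)"
    by (auto simp: s_def t_def z_def sum_nonneg power_mult_distrib)
  have g: "E * \<bar>g j\<bar> \<le> s + t" for j
  proof -
    have "(w1 j)\<^sup>2 \<le> (\<Sum>j\<in>UNIV. (w1 j)\<^sup>2)" by (rule member_le_sum) auto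
    then have "\<bar>w1 j\<bar> \<le> s" by (simp add: s_def real_le_rsqrt)
    moreover have "\<bar>(if j = k then r * E else 0) * h m\<bar> \<le> t"
      using r E by (auto simp: t_def abs_mult)
    moreover have "E * g j = w1 j - (if j = k then r * E else 0) * h m" by (simp add: w1)
    moreover have "E * \<bar>g j\<bar> = \<bar>E * g j\<bar>" using E by (simp add: abs_mult)
    ultimately show ?thesis by linarith
  qed
  have h: "E * \<bar>h n\<bar> \<le> z" if "n \<in> I" for n
  proof -
    have "r\<^sup>2 * (E * h n)\<^sup>2 \<le> (\<Sum>n\<in>I. r\<^sup>2 * (E * h n)\<^sup>2)" using that I by (intro member_le_sum) auto
    then have "\<bar>r * (E * h n)\<bar> \<le> z" by (simp add: z_def real_le_rsqrt power_mult_distrib)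
    moreover have "1 * (E * \<bar>h n\<bar>) \<le> r * (E * \<bar>h n\<bar>)" using r E by (intro mult_right_mono) auto
    moreover have "\<bar>r * (E * h n)\<bar> = r * (E * \<bar>h n\<bar>)" using r E by (simp add: abs_mult)
    ultimately show ?thesis by linarith
  qed
  have "\<bar>E * AG\<bar> \<le> E * (C * ((\<Sum>j\<in>UNIV. \<bar>g j\<bar>) + (\<Sum>n\<in>I. \<bar>h n\<bar>)))"
    using A E by (simp add: abs_mult)
  also have "\<dots> = C * ((\<Sum>j\<in>UNIV. E * \<bar>g j\<bar>) + (\<Sum>n\<in>I. E * \<bar>h n\<bar>))"
    by (simp add: sum_distrib_left algebra_simps)
  also have "\<dots> \<le> C * ((\<Sum>j\<in>(UNIV::'n set). s + t) + (\<Sum>n\<in>I. z))"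
    by (intro mult_left_mono add_mono sum_mono g h C)
  also have "\<dots> = C * (real CARD('n) * (s + t) + card I * z)" by simp
  also have "\<dots> \<le> C * ((real CARD('n) + card I) * (s + t + z))"
    using nonneg by (intro mult_left_mono C) (simp add: algebra_simps)
  finally have "\<bar>E * AG\<bar> \<le> C * (real CARD('n) + card I) * (s + t + z)" by (simp add: mult.assoc)
  then have "(E * AG)\<^sup>2 \<le> (C * (real CARD('n) + card I) * (s + t + z))\<^sup>2"
    by (rule abs_le_square_iff[THEN iffD1, OF order_trans[OF _ abs_ge_self]])
  also have "\<dots> = (C * (real CARD('n) + card I))\<^sup>2 * (s + t + z)\<^sup>2" by (rule power_mult_distrib)
  also have "\<dots> \<le> (C * (real CARD('n) + card I))\<^sup>2 * (3 * (t\<^sup>2 + s\<^sup>2 + z\<^sup>2))"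
  proof (intro mult_left_mono)
    show "(s + t + z)\<^sup>2 \<le> 3 * (t\<^sup>2 + s\<^sup>2 + z\<^sup>2)"
      using sum_squares_bound[of s t] sum_squares_bound[of s z] sum_squares_bound[of t z]
      by (simp add: power2_eq_square algebra_simps)
  qed simp
  finally show ?thesis unfolding sq by (simp add: algebra_simps)
qed

lemma unique_continuation:
  fixes h :: "'m \<Rightarrow> real^'n \<Rightarrow> real"
  assumes I: "finite I" and H: "\<And>m. m \<in> I \<Longrightarrow> H20 R (h m) (g m) (G m)" and C: "C \<ge> 0"
    and le: "\<And>m. m \<in> I \<Longrightarrow> AE x in QM R. \<bar>Aop (G m) x\<bar> \<le> C * ((\<Sum>j\<in>UNIV. \<bar>g m j x\<bar>) + (\<Sum>n\<in>I. \<bar>h n x\<bar>))"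
    and m: "m \<in> I"
  shows "AE x in QM R. h m x = 0"
proof -
  \<comment> \<open>Any axis will do, as the Cauchy data vanish on every face;
    \<open>undefined\<close> just names one.\<close>
  define k :: 'n where "k = undefined"
  obtain \<beta> where \<beta>: "\<beta> > 0" and car: "\<And>\<kappa> h g G. (\<forall>x\<in>cube R. rate k \<beta> \<kappa> x \<ge> max 1 \<beta>) \<Longrightarrow> H20 R h g G \<Longrightarrow>
    (\<integral>x. (rate k \<beta> \<kappa> x)\<^sup>2 * (weight k \<beta> \<kappa> x * h x)\<^sup>2 +
        sqgrad (\<lambda>i x. (if i = k then rate k \<beta> \<kappa> x * weight k \<beta> \<kappa> x else 0) * h x + weight k \<beta> \<kappa> x * g i x) x \<partial>QM R) \<le>
    (\<integral>x. 2 * (weight k \<beta> \<kappa> x * Aop G x)\<^sup>2 / rate k \<beta> \<kappa> x \<partial>QM R)"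
    using carleman[of k] by blast
  define D where "D = 3 * (C * (real CARD('n) + card I))\<^sup>2"
  \<comment> \<open>The inner maximum is the threshold of the Carleman estimate;
    \<open>4 * D * (1 + card I)\<close> makes the right-hand side, summed over all equations, at
    most half of the left.\<close>
  define M where "M = max (max 1 \<beta>) (4 * D * (1 + card I))"
  \<comment> \<open>On the cube x_k > -R, so the factor exp(\<beta> R) compensates the smallest
    value of exp(\<beta> x_k) and yields r >= M.\<close>
  define \<kappa> where "\<kappa> = M * exp (\<beta> * R)"
  define r where "r = rate k \<beta> \<kappa>"
  define E where "E = weight k \<beta> \<kappa>"
  have D: "D \<ge> 0" by (simp add: D_def)
  have M: "M \<ge> 1" "M \<ge> 4 * D * (1 + card I)" by (auto simp: M_def)
  have rM: "r x \<ge> M" if "x \<in> cube R" for x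
  proof -
    have "\<bar>x $ k\<bar> < R" using that by (simp add: mem_cube)
    then have "0 \<le> \<beta> * (R + x $ k)" using \<beta> by (intro mult_nonneg_nonneg) auto
    then have "M * 1 \<le> M * exp (\<beta> * (R + x $ k))" using M by (intro mult_left_mono) auto
    then show ?thesis by (simp add: r_def rate_def \<kappa>_def exp_add distrib_left)
  qed
  then have r1: "\<forall>x\<in>cube R. rate k \<beta> \<kappa> x \<ge> max 1 \<beta>" by (fastforce simp: M_def r_def)
  have Epos: "E x > 0" for x by (simp add: E_def weight_def)
  have E_cont: "continuous_on UNIV E"
    unfolding E_def using weight_C2[OF \<beta>] by (auto simp: C2_grad_def intro: C1_grad_continuous)
  have r_cont: "continuous_on UNIV r" unfolding r_def by (rule rate_cont)
  define w1 where "w1 m i x = (if i = k then r x * E x else 0) * h m x + E x * g m i x" for m i x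
  define X where "X m = (\<integral>x. (r x)\<^sup>2 * (E x * h m x)\<^sup>2 + sqgrad (w1 m) x \<partial>QM R)" for m
  define X0 where "X0 m = (\<integral>x. (r x)\<^sup>2 * (E x * h m x)\<^sup>2 \<partial>QM R)" for m
  have L: "h m \<in> L2 (QM R)" "g m i \<in> L2 (QM R)" "G m i j \<in> L2 (QM R)" if "m \<in> I" for m i j
    using H20_L2[OF H[OF that]] by auto
  have Lw1: "w1 m i \<in> L2 (QM R)" if "m \<in> I" for m i
    unfolding w1_def by (cases "i = k") (auto intro!: L2_add L2_continuous_mult L[OF that] continuous_intros r_cont E_cont)
  have i0: "integrable (QM R) (\<lambda>x. (r x)\<^sup>2 * (E x * h m x)\<^sup>2)" if "m \<in> I" for m
    using integrable_L2_mult3[of "\<lambda>x. (r x)\<^sup>2" "\<lambda>x. E x * h m x" R "\<lambda>x. E x * h m x"]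
      L2_continuous_mult[OF E_cont L(1)[OF that]] r_cont
    by (simp add: power2_eq_square[of "_ * h m _"] mult.assoc continuous_intros)
  have i1: "integrable (QM R) (sqgrad (w1 m))" if "m \<in> I" for m
    by (rule integrable_sqgrad[OF Lw1[OF that]])
  have X0X: "X0 m \<le> X m" "0 \<le> X0 m" if "m \<in> I" for m
    unfolding X_def X0_def
    by (rule integral_mono_cube) (use i0[OF that] i1[OF that] sqgrad_nonneg in auto)
  \<comment> \<open>The smallness comes from the factor 1/r <= 1/M on the right of the Carleman
    estimate. The coupling brings in every \<open>X n\<close>, so no single equation closes on its
    own and the inequalities are summed over \<open>m\<close> below.\<close>
  have step: "X m \<le> 2 * D / M * (X m + (\<Sum>n\<in>I. X n))" if m: "m \<in> I" for m
  proof -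
    let ?B = "\<lambda>x. (r x)\<^sup>2 * (E x * h m x)\<^sup>2 + sqgrad (w1 m) x + (\<Sum>n\<in>I. (r x)\<^sup>2 * (E x * h n x)\<^sup>2)"
    have iB: "integrable (QM R) ?B"
      using i0 i1 m by (intro Bochner_Integration.integrable_add Bochner_Integration.integrable_sum) auto
    have LA: "(\<lambda>x. E x * Aop (G m) x) \<in> L2 (QM R)"
      by (intro L2_continuous_mult E_cont Aop_L2 L m)
    have "X m \<le> (\<integral>x. 2 * (E x * Aop (G m) x)\<^sup>2 / r x \<partial>QM R)"
      using car[OF r1 H[OF m]] unfolding X_def w1_def r_def E_def .
    also have "\<dots> \<le> (\<integral>x. 2 * D / M * ?B x \<partial>QM R)"
    proof (rule integral_mono_AE')
      show "integrable (QM R) (\<lambda>x. 2 * D / M * ?B x)" using iB by simp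
      show "AE x in QM R. 2 * (E x * Aop (G m) x)\<^sup>2 / r x \<le> 2 * D / M * ?B x"
        using le[OF m] AE_cube
      proof eventually_elim
        case (elim x)
        have r: "r x \<ge> M" by (rule rM[OF elim(2)])
        have b: "(E x * Aop (G m) x)\<^sup>2 \<le> D * ?B x"
          unfolding D_def sqgrad_def
          by (rule weighted_bound[OF I m C _ Epos elim(1) w1_def]) (use r M in auto)
        have "2 * (E x * Aop (G m) x)\<^sup>2 / r x \<le> 2 * (E x * Aop (G m) x)\<^sup>2 / M"
          using r M by (intro divide_left_mono) auto
        also have "\<dots> \<le> 2 * (D * ?B x) / M" using b M by (intro divide_right_mono mult_left_mono) auto
        finally show ?case by simp
      qed
      show "AE x in QM R. 0 \<le> 2 * D / M * ?B x"
        using D M by (intro AE_I2 mult_nonneg_nonneg add_nonneg_nonneg sum_nonneg sqgrad_nonneg) auto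
    qed
    also have "\<dots> = 2 * D / M * (X m + (\<Sum>n\<in>I. X0 n))"
    proof -
      have "(\<integral>x. ?B x \<partial>QM R) = X m + (\<integral>x. (\<Sum>n\<in>I. (r x)\<^sup>2 * (E x * h n x)\<^sup>2) \<partial>QM R)"
        unfolding X_def using i0 i1 m by (intro Bochner_Integration.integral_add) auto
      also have "(\<integral>x. (\<Sum>n\<in>I. (r x)\<^sup>2 * (E x * h n x)\<^sup>2) \<partial>QM R) = (\<Sum>n\<in>I. X0 n)"
        unfolding X0_def by (rule Bochner_Integration.integral_sum) (rule i0)
      finally show ?thesis by simp
    qed
    also have "\<dots> \<le> 2 * D / M * (X m + (\<Sum>n\<in>I. X n))"
      using D M X0X(1) by (intro mult_left_mono add_left_mono sum_mono) auto
    finally show ?thesis .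
  qed
  define S where "S = (\<Sum>n\<in>I. X n)"
  have S0: "S \<ge> 0" unfolding S_def using X0X by (intro sum_nonneg) force
  have "S \<le> (\<Sum>m\<in>I. 2 * D / M * (X m + S))"
    unfolding S_def by (intro sum_mono step)
  also have "\<dots> = 2 * D / M * (S + card I * S)"
    unfolding sum_distrib_left[symmetric] sum.distrib by (simp add: S_def)
  also have "\<dots> = 2 * D / M * (1 + card I) * S"
    by (simp add: algebra_simps)
  also have "\<dots> \<le> 1 / 2 * S"
  proof (intro mult_right_mono S0)
    show "2 * D / M * (1 + card I) \<le> 1 / 2" using M by (simp add: field_simps)
  qed
  finally have "S = 0" using S0 by linarith
  then have "X m = 0"
    using X0X I m by (subst (asm) S_def, subst (asm) sum_nonneg_eq_0_iff) force+
  then have "X0 m = 0" using X0X[OF m] by linarith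
  then have "AE x in QM R. (r x)\<^sup>2 * (E x * h m x)\<^sup>2 = 0"
    unfolding X0_def using i0[OF m] by (subst (asm) integral_nonneg_eq_0_iff_AE) auto
  then show ?thesis using AE_cube
  proof eventually_elim
    case (elim x)
    have "r x \<noteq> 0" using rM[OF elim(2)] M by auto
    then show ?case using elim(1) Epos[of x] by simp
  qed
qed

end

section \<open>The nonlinear system\<close>

lemma H1_approx_sum:
  assumes "finite J" "\<And>j. j \<in> J \<Longrightarrow> H1_approx R (h j) (g j)"
  shows "H1_approx R (\<lambda>x. \<Sum>j\<in>J. h j x) (\<lambda>i x. \<Sum>j\<in>J. g j i x)"
  using assms
proof (induction J rule: finite_induct)
  case empty
  have "H1_approx R (\<lambda>_. 0) (\<lambda>i _. 0)"
    unfolding H1_approx_def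
    by (intro conjI allI exI[of _ "\<lambda>k x. 0"] exI[of _ "\<lambda>k i x. 0"] C1_grad_const L2_continuous_cube continuous_intros)
      (simp_all add: tendsto_L2_def L2_def)
  then show ?case by simp
next
  case (insert j J)
  then show ?case by (simp add: H1_approx_add)
qed

lemma H1_approx_C1:
  assumes "C1_grad f df" shows "H1_approx R f df"
  unfolding H1_approx_def
proof (intro conjI allI exI[of _ "\<lambda>k. f"] exI[of _ "\<lambda>k. df"])
  show "f \<in> L2 (QM R)" by (intro L2_continuous_cube C1_grad_continuous[OF assms])
  show "df i \<in> L2 (QM R)" for i by (intro L2_continuous_cube C1_grad_continuous'[OF assms])
qed (use assms in \<open>simp_all add: tendsto_L2_def L2_def\<close>)

text \<open>A test function supported inside the cube lies in \<open>H10\<close>, so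
  \<open>H10_parts\<close> becomes the defining identity of the weak derivative.\<close>

lemma H1_approx_has_wpartial:
  assumes w: "H1_approx R w g" and R: "R > 0"
  shows "has_wpartial (cube R) i w (g i)"
  unfolding has_wpartial_def
proof (intro conjI allI impI)
  show "loc_integrable (cube R) w" "loc_integrable (cube R) (g i)"
    using H1_approx_L2[OF w] by (auto intro: L2_loc_integrable)
  fix f :: "real^'a \<Rightarrow> real" assume f: "smooth f \<and> compact (support f) \<and> support f \<subseteq> cube R"
  then have C: "C1_grad f (\<lambda>i. partial i f)" by (simp add: C1_grad_smooth)
  have f0: "f x = 0" if "x \<notin> cube R" for x
    using that f closure_subset[of "{x. f x \<noteq> 0}"] by (auto simp: support_def)
  have "H10 R f (\<lambda>i. partial i f)"
    unfolding H10_def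
  proof (intro conjI allI impI)
    show "H1_approx R f (\<lambda>i. partial i f)" by (rule H1_approx_C1[OF C])
    fix \<psi> :: "real^'a \<Rightarrow> real" and d\<psi> i assume "C1_grad \<psi> d\<psi>"
    from cube_divergence[OF C1_grad_mult[OF this C] R, of i]
    have "(\<integral>x. d\<psi> i x * f x + \<psi> x * partial i f x \<partial>QM R) = 0"
      by (simp add: face_integral_zero[OF f0 R])
    then show "(\<integral>x. partial i f x * \<psi> x + f x * d\<psi> i x \<partial>QM R) = 0"
      by (simp add: add.commute mult.commute)
  qed
  from H10_parts[OF this w, of i]
  have "(\<integral>x. w x * partial i f x + g i x * f x \<partial>QM R) = 0" by (simp add: mult.commute)
  moreover have "f \<in> L2 (QM R)" "partial i f \<in> L2 (QM R)" by (intro H1_approx_L2[OF H1_approx_C1[OF C]])+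
  ultimately show "(\<integral>x. w x * partial i f x \<partial>QM R) = - (\<integral>x. g i x * f x \<partial>QM R)"
    by (subst (asm) Bochner_Integration.integral_add) (auto intro: L2_integrable_mult H1_approx_L2[OF w])
qed

text \<open>Ties the unspecified representative to an explicit gradient, through uniqueness of weak
  derivatives.\<close>

lemma wpartial_AE_eq:
  assumes "H1_approx R w g" "R > 0"
  shows "AE x in QM R. wpartial (cube R) i w x = g i x"
proof (rule has_wpartial_unique[OF assms(2)])
  show "has_wpartial (cube R) i w (g i)" by (rule H1_approx_has_wpartial[OF assms])
  then show "has_wpartial (cube R) i w (wpartial (cube R) i w)"
    unfolding wpartial_def by (rule someI[of "has_wpartial (cube R) i w"])
qed

text \<open>The outer \<open>wpartial\<close> acts on the flux A grad w. Traces of the first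
  derivatives make these H1-approximable, Leibniz supplies an explicit gradient of the flux, and
  \<open>wpartial_AE_eq\<close> converts it into a product rule almost everywhere.\<close>

lemma Lop_wpartial_expand:
  fixes w :: "real^'n::finite \<Rightarrow> real"
  assumes R: "R > 0" and A: "\<And>i j. smooth (\<lambda>x. A x $ i $ j)"
    and tr: "\<And>j. has_trace R (wpartial (cube R) j w) (\<tau> j)"
  shows "AE x in QM R. Lop (wpartial (cube R)) A b w x =
    (\<Sum>i\<in>UNIV. \<Sum>j\<in>UNIV. A x $ i $ j * wpartial (cube R) i (wpartial (cube R) j w) x)
    + (\<Sum>i\<in>UNIV. \<Sum>j\<in>UNIV. partial i (\<lambda>y. A y $ i $ j) x * wpartial (cube R) j w x)
    + (\<Sum>j\<in>UNIV. b x $ j * wpartial (cube R) j w x)"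
proof -
  let ?g = "\<lambda>j. wpartial (cube R) j w"
  let ?G = "\<lambda>i j. wpartial (cube R) i (wpartial (cube R) j w)"
  have g: "H1_approx R (?g j) (\<lambda>i. ?G i j)" for j
    by (rule H1_trace_approx[OF has_trace_H1_trace[OF tr]])
  have eq: "(\<lambda>y. (A y *v grad (wpartial (cube R)) w y) $ i) = (\<lambda>y. \<Sum>j\<in>UNIV. A y $ i $ j * ?g j y)" for i
    by (simp add: matrix_vector_mult_def grad_def)
  have "H1_approx R (\<lambda>y. \<Sum>j\<in>UNIV. A y $ i $ j * ?g j y)
    (\<lambda>l x. \<Sum>j\<in>UNIV. partial l (\<lambda>y. A y $ i $ j) x * ?g j x + A x $ i $ j * ?G l j x)" for i
    by (intro H1_approx_sum H1_approx_mult C1_grad_smooth A g) auto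
  then have "AE x in QM R. wpartial (cube R) i (\<lambda>y. (A y *v grad (wpartial (cube R)) w y) $ i) x
    = (\<Sum>j\<in>UNIV. partial i (\<lambda>y. A y $ i $ j) x * ?g j x + A x $ i $ j * ?G i j x)" for i
    unfolding eq by (rule wpartial_AE_eq[OF _ R])
  then have "AE x in QM R. \<forall>i. wpartial (cube R) i (\<lambda>y. (A y *v grad (wpartial (cube R)) w y) $ i) x
    = (\<Sum>j\<in>UNIV. partial i (\<lambda>y. A y $ i $ j) x * ?g j x + A x $ i $ j * ?G i j x)"
    by (simp add: AE_all_countable)
  then show ?thesis
    by eventually_elim (simp add: Lop_def divg_def sum.distrib inner_vec_def grad_def)
qed

text \<open>Off the edges \<open>normal\<close> is \<sigma> times the unit vector of axis
  \<open>i\<close>, so the normal trace is a single component up to sign.\<close>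

lemma normal_trace_face:
  fixes \<tau> :: "real^'n::finite \<Rightarrow> real^'n"
  assumes R: "R > 0" and \<sigma>: "\<sigma> \<in> {-1, 1}" and z: "AE x in face_measure R i \<sigma>. \<tau> x \<bullet> normal R x = 0"
  shows "AE x in face_measure R i \<sigma>. \<tau> x $ i = 0"
proof -
  have "AE x in face_measure R i \<sigma>. \<forall>j. j \<noteq> i \<longrightarrow> \<bar>x $ j\<bar> \<noteq> R"
    unfolding AE_all_countable
  proof
    fix j show "AE x in face_measure R i \<sigma>. j \<noteq> i \<longrightarrow> \<bar>x $ j\<bar> \<noteq> R"
      using AE_face_interior[OF \<sigma> R, of j i] by (cases "j = i") auto
  qed
  then show ?thesis using AE_face_coord[OF \<sigma> R] z
  proof eventually_elim
    case (elim x)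
    have "normal R x = axis i \<sigma>"
      using elim(1,2) \<sigma> R by (auto simp: vec_eq_iff normal_def axis_def sgn_mult abs_mult)
    then have "\<tau> x $ i * \<sigma> = 0" using elim(3) by (simp add: inner_axis)
    then show ?case using \<sigma> by auto
  qed
qed

text \<open>The trace fields of the two gradients may differ tangentially as far as the data tell,
  but share the normal component \<open>G\<close>; subtraction leaves the situation of
  \<open>zero_Cauchy_data_H20\<close>.\<close>

lemma system_difference_H20:
  assumes R: "R > 0" and v: "has_trace R v F" "has_normal_trace R v G"
    and w: "has_trace R w F" "has_normal_trace R w G"
  shows "H20 R (\<lambda>x. v x - w x) (\<lambda>i x. wpartial (cube R) i v x - wpartial (cube R) i w x)
    (\<lambda>i j x. wpartial (cube R) i (wpartial (cube R) j v) x - wpartial (cube R) i (wpartial (cube R) j w) x)"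
proof -
  obtain \<tau> where \<tau>: "\<And>j. has_trace R (wpartial (cube R) j v) (\<lambda>x. \<tau> x $ j)"
      "\<And>i \<sigma>. \<sigma> \<in> {-1, 1} \<Longrightarrow> AE x in face_measure R i \<sigma>. \<tau> x \<bullet> normal R x = G x"
    using v(2) unfolding has_normal_trace_def by blast
  obtain \<tau>' where \<tau>': "\<And>j. has_trace R (wpartial (cube R) j w) (\<lambda>x. \<tau>' x $ j)"
      "\<And>i \<sigma>. \<sigma> \<in> {-1, 1} \<Longrightarrow> AE x in face_measure R i \<sigma>. \<tau>' x \<bullet> normal R x = G x"
    using w(2) unfolding has_normal_trace_def by blast
  show ?thesis
  proof (rule zero_Cauchy_data_H20)
    show "H1_trace R (\<lambda>x. v x - w x) (\<lambda>i x. wpartial (cube R) i v x - wpartial (cube R) i w x) (\<lambda>_. 0)"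
      using H1_trace_diff[OF has_trace_H1_trace[OF v(1)] has_trace_H1_trace[OF w(1)]] by simp
    show "H1_trace R (\<lambda>x. wpartial (cube R) j v x - wpartial (cube R) j w x)
      (\<lambda>i x. wpartial (cube R) i (wpartial (cube R) j v) x - wpartial (cube R) i (wpartial (cube R) j w) x)
      ((\<lambda>j x. (\<tau> x - \<tau>' x) $ j) j)" for j
      using H1_trace_diff[OF has_trace_H1_trace[OF \<tau>(1)] has_trace_H1_trace[OF \<tau>'(1)], of j j] by simp
    fix i \<sigma> assume \<sigma>: "\<sigma> \<in> {-1, 1 :: real}"
    have "AE x in face_measure R i \<sigma>. (\<tau> x - \<tau>' x) \<bullet> normal R x = 0"
      using \<tau>(2)[OF \<sigma>] \<tau>'(2)[OF \<sigma>] by eventually_elim (simp add: inner_diff_left)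
    then show "AE x in face_measure R i \<sigma>. (\<lambda>j x. (\<tau> x - \<tau>' x) $ j) i x = 0"
      by (rule normal_trace_face[OF R \<sigma>, where \<tau>="\<lambda>x. \<tau> x - \<tau>' x"])
  qed (rule R)
qed

lemma Lop_partial_continuous:
  assumes "\<And>i j. smooth (\<lambda>x. A x $ i $ j)" "\<And>i. smooth (\<lambda>x. b x $ i)" "smooth f"
  shows "continuous_on UNIV (Lop partial A b f)"
proof -
  have "C1_grad (\<lambda>y. \<Sum>j\<in>UNIV. A y $ i $ j * partial j f y)
    (\<lambda>l x. \<Sum>j\<in>UNIV. partial l (\<lambda>y. A y $ i $ j) x * partial j f x + A x $ i $ j * partial l (partial j f) x)" for i
    by (intro C1_grad_sum C1_grad_mult C1_grad_smooth smooth_partial assms)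
  from C1_grad_partial[OF this]
  have "Lop partial A b f = (\<lambda>x. (\<Sum>i\<in>UNIV. \<Sum>j\<in>UNIV. partial i (\<lambda>y. A y $ i $ j) x * partial j f x + A x $ i $ j * partial i (partial j f) x)
      + (\<Sum>i\<in>UNIV. b x $ i * partial i f x))"
    by (simp add: fun_eq_iff Lop_def divg_def matrix_vector_mult_def grad_def inner_vec_def)
  moreover have "continuous_on UNIV \<dots>"
    by (intro continuous_intros smooth_continuous smooth_partial assms)
  ultimately show ?thesis by simp
qed

section \<open>The pointwise inequality for the difference of two solutions\<close>

lemma abs_sum_mult_le:
  fixes c u :: "'i \<Rightarrow> real"
  assumes "\<And>i. i \<in> J \<Longrightarrow> \<bar>c i\<bar> \<le> B"
  shows "\<bar>\<Sum>i\<in>J. c i * u i\<bar> \<le> B * (\<Sum>i\<in>J. \<bar>u i\<bar>)"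
proof -
  have "\<bar>\<Sum>i\<in>J. c i * u i\<bar> \<le> (\<Sum>i\<in>J. \<bar>c i * u i\<bar>)" by (rule sum_abs)
  also have "\<dots> \<le> (\<Sum>i\<in>J. B * \<bar>u i\<bar>)"
    unfolding abs_mult by (intro sum_mono mult_right_mono assms) auto
  finally show ?thesis by (simp add: sum_distrib_left)
qed

text \<open>The quadratic terms are linearized by v_n v_m - w_n w_m = v_n (v_m - w_m) + (v_n - w_n)
  w_m, with both solutions bounded by \<open>V\<close>; all other terms are linear already. The
  principal parts \<open>av\<close> and \<open>aw\<close> are isolated on the left.\<close>

lemma nonlinear_difference_bound:
  fixes v w :: "'m \<Rightarrow> real" and gv gw :: "'n::finite \<Rightarrow> real"
    and d :: "'n \<Rightarrow> 'n \<Rightarrow> real"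
  assumes I: "finite I" "m \<in> I"
    and ev: "av + (\<Sum>i\<in>UNIV. \<Sum>j\<in>UNIV. d i j * gv j) + (\<Sum>j\<in>UNIV. \<beta> j * gv j)
      - (\<Sum>n\<in>I. s n * v n) - q * v m + (\<Sum>n\<in>I. p n * v n * v m) = 0"
    and ew: "aw + (\<Sum>i\<in>UNIV. \<Sum>j\<in>UNIV. d i j * gw j) + (\<Sum>j\<in>UNIV. \<beta> j * gw j)
      - (\<Sum>n\<in>I. s n * w n) - q * w m + (\<Sum>n\<in>I. p n * w n * w m) = 0"
    and d: "\<And>i j. \<bar>d i j\<bar> \<le> B" and \<beta>: "\<And>j. \<bar>\<beta> j\<bar> \<le> B'" and s: "\<And>n. n \<in> I \<Longrightarrow> \<bar>s n\<bar> \<le> S"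
    and q: "\<bar>q\<bar> \<le> Q" and p: "\<And>n. n \<in> I \<Longrightarrow> \<bar>p n\<bar> \<le> P"
    and V: "\<And>n. n \<in> I \<Longrightarrow> \<bar>v n\<bar> \<le> V" "\<And>n. n \<in> I \<Longrightarrow> \<bar>w n\<bar> \<le> V"
  shows "\<bar>av - aw\<bar> \<le> (real CARD('n) * B + B' + S + Q + P * V * (card I + 1)) *
    ((\<Sum>j\<in>UNIV. \<bar>gv j - gw j\<bar>) + (\<Sum>n\<in>I. \<bar>v n - w n\<bar>))"
proof -
  define g where "g j = gv j - gw j" for j
  define h where "h n = v n - w n" for n
  define X where "X = (\<Sum>j\<in>UNIV. \<bar>g j\<bar>)"
  define H where "H = (\<Sum>n\<in>I. \<bar>h n\<bar>)"
  have X: "X \<ge> 0" and H: "H \<ge> 0" by (auto simp: X_def H_def sum_nonneg)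
  \<comment> \<open>Each bound dominates an absolute value at some index; \<open>m\<close> witnesses
    that the index set is nonempty.\<close>
  have nonneg: "B \<ge> 0" "B' \<ge> 0" "S \<ge> 0" "Q \<ge> 0" "P \<ge> 0" "V \<ge> 0"
    using d[of undefined undefined] \<beta>[of undefined] s[OF I(2)] q p[OF I(2)] V(1)[OF I(2)] by linarith+
  have hm: "\<bar>h m\<bar> \<le> H" unfolding H_def using I by (intro member_le_sum) auto
  have 1: "\<bar>\<Sum>i\<in>UNIV. \<Sum>j\<in>UNIV. d i j * g j\<bar> \<le> real CARD('n) * B * X"
  proof -
    have "\<bar>\<Sum>i\<in>UNIV. \<Sum>j\<in>UNIV. d i j * g j\<bar> \<le> (\<Sum>i\<in>UNIV. \<bar>\<Sum>j\<in>UNIV. d i j * g j\<bar>)" by (rule sum_abs)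
    also have "\<dots> \<le> (\<Sum>i\<in>(UNIV::'n set). B * X)"
      unfolding X_def by (rule sum_mono) (rule abs_sum_mult_le[OF d])
    finally show ?thesis by simp
  qed
  have 2: "\<bar>\<Sum>j\<in>UNIV. \<beta> j * g j\<bar> \<le> B' * X" unfolding X_def by (rule abs_sum_mult_le[OF \<beta>])
  have 3: "\<bar>\<Sum>n\<in>I. s n * h n\<bar> \<le> S * H" unfolding H_def by (rule abs_sum_mult_le[OF s])
  have 4: "\<bar>q * h m\<bar> \<le> Q * H" unfolding abs_mult using q hm nonneg by (intro mult_mono) auto
  have 5: "\<bar>\<Sum>n\<in>I. p n * (v n * h m + h n * w m)\<bar> \<le> P * V * (card I + 1) * H"
  proof -
    have "\<bar>\<Sum>n\<in>I. p n * (v n * h m + h n * w m)\<bar> \<le> P * (\<Sum>n\<in>I. \<bar>v n * h m + h n * w m\<bar>)"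
      by (rule abs_sum_mult_le[OF p])
    also have "\<dots> \<le> P * (\<Sum>n\<in>I. V * H + V * \<bar>h n\<bar>)"
    proof (intro mult_left_mono sum_mono nonneg)
      fix n assume n: "n \<in> I"
      have "\<bar>v n * h m + h n * w m\<bar> \<le> \<bar>v n\<bar> * \<bar>h m\<bar> + \<bar>w m\<bar> * \<bar>h n\<bar>"
        using abs_triangle_ineq[of "v n * h m" "h n * w m"] by (simp add: abs_mult mult.commute)
      also have "\<dots> \<le> V * H + V * \<bar>h n\<bar>"
        using V n I hm nonneg by (intro add_mono mult_mono) auto
      finally show "\<bar>v n * h m + h n * w m\<bar> \<le> V * H + V * \<bar>h n\<bar>" .
    qed
    also have "(\<Sum>n\<in>I. V * H + V * \<bar>h n\<bar>) = V * (card I + 1) * H"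
      by (simp add: sum.distrib H_def sum_distrib_left[symmetric] algebra_simps)
    finally show ?thesis by (simp add: mult.assoc)
  qed
  have e1: "(\<Sum>i\<in>UNIV. \<Sum>j\<in>UNIV. d i j * g j) = (\<Sum>i\<in>UNIV. \<Sum>j\<in>UNIV. d i j * gv j) - (\<Sum>i\<in>UNIV. \<Sum>j\<in>UNIV. d i j * gw j)"
    "(\<Sum>j\<in>UNIV. \<beta> j * g j) = (\<Sum>j\<in>UNIV. \<beta> j * gv j) - (\<Sum>j\<in>UNIV. \<beta> j * gw j)"
    "(\<Sum>n\<in>I. s n * h n) = (\<Sum>n\<in>I. s n * v n) - (\<Sum>n\<in>I. s n * w n)"
    by (simp_all add: g_def h_def right_diff_distrib sum_subtractf)
  have e2: "(\<Sum>n\<in>I. p n * (v n * h m + h n * w m)) = (\<Sum>n\<in>I. p n * v n * v m) - (\<Sum>n\<in>I. p n * w n * w m)"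
    unfolding sum_subtractf[symmetric] by (rule sum.cong) (auto simp: h_def algebra_simps)
  have e3: "q * h m = q * v m - q * w m" by (simp add: h_def algebra_simps)
  have "\<bar>av - aw\<bar> \<le> (real CARD('n) * B + B') * X + (S + Q + P * V * (card I + 1)) * H"
    using ev ew 1 2 3 4 5 e1 e2 e3 by (simp add: distrib_right abs_le_iff)
  \<comment> \<open>Nonnegative cross terms are added so that both sums share one constant.\<close>
  also have "\<dots> \<le> (real CARD('n) * B + B') * X + (S + Q + P * V * (card I + 1)) * H
    + (real CARD('n) * B + B') * H + (S + Q + P * V * (card I + 1)) * X"
    using nonneg X H by simp
  finally show ?thesis by (simp add: X_def H_def g_def h_def algebra_simps)
qed

lemma AE_bounded_family:
  assumes "finite I" "\<And>m. m \<in> I \<Longrightarrow> v m \<in> Linf M"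
  obtains V where "AE x in M. \<forall>m\<in>I. \<bar>v m x\<bar> \<le> V"
proof -
  have "\<exists>C. AE x in M. \<bar>v m x\<bar> \<le> C" if "m \<in> I" for m
    using assms(2)[OF that] by (auto simp: Linf_def)
  then obtain C where C: "\<And>m. m \<in> I \<Longrightarrow> AE x in M. \<bar>v m x\<bar> \<le> C m" by metis
  have "AE x in M. \<forall>m\<in>I. \<bar>v m x\<bar> \<le> C m"
    using C by (intro AE_finite_allI assms(1))
  then have "AE x in M. \<forall>m\<in>I. \<bar>v m x\<bar> \<le> (\<Sum>m\<in>I. \<bar>C m\<bar>)"
  proof eventually_elim
    case (elim x)
    show ?case
    proof
      fix m assume m: "m \<in> I"
      have "\<bar>C m\<bar> \<le> (\<Sum>m\<in>I. \<bar>C m\<bar>)" using assms(1) m by (intro member_le_sum) auto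
      then show "\<bar>v m x\<bar> \<le> (\<Sum>m\<in>I. \<bar>C m\<bar>)" using elim m by fastforce
    qed
  qed
  then show thesis by (rule that)
qed

lemma positive_lower_bound_cube:
  fixes f :: "real^'n::finite \<Rightarrow> real"
  assumes "R > 0" "continuous_on UNIV f" "\<And>x. x \<in> closure (cube R) \<Longrightarrow> f x > 0"
  obtains \<delta> where "\<delta> > 0" "\<And>x. x \<in> cube R \<Longrightarrow> f x \<ge> \<delta>"
proof -
  have "compact (closure (cube R :: (real^'n) set))" unfolding cube_def by (simp add: compact_closure)
  moreover have "0 \<in> (cube R :: (real^'n) set)" using assms(1) by (simp add: mem_cube)
  ultimately obtain x0 where "x0 \<in> closure (cube R)" "\<And>x. x \<in> closure (cube R) \<Longrightarrow> f x0 \<le> f x"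
    using continuous_attains_inf[of "closure (cube R)" f] continuous_on_subset[OF assms(2)] closure_subset
    by (metis empty_iff subset_UNIV subsetD)
  then show thesis using assms(3) closure_subset by (intro that[of "f x0"]) auto
qed

lemma system_solution_unique:
  fixes R T :: real
    and A :: "real^'n::finite \<Rightarrow> real^'n^'n"
    and v w :: "nat \<Rightarrow> real^'n \<Rightarrow> real"
  assumes R: "R > 0"
    and A_smooth: "\<And>i j. smooth (\<lambda>x. A x $ i $ j)"
    and A_sym: "\<And>x. transpose (A x) = A x"
    and A_elliptic: "\<exists>\<mu>>0. \<forall>x \<xi>. (A x *v \<xi>) \<bullet> \<xi> \<ge> \<mu> * (norm \<xi>)\<^sup>2"
    and b_smooth: "\<And>i. smooth (\<lambda>x. b x $ i)"
    and f_smooth: "smooth f"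
    and f_pos: "\<And>x. x \<in> closure (cube R) \<Longrightarrow> f x > 0"
    and v_sol: "system_solution R T A b f N F G v"
    and w_sol: "system_solution R T A b f N F G w"
  shows "\<forall>m\<in>{1..N}. AE x in QM R. v m x = w m x"
proof -
  obtain \<mu> where \<mu>: "\<mu> > 0" "\<And>x \<xi>. (A x *v \<xi>) \<bullet> \<xi> \<ge> \<mu> * (norm \<xi>)\<^sup>2" using A_elliptic by blast
  interpret elliptic_coeff R \<mu> "\<lambda>i j x. A x $ i $ j" "\<lambda>i j l. partial l (\<lambda>x. A x $ i $ j)"
  proof
    show "C1_grad (\<lambda>x. A x $ i $ j) (\<lambda>l. partial l (\<lambda>x. A x $ i $ j))" for i j
      by (rule C1_grad_smooth[OF A_smooth])
    show "A x $ i $ j = A x $ j $ i" for i j x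
      using A_sym[of x] by (metis transpose_def vec_lambda_beta)
    fix x and \<xi> :: "'n \<Rightarrow> real"
    have "(norm (\<chi> i. \<xi> i))\<^sup>2 = (\<Sum>i\<in>UNIV. (\<xi> i)\<^sup>2)"
      unfolding power2_norm_eq_inner by (simp add: inner_vec_def power2_eq_square)
    moreover have "(A x *v (\<chi> i. \<xi> i)) \<bullet> (\<chi> i. \<xi> i) = (\<Sum>i\<in>UNIV. \<Sum>j\<in>UNIV. A x $ i $ j * \<xi> i * \<xi> j)"
      by (simp add: inner_vec_def matrix_vector_mult_def sum_distrib_left mult_ac)
    ultimately show "\<mu> * (\<Sum>i\<in>UNIV. (\<xi> i)\<^sup>2) \<le> (\<Sum>i\<in>UNIV. \<Sum>j\<in>UNIV. A x $ i $ j * \<xi> i * \<xi> j)"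
      using \<mu>(2)[where x=x and \<xi>="\<chi> i. \<xi> i"] by simp
  qed (fact R \<mu>(1))+
  let ?I = "{1..N}"
  let ?D = "wpartial (cube R) :: 'n \<Rightarrow> (real^'n \<Rightarrow> real) \<Rightarrow> real^'n \<Rightarrow> real"
  have v: "v m \<in> Linf (QM R)" "has_trace R (v m) (F m)" "has_normal_trace R (v m) (G m)"
    and v_eq: "AE x in QM R. Lop ?D A b (v m) x - (\<Sum>n=1..N. smat T m n * v n x)
      - Lop partial A b f x / f x * v m x + (\<Sum>n=1..N. Psi T n 0 / f x * v n x * v m x) = 0" if "m \<in> ?I" for m
    using v_sol that unfolding system_solution_def by auto
  have w: "w m \<in> Linf (QM R)" "has_trace R (w m) (F m)" "has_normal_trace R (w m) (G m)"
    and w_eq: "AE x in QM R. Lop ?D A b (w m) x - (\<Sum>n=1..N. smat T m n * w n x)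
      - Lop partial A b f x / f x * w m x + (\<Sum>n=1..N. Psi T n 0 / f x * w n x * w m x) = 0" if "m \<in> ?I" for m
    using w_sol that unfolding system_solution_def by auto
  \<comment> \<open>\<open>has_normal_trace\<close> supplies traces of all first derivatives, which
    is what the expansion asks for.\<close>
  have expand: "AE x in QM R. Lop ?D A b u x = (\<Sum>i\<in>UNIV. \<Sum>j\<in>UNIV. A x $ i $ j * ?D i (?D j u) x)
    + (\<Sum>i\<in>UNIV. \<Sum>j\<in>UNIV. partial i (\<lambda>y. A y $ i $ j) x * ?D j u x) + (\<Sum>j\<in>UNIV. b x $ j * ?D j u x)"
    if nt: "has_normal_trace R u g" for u g
  proof -
    obtain \<tau> where "\<And>j. has_trace R (?D j u) (\<lambda>x. \<tau> x $ j)"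
      using nt unfolding has_normal_trace_def by blast
    then show ?thesis by (rule Lop_wpartial_expand[OF R A_smooth])
  qed
  obtain B where B: "\<And>z x. x \<in> cube R \<Longrightarrow> \<bar>(case z of (i, j) \<Rightarrow> partial i (\<lambda>y. A y $ i $ j)) x\<bar> \<le> B"
    by (rule bounded_family[of "\<lambda>z. case z of (i, j) \<Rightarrow> partial i (\<lambda>y. A y $ i $ j)" R])
      (use smooth_continuous[OF smooth_partial[OF A_smooth]] in \<open>auto split: prod.splits\<close>)
  obtain B' where B': "\<And>j x. x \<in> cube R \<Longrightarrow> \<bar>b x $ j\<bar> \<le> B'"
    by (rule bounded_family[of "\<lambda>j x. b x $ j" R]) (use smooth_continuous[OF b_smooth] in auto)
  obtain BL where BL: "\<And>z::unit. \<And>x. x \<in> cube R \<Longrightarrow> \<bar>Lop partial A b f x\<bar> \<le> BL"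
    by (rule bounded_family[of "\<lambda>_. Lop partial A b f" R])
      (use Lop_partial_continuous[OF A_smooth b_smooth f_smooth] in auto)
  \<comment> \<open>A positive minimum of \<open>f\<close> on the closed cube bounds the
    coefficients with denominator \<open>f\<close>.\<close>
  obtain \<delta> where \<delta>: "\<delta> > 0" "\<And>x. x \<in> cube R \<Longrightarrow> f x \<ge> \<delta>"
    using positive_lower_bound_cube[OF R smooth_continuous[OF f_smooth] f_pos] by blast
  obtain V where V: "AE x in QM R. \<forall>m\<in>?I. \<bar>v m x\<bar> \<le> V"
    using AE_bounded_family[of ?I v "QM R"] v(1) by blast
  obtain W where W: "AE x in QM R. \<forall>m\<in>?I. \<bar>w m x\<bar> \<le> W"
    using AE_bounded_family[of ?I w "QM R"] w(1) by blast
  define S where "S = (\<Sum>m\<in>?I. \<Sum>n\<in>?I. \<bar>smat T m n\<bar>)"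
  have S: "\<bar>smat T m n\<bar> \<le> S" if "m \<in> ?I" "n \<in> ?I" for m n
  proof -
    have "\<bar>smat T m n\<bar> \<le> (\<Sum>n\<in>?I. \<bar>smat T m n\<bar>)" using that by (intro member_le_sum) auto
    also have "\<dots> \<le> S" unfolding S_def using that by (intro member_le_sum) (auto intro: sum_nonneg)
    finally show ?thesis .
  qed
  define P where "P = (\<Sum>n\<in>?I. \<bar>Psi T n 0\<bar>)"
  have P: "\<bar>Psi T n 0\<bar> \<le> P" if "n \<in> ?I" for n
    unfolding P_def using that by (intro member_le_sum) auto
  \<comment> \<open>The outer absolute value gives nonnegativity at once, without tracking the signs
    of the individual bounds.\<close>
  define C where "C = \<bar>real CARD('n) * B + B' + S + BL / \<delta> + P / \<delta> * max V W * (card ?I + 1)\<bar>"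
  have le: "AE x in QM R. \<bar>Aop (\<lambda>i j x. ?D i (?D j (v m)) x - ?D i (?D j (w m)) x) x\<bar>
      \<le> C * ((\<Sum>j\<in>UNIV. \<bar>?D j (v m) x - ?D j (w m) x\<bar>) + (\<Sum>n\<in>?I. \<bar>v n x - w n x\<bar>))" if m: "m \<in> ?I" for m
    using v_eq[OF m] w_eq[OF m] expand[OF v(3)[OF m]] expand[OF w(3)[OF m]] V W AE_cube
  proof eventually_elim
    case (elim x)
    have f: "f x \<ge> \<delta>" "f x > 0" using \<delta> elim(7) by (auto intro: less_le_trans)
    have div: "\<bar>y / f x\<bar> \<le> Y / \<delta>" if "\<bar>y\<bar> \<le> Y" for y Y
    proof -
      have "\<bar>y\<bar> / f x \<le> Y / \<delta>" using that f \<delta>(1) by (intro frac_le) auto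
      then show ?thesis using f by simp
    qed
    have *: "\<bar>(\<Sum>i\<in>UNIV. \<Sum>j\<in>UNIV. A x $ i $ j * ?D i (?D j (v m)) x) - (\<Sum>i\<in>UNIV. \<Sum>j\<in>UNIV. A x $ i $ j * ?D i (?D j (w m)) x)\<bar>
      \<le> (real CARD('n) * B + B' + S + BL / \<delta> + P / \<delta> * max V W * (card ?I + 1)) *
       ((\<Sum>j\<in>UNIV. \<bar>?D j (v m) x - ?D j (w m) x\<bar>) + (\<Sum>n\<in>?I. \<bar>v n x - w n x\<bar>))"
    proof (rule nonlinear_difference_bound[OF _ m, where v="\<lambda>n. v n x" and w="\<lambda>n. w n x"
        and gv="\<lambda>j. ?D j (v m) x" and gw="\<lambda>j. ?D j (w m) x"
        and d="\<lambda>i j. partial i (\<lambda>y. A y $ i $ j) x" and \<beta>="\<lambda>j. b x $ j" and s="smat T m"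
        and q="Lop partial A b f x / f x" and p="\<lambda>n. Psi T n 0 / f x"])
      show "\<bar>partial i (\<lambda>y. A y $ i $ j) x\<bar> \<le> B" for i j using B[OF elim(7), of "(i, j)"] by simp
      show "\<bar>Psi T n 0 / f x\<bar> \<le> P / \<delta>" if "n \<in> ?I" for n by (rule div[OF P[OF that]])
      show "\<bar>Lop partial A b f x / f x\<bar> \<le> BL / \<delta>" by (rule div[OF BL[OF elim(7)]])
    qed (use elim m S B' in \<open>auto simp: le_max_iff_disj\<close>)
    also have "\<dots> \<le> C * ((\<Sum>j\<in>UNIV. \<bar>?D j (v m) x - ?D j (w m) x\<bar>) + (\<Sum>n\<in>?I. \<bar>v n x - w n x\<bar>))"
      unfolding C_def by (intro mult_right_mono abs_ge_self add_nonneg_nonneg sum_nonneg) auto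
    finally show ?case by (simp add: Aop_def right_diff_distrib sum_subtractf)
  qed
  show ?thesis
  proof
    fix m assume m: "m \<in> ?I"
    have "AE x in QM R. v m x - w m x = 0"
      by (rule unique_continuation[of ?I "\<lambda>m x. v m x - w m x" "\<lambda>m j x. ?D j (v m) x - ?D j (w m) x"
            "\<lambda>m i j x. ?D i (?D j (v m)) x - ?D i (?D j (w m)) x" C m])
        (use m le system_difference_H20[OF R v(2,3) w(2,3)] in \<open>auto simp: C_def\<close>)
    then show "AE x in QM R. v m x = w m x" by simp
  qed
qed

theorem theorem3p1:
  fixes R T :: real
    and A :: "real^'n::finite \<Rightarrow> real^'n^'n"
    and b :: "real^'n \<Rightarrow> real^'n"
    and f c :: "real^'n \<Rightarrow> real"
    and u :: "real^'n \<Rightarrow> real \<Rightarrow> real"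
    and N :: nat
    and v w :: "nat \<Rightarrow> real^'n \<Rightarrow> real"
  assumes "CARD('n) \<ge> 2" and "R > 0" and "T > 0" and "N > 0"
    and A_smooth: "\<And>i j. smooth (\<lambda>x. A x $ i $ j)"
    and A_sym: "\<And>x. transpose (A x) = A x"
    and A_elliptic: "\<exists>\<mu>>0. \<forall>x \<xi>. (A x *v \<xi>) \<bullet> \<xi> \<ge> \<mu> * (norm \<xi>)\<^sup>2"
    and A_id: "\<And>x. x \<notin> cube R \<Longrightarrow> A x = mat 1"
    and b_smooth: "\<And>i. smooth (\<lambda>x. b x $ i)"
    and f_smooth: "smooth f"
    and f_support: "compact (support f)"
    and f_pos: "\<And>x. x \<in> closure (cube R) \<Longrightarrow> f x > 0"
    and u_sol: "parabolic_solution A b c f u"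
    and F_defined: "\<And>x m. x \<in> frontier (cube R) \<Longrightarrow> m \<in> {1..N} \<Longrightarrow> time_coeff_defined T m (u x)"
    and G_defined: "\<And>x m. x \<in> face_points R \<Longrightarrow> m \<in> {1..N} \<Longrightarrow>
      time_coeff_defined T m (flux R A u x)"
    and v_sol: "system_solution R T A b f N
      (\<lambda>m x. time_coeff T m (u x)) (\<lambda>m x. time_coeff T m (flux R A u x)) v"
    and w_sol: "system_solution R T A b f N
      (\<lambda>m x. time_coeff T m (u x)) (\<lambda>m x. time_coeff T m (flux R A u x)) w"
  shows "\<forall>m\<in>{1..N}. AE x in lebesgue_on (cube R). v m x = w m x"
  using assms(2) A_smooth A_sym A_elliptic b_smooth f_smooth f_pos v_sol w_sol
  by (rule system_solution_unique)

end
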